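(* Let $k$ be any field and let $X\subset\mathbb{P}^3_k$ be a smooth cubic surface over $k$. Then the number of lines on $X$ defined over $k$ is one of $0,1,2,3,5,7,9,15,27$.
   Context: A line on $X$ defined over $k$ means a line $L\subset\mathbb{P}^3_k$ (cut out by linear forms with coefficients in $k$) such that $L\subseteq X$ as schemes (not merely that the $k$-rational points of $L$ lie on $X$). *)

theory Defs
  imports "HOL-Computational_Algebra.Polynomial" "HOL-Algebra.Algebraic_Closure_Type"
begin

text \<open>A cubic form in the four homogeneous coordinates x0,x1,x2,x3 of P^3 over a field k
  is given by its coefficients c(a,b,c,d) of the monomials x0^a x1^b x2^c x3^d with
  a+b+c+d = 3.  Points of affine 4-space are functions nat => 'a (coordinates 0..3).\<close>

definition cubic_monos :: "(nat \<times> nat \<times> nat \<times> nat) set" where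
  "cubic_monos = {(a,b,c,d). a + b + c + d = 3}"

text \<open>Evaluation of the form at a point with coordinates in a commutative ring,
  after transporting coefficients along h (e.g. an embedding of k into an extension,
  or the constant-polynomial map k -> k[t]).\<close>
definition form_eval ::
  "('k \<Rightarrow> 'a::comm_ring_1) \<Rightarrow> (nat \<times> nat \<times> nat \<times> nat \<Rightarrow> 'k) \<Rightarrow> (nat \<Rightarrow> 'a) \<Rightarrow> 'a" where
  "form_eval h F x =
     (\<Sum>(a,b,c,d)\<in>cubic_monos. h (F (a,b,c,d)) * x 0 ^ a * x 1 ^ b * x 2 ^ c * x 3 ^ d)"

definition form_deriv_eval ::
  "('k \<Rightarrow> 'a::comm_ring_1) \<Rightarrow> (nat \<times> nat \<times> nat \<times> nat \<Rightarrow> 'k) \<Rightarrow> nat \<Rightarrow> (nat \<Rightarrow> 'a) \<Rightarrow> 'a" where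
  "form_deriv_eval h F i x =
     (\<Sum>(a,b,c,d)\<in>cubic_monos.
        let e = (\<lambda>j::nat. if j = 0 then a else if j = 1 then b else if j = 2 then c else d)
        in h (F (a,b,c,d)) * of_nat (e i) *
           (\<Prod>j\<in>{0..3::nat}. x j ^ (if j = i then e j - 1 else e j)))"

text \<open>Smoothness of the cubic surface X = V(F) in P^3_k: X is geometrically smooth,
  i.e. (Jacobian criterion) there is no nonzero point over the algebraic closure of k
  at which F and all four partial derivatives vanish.\<close>
definition smooth_cubic_surface :: "(nat \<times> nat \<times> nat \<times> nat \<Rightarrow> 'k::field) \<Rightarrow> bool" where
  "smooth_cubic_surface F \<longleftrightarrow>
     \<not> (\<exists>x :: nat \<Rightarrow> 'k alg_closure.
          (\<exists>i\<in>{0..3}. x i \<noteq> 0) \<and> form_eval to_ac F x = 0 \<and>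
          (\<forall>i\<in>{0..3}. form_deriv_eval to_ac F i x = 0))"

definition vec4 :: "(nat \<Rightarrow> 'k::field) set" where
  "vec4 = {v. \<forall>i\<ge>4. v i = 0}"

definition lin_indep2 :: "(nat \<Rightarrow> 'k::field) \<Rightarrow> (nat \<Rightarrow> 'k) \<Rightarrow> bool" where
  "lin_indep2 u v \<longleftrightarrow> (\<forall>s t. (\<forall>i. s * u i + t * v i = 0) \<longrightarrow> s = 0 \<and> t = 0)"

definition span2 :: "(nat \<Rightarrow> 'k::field) \<Rightarrow> (nat \<Rightarrow> 'k) \<Rightarrow> (nat \<Rightarrow> 'k) set" where
  "span2 u v = {(\<lambda>i. s * u i + t * v i) | s t. True}"

text \<open>The line L = P(span(u,v)) lies on X scheme-theoretically iff F restricted to L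
  is the zero binary cubic form, i.e. F(u + t v) = 0 in k[t] (F homogeneous).\<close>
definition line_on_surface :: "(nat \<times> nat \<times> nat \<times> nat \<Rightarrow> 'k::field) \<Rightarrow> (nat \<Rightarrow> 'k) \<Rightarrow> (nat \<Rightarrow> 'k) \<Rightarrow> bool" where
  "line_on_surface F u v \<longleftrightarrow> form_eval (\<lambda>a. [:a:]) F (\<lambda>j. [:u j, v j:]) = 0"

definition k_lines :: "(nat \<times> nat \<times> nat \<times> nat \<Rightarrow> 'k::field) \<Rightarrow> (nat \<Rightarrow> 'k) set set" where
  "k_lines F = {span2 u v | u v. u \<in> vec4 \<and> v \<in> vec4 \<and> lin_indep2 u v \<and> line_on_surface F u v}"

end

theory Submission
  imports Defs "HOL-Analysis.Cartesian_Space" "HOL-Computational_Algebra.Polynomial_Factorial"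
begin

text \<open>
  If no two rational lines are skew, any two of them span a plane cutting out a third line, and since
  lines through a common point of a smooth surface are coplanar there are 0, 1 or 3 of them.
  Otherwise take skew rational lines L and M as coordinate lines and write the cubic form as
  A(x; y) + B(x; y) with A of bidegree (2,1) and B of bidegree (1,2). Eliminating y gives a binary quintic f
  over k, squarefree by smoothness. Its rational zeros are the rational common transversals of L and M, and each
  of them has one partner meeting only L and one meeting only M (the third lines in the planes it spans
  with L and with M). A line skew to both is the graph of an isomorphism L \<rightarrow> M, and these graphs correspond to
  the rational factorizations of f into a cubic and a quadratic form. So the number of rational lines
  is 2 + 3 r + q, where r and q count linear and quadratic rational factors of f, and the factorization
  type of f leaves only the values 2, 3, 5, 7, 9, 15, 27.
\<close>

section \<open>Linear substitutions in cubic forms\<close>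

text \<open>Over an arbitrary field there are no Galois arguments to start from: lines are counted
  over k itself, and the closure enters only through smoothness. Characteristics 2 and 3 forbid
  halving and recovering F from its gradient, so the identities avoid dividing by integers. Why
  graphs match factorizations: on the graph of \<phi> : L \<rightarrow> M the equation reads A(x;
  \<phi>(x)) = - B(x; \<phi>(x)). Where the cubic form g = A(x; \<phi>(x)) vanishes, \<phi>(x) is
  the zero of the linear form A(x; -) and also a zero of B(x; -). Since f is the value of B(x; -) at
  the zero of A(x; -), it vanishes there too, and g divides f. Conversely, every cubic form g is
  A(x; \<phi>(x)) for exactly one linear \<phi>, pairs of linear forms and cubic forms both being
  4-dimensional. If g divides f, then B(x; \<phi>(x)) is a constant multiple of g, and rescaling
  \<phi>, which acts linearly on A and quadratically on B, turns the constant into -1.\<close>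

definition ring_hom_fun :: "('a::comm_ring_1 \<Rightarrow> 'b::comm_ring_1) \<Rightarrow> bool" where
  "ring_hom_fun h \<longleftrightarrow> h 0 = 0 \<and> h 1 = 1 \<and> (\<forall>a b. h (a + b) = h a + h b) \<and> (\<forall>a b. h (a * b) = h a * h b)"

lemma ring_hom_fun_simps:
  assumes "ring_hom_fun h"
  shows "h 0 = 0" "h 1 = 1" "h (a + b) = h a + h b" "h (a * b) = h a * h b"
    "h (sum g A) = (\<Sum>x\<in>A. h (g x))" "h (- a) = - h a" "h (a - b) = h a - h b"
    "h (a ^ n) = h a ^ n"
proof -
  show 1: "h 0 = 0" "h 1 = 1" and 2: "h (a + b) = h a + h b" and "h (a * b) = h a * h b" for a b
    using assms by (auto simp: ring_hom_fun_def)
  have "h a + h (- a) = 0" for a using 1 2[of a "- a"] by simp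
  then show 3: "h (- a) = - h a" for a
    by (simp add: eq_neg_iff_add_eq_0 add.commute)
  show "h (a - b) = h a - h b" using 2[of a "- b"] 3 by simp
  show "h (sum g A) = (\<Sum>x\<in>A. h (g x))"
    by (induction A rule: infinite_finite_induct) (auto simp: 1 2)
  show "h (a ^ n) = h a ^ n"
    by (induction n) (use assms in \<open>auto simp: ring_hom_fun_def\<close>)
qed

lemma ring_hom_fun_to_ac: "ring_hom_fun to_ac"
  by (simp add: ring_hom_fun_def)

lemma ring_hom_fun_const_poly: "ring_hom_fun (\<lambda>c. [:c:])"
  by (simp add: ring_hom_fun_def)

lemma ring_hom_fun_const_poly_comp: "ring_hom_fun h \<Longrightarrow> ring_hom_fun (\<lambda>c. [:h c:])"
  by (simp add: ring_hom_fun_def)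

lemma ring_hom_fun_id: "ring_hom_fun (\<lambda>c. c)"
  by (simp add: ring_hom_fun_def)

lemma cubic_monos_eq: "cubic_monos = {(3,0,0,0),(0,3,0,0),(0,0,3,0),(0,0,0,3),(2,1,0,0),(2,0,1,0),(2,0,0,1),(1,2,0,0),(0,2,1,0),(0,2,0,1),(1,0,2,0),(0,1,2,0),(0,0,2,1),(1,0,0,2),(0,1,0,2),(0,0,1,2),(1,1,1,0),(1,1,0,1),(1,0,1,1),(0,1,1,1)}"
  (is "_ = ?S")
proof
  have *: "(a,b,c,d) \<in> ?S" if "a + b + c + d = 3" for a b c d :: nat
  proof -
    have "a = 0 \<or> a = 1 \<or> a = 2 \<or> a = 3" "b = 0 \<or> b = 1 \<or> b = 2 \<or> b = 3"
      "c = 0 \<or> c = 1 \<or> c = 2 \<or> c = 3" and d: "d = 3 - a - b - c"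
      using that by linarith+
    then show ?thesis
      using that unfolding d by (elim disjE) simp_all
  qed
  show "cubic_monos \<subseteq> ?S"
  proof
    fix m :: "nat \<times> nat \<times> nat \<times> nat" assume m: "m \<in> cubic_monos"
    obtain a b c d where "m = (a,b,c,d)" by (cases m)
    with m *[of a b c d] show "m \<in> ?S" by (simp only: cubic_monos_def mem_Collect_eq prod.case)
  qed
  show "?S \<subseteq> cubic_monos"
    by (simp add: cubic_monos_def)
qed

lemma finite_cubic_monos: "finite cubic_monos"
  by (simp add: cubic_monos_eq)

lemma sum_less4: "(\<Sum>i<4. f i) = f 0 + f 1 + f 2 + f (3::nat)" for f :: "nat \<Rightarrow> 'b::comm_monoid_add"
  by (simp add: eval_nat_numeral ac_simps)

text \<open>The exponent vector of x_i x_j x_k.\<close>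

definition mono_of :: "nat \<Rightarrow> nat \<Rightarrow> nat \<Rightarrow> nat \<times> nat \<times> nat \<times> nat" where
  "mono_of i j k = (let c = (\<lambda>n. of_bool (i = n) + of_bool (j = n) + of_bool (k = n)) in (c 0, c 1, c 2, c 3))"

text \<open>A non-symmetric tensor representing the form: the coefficient of each monomial is placed at the
  sorted index triple.\<close>
definition cubic_tensor :: "(nat \<times> nat \<times> nat \<times> nat \<Rightarrow> 'k::field) \<Rightarrow> nat \<Rightarrow> nat \<Rightarrow> nat \<Rightarrow> 'k" where
  "cubic_tensor F i j k = (if i \<le> j \<and> j \<le> k then F (mono_of i j k) else 0)"

lemma form_eval_expand:
  "form_eval h F x =
     h (F (3,0,0,0)) * x 0 ^ 3 + h (F (0,3,0,0)) * x 1 ^ 3 + h (F (0,0,3,0)) * x 2 ^ 3 + h (F (0,0,0,3)) * x 3 ^ 3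
   + h (F (2,1,0,0)) * x 0 ^ 2 * x 1 + h (F (2,0,1,0)) * x 0 ^ 2 * x 2 + h (F (2,0,0,1)) * x 0 ^ 2 * x 3
   + h (F (1,2,0,0)) * x 0 * x 1 ^ 2 + h (F (0,2,1,0)) * x 1 ^ 2 * x 2 + h (F (0,2,0,1)) * x 1 ^ 2 * x 3
   + h (F (1,0,2,0)) * x 0 * x 2 ^ 2 + h (F (0,1,2,0)) * x 1 * x 2 ^ 2 + h (F (0,0,2,1)) * x 2 ^ 2 * x 3
   + h (F (1,0,0,2)) * x 0 * x 3 ^ 2 + h (F (0,1,0,2)) * x 1 * x 3 ^ 2 + h (F (0,0,1,2)) * x 2 * x 3 ^ 2
   + h (F (1,1,1,0)) * x 0 * x 1 * x 2 + h (F (1,1,0,1)) * x 0 * x 1 * x 3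
   + h (F (1,0,1,1)) * x 0 * x 2 * x 3 + h (F (0,1,1,1)) * x 1 * x 2 * x 3"
  unfolding form_eval_def cubic_monos_eq by (simp add: ac_simps)

lemma form_eval_tensor:
  assumes "h 0 = 0"
  shows "form_eval h F x = (\<Sum>i<4. \<Sum>j<4. \<Sum>k<4. h (cubic_tensor F i j k) * x i * x j * x k)"
  unfolding form_eval_expand sum_less4 cubic_tensor_def mono_of_def
  by (simp add: assms numeral_2_eq_2 numeral_3_eq_3 ac_simps)

text \<open>The coefficients of F composed with x \<mapsto> \<Sum> x_i u_i, so \<open>u i\<close> is
  the image of the i-th axis vector. Each monomial collects the index triples producing it.\<close>

definition form_subst :: "(nat \<times> nat \<times> nat \<times> nat \<Rightarrow> 'k::field) \<Rightarrow> (nat \<Rightarrow> nat \<Rightarrow> 'k) \<Rightarrow> (nat \<times> nat \<times> nat \<times> nat \<Rightarrow> 'k)" where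
  "form_subst F u m = (\<Sum>(a,b,c)\<in>{..<4}\<times>{..<4}\<times>{..<4}. if mono_of a b c = m then
     (\<Sum>i<4. \<Sum>j<4. \<Sum>k<4. cubic_tensor F i j k * u a i * u b j * u c k) else 0)"

lemma mono_of_in: "a < 4 \<Longrightarrow> b < 4 \<Longrightarrow> c < 4 \<Longrightarrow> mono_of a b c \<in> cubic_monos"
  unfolding cubic_monos_def mono_of_def Let_def
  by (auto simp: less_Suc_eq eval_nat_numeral)

lemma form_eval_mono_of:
  fixes x :: "nat \<Rightarrow> 'a::comm_ring_1"
  assumes "a < 4" "b < 4" "c < 4"
  shows "(case mono_of a b c of (p,q,r,s) \<Rightarrow> x 0 ^ p * x 1 ^ q * x 2 ^ r * x 3 ^ s) = x a * x b * x c"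
proof -
  have 1: "x 0 ^ of_bool (i = 0) * x 1 ^ of_bool (i = 1) * x 2 ^ of_bool (i = 2) * x 3 ^ of_bool (i = 3) = x i"
    if "i < 4" for i :: nat
    using that by (auto simp: less_Suc_eq eval_nat_numeral)
  have "(case mono_of a b c of (p,q,r,s) \<Rightarrow> x 0 ^ p * x 1 ^ q * x 2 ^ r * x 3 ^ s) =
    (x 0 ^ of_bool (a = 0) * x 1 ^ of_bool (a = 1) * x 2 ^ of_bool (a = 2) * x 3 ^ of_bool (a = 3)) *
    (x 0 ^ of_bool (b = 0) * x 1 ^ of_bool (b = 1) * x 2 ^ of_bool (b = 2) * x 3 ^ of_bool (b = 3)) *
    (x 0 ^ of_bool (c = 0) * x 1 ^ of_bool (c = 1) * x 2 ^ of_bool (c = 2) * x 3 ^ of_bool (c = 3))"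
    unfolding mono_of_def Let_def by (simp only: prod.case power_add ac_simps)
  then show ?thesis using assms by (simp only: 1)
qed

text \<open>One rule along any ring homomorphism serves three purposes: constant polynomials decide
  whether a line lies on the surface, the embedding into the closure evaluates at geometric points,
  and constant polynomials over the closure carry derivatives.\<close>

lemma form_eval_subst:
  fixes x :: "nat \<Rightarrow> 'a::comm_ring_1"
  assumes h: "ring_hom_fun h"
  shows "form_eval h (form_subst F u) x = form_eval h F (\<lambda>j. \<Sum>i<4. x i * h (u i j))"
proof -
  note hs = ring_hom_fun_simps[OF h]
  define t where "t a b c = h (\<Sum>i<4. \<Sum>j<4. \<Sum>k<4. cubic_tensor F i j k * u a i * u b j * u c k)" for a b c
  define M where "M m = (case m of (p,q,r,s) \<Rightarrow> x 0 ^ p * x 1 ^ q * x 2 ^ r * x 3 ^ s)" for m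
  let ?I = "{..<4} \<times> {..<4} \<times> {..<4::nat}"
  have hif: "h (if P then y else 0) = (if P then h y else 0)" for P y by (simp add: hs)
  have "form_eval h (form_subst F u) x = (\<Sum>m\<in>cubic_monos. h (form_subst F u m) * M m)"
    unfolding form_eval_def M_def by (intro sum.cong) (auto simp: ac_simps)
  also have "\<dots> = (\<Sum>m\<in>cubic_monos. \<Sum>(a,b,c)\<in>?I. if mono_of a b c = m then t a b c * M m else 0)"
    unfolding form_subst_def hs(5) sum_distrib_right t_def[symmetric]
    by (intro sum.cong refl) (auto simp: hs(1) t_def)
  also have "\<dots> = (\<Sum>(a,b,c)\<in>?I. \<Sum>m\<in>cubic_monos. if mono_of a b c = m then t a b c * M m else 0)"
    by (subst sum.swap) (simp add: case_prod_unfold)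
  also have "\<dots> = (\<Sum>(a,b,c)\<in>?I. t a b c * M (mono_of a b c))"
    by (intro sum.cong refl) (auto simp: finite_cubic_monos mono_of_in)
  also have "\<dots> = (\<Sum>(a,b,c)\<in>?I. t a b c * (x a * x b * x c))"
    by (intro sum.cong refl) (auto simp: M_def form_eval_mono_of[unfolded One_nat_def])
  also have "\<dots> = (\<Sum>a<4. \<Sum>b<4. \<Sum>c<4. t a b c * (x a * x b * x c))"
    by (simp add: sum.cartesian_product)
  also have "\<dots> = (\<Sum>a<4. \<Sum>b<4. \<Sum>c<4. \<Sum>i<4. \<Sum>j<4. \<Sum>k<4.
      h (cubic_tensor F i j k) * (x a * h (u a i)) * (x b * h (u b j)) * (x c * h (u c k)))"
    unfolding t_def hs sum_distrib_right by (intro sum.cong refl) (simp add: hs ac_simps)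
  also have "\<dots> = (\<Sum>i<4. \<Sum>j<4. \<Sum>k<4. \<Sum>a<4. \<Sum>b<4. \<Sum>c<4.
      h (cubic_tensor F i j k) * (x a * h (u a i)) * (x b * h (u b j)) * (x c * h (u c k)))"
  proof -
    have sw: "(\<Sum>a<4. \<Sum>b<4. \<Sum>c<4. \<Sum>i<4. \<Sum>j<4. \<Sum>k<4. g a b c i j k)
      = (\<Sum>i<4. \<Sum>j<4. \<Sum>k<4. \<Sum>a<4. \<Sum>b<4. \<Sum>c<4. g a b c i j k)"
      for g :: "nat \<Rightarrow> nat \<Rightarrow> nat \<Rightarrow> nat \<Rightarrow> nat \<Rightarrow> nat \<Rightarrow> 'a"
    proof -
      have "(\<Sum>(a,b,c)\<in>?I. \<Sum>(i,j,k)\<in>?I. g a b c i j k) = (\<Sum>(i,j,k)\<in>?I. \<Sum>(a,b,c)\<in>?I. g a b c i j k)"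
        unfolding case_prod_unfold by (rule sum.swap)
      moreover have triple: "(\<Sum>a<4. \<Sum>b<4. \<Sum>c<4. f a b c) = (\<Sum>(a,b,c)\<in>?I. f a b c)"
        for f :: "nat \<Rightarrow> nat \<Rightarrow> nat \<Rightarrow> 'a"
        by (simp add: sum.cartesian_product)
      ultimately show ?thesis by (simp only: triple)
    qed
    show ?thesis by (rule sw)
  qed
  also have "\<dots> = form_eval h F (\<lambda>j. \<Sum>i<4. x i * h (u i j))"
    unfolding form_eval_tensor[of h, OF hs(1)]
    by (simp only: sum_distrib_left[symmetric] sum_distrib_right[symmetric])
  finally show ?thesis .
qed

section \<open>First-order terms and partial derivatives\<close>

lemma coeff0_lin_power: "coeff ([:x, y:] ^ n) 0 = x ^ n" for x :: "'a::comm_ring_1"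
  by (simp add: coeff_0_power)

lemma coeff1_mult: "coeff (p * q) 1 = coeff p 0 * coeff q 1 + coeff p 1 * coeff q (0::nat)"
  for p :: "'a::comm_ring_1 poly"
  by (simp add: coeff_mult)

lemma coeff1_const: "coeff [:c:] (1::nat) = 0"
  by simp

lemma coeff1_lin_power: "coeff ([:x, y:] ^ n) 1 = of_nat n * x ^ (n - 1) * y" for x :: "'a::comm_ring_1"
proof (induction n)
  case (Suc n)
  then show ?case
    unfolding power_Suc coeff1_mult Suc.IH coeff0_lin_power
    by (cases n) (simp_all add: algebra_simps)
qed simp

text \<open>Derivatives are read off over the dual numbers, so that the chain rule for linear substitutions
  becomes an instance of the evaluation rule over a polynomial ring.\<close>
lemma form_deriv_eval_eq_coeff:
  fixes x :: "nat \<Rightarrow> 'a::comm_ring_1"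
  shows "coeff (form_eval (\<lambda>c. [:h c:]) F (\<lambda>j. [:x j, y j:])) 1 = (\<Sum>i<4. y i * form_deriv_eval h F i x)"
proof -
  have "y 0 * form_deriv_eval h F 0 x + y 1 * form_deriv_eval h F 1 x + y 2 * form_deriv_eval h F 2 x + y 3 * form_deriv_eval h F 3 x
    = (\<Sum>m\<in>cubic_monos. case m of (a,b,c,d) \<Rightarrow> h (F (a,b,c,d)) * 
        (of_nat a * x 0 ^ (a - 1) * y 0 * x 1 ^ b * x 2 ^ c * x 3 ^ d
        + x 0 ^ a * (of_nat b * x 1 ^ (b - 1) * y 1) * x 2 ^ c * x 3 ^ d
        + x 0 ^ a * x 1 ^ b * (of_nat c * x 2 ^ (c - 1) * y 2) * x 3 ^ d
        + x 0 ^ a * x 1 ^ b * x 2 ^ c * (of_nat d * x 3 ^ (d - 1) * y 3)))"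
    unfolding form_deriv_eval_def sum_distrib_left sum.distrib[symmetric] Let_def
  proof (intro sum.cong refl, goal_cases)
    case (1 m)
    obtain a b c d where m: "m = (a,b,c,d)" by (cases m)
    have p: "(\<Prod>j\<in>{0..3::nat}. g j) = g 0 * g 1 * g 2 * (g 3 :: 'a)" for g
      by (simp add: eval_nat_numeral atLeast0_atMost_Suc ac_simps)
    have r: "y0 * (H * N0 * (D0 * P1 * P2 * P3)) + y1 * (H * N1 * (P0 * D1 * P2 * P3)) +
        y2 * (H * N2 * (P0 * P1 * D2 * P3)) + y3 * (H * N3 * (P0 * P1 * P2 * D3))
      = H * (N0 * D0 * y0 * P1 * P2 * P3 + P0 * (N1 * D1 * y1) * P2 * P3 + P0 * P1 * (N2 * D2 * y2) * P3
        + P0 * P1 * P2 * (N3 * D3 * y3))"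
      for y0 y1 y2 y3 H N0 N1 N2 N3 D0 D1 D2 D3 P0 P1 P2 P3 :: 'a
      by (simp add: algebra_simps)
    have i: "0 \<noteq> (1::nat)" "0 \<noteq> (2::nat)" "0 \<noteq> (3::nat)" "1 \<noteq> (2::nat)" "1 \<noteq> (3::nat)" "2 \<noteq> (3::nat)"
      "1 \<noteq> (0::nat)" "2 \<noteq> (0::nat)" "3 \<noteq> (0::nat)" "2 \<noteq> (1::nat)" "3 \<noteq> (1::nat)" "3 \<noteq> (2::nat)"
      by simp_all
    show ?case unfolding m p prod.case by (simp only: r[symmetric] i if_True if_False refl simp_thms)
  qed
  also have "\<dots> = coeff (form_eval (\<lambda>c. [:h c:]) F (\<lambda>j. [:x j, y j:])) 1"
    unfolding form_eval_def coeff_sum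
  proof (intro sum.cong refl, goal_cases)
    case (1 m)
    obtain a b c d where m: "m = (a,b,c,d)" by (cases m)
    show ?case unfolding m prod.case coeff1_mult coeff_mult_0 coeff1_lin_power coeff0_lin_power coeff_pCons_0 coeff1_const mult_zero_left add_0_left mult_zero_right
      by (simp only: algebra_simps mult_zero_left add_0_left)
  qed
  finally show ?thesis by (simp add: sum_less4)
qed

section \<open>Bases of \<open>k^4\<close> and invariance of smoothness\<close>

definition lin_map :: "(nat \<Rightarrow> nat \<Rightarrow> 'k::comm_ring_1) \<Rightarrow> (nat \<Rightarrow> 'k) \<Rightarrow> nat \<Rightarrow> 'k" where
  "lin_map u x = (\<lambda>j. \<Sum>i<4. x i * u i j)"

text \<open>Both products with the inverse \<open>w\<close> are recorded because smoothness uses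
  both: w u = 1 recovers the partial derivatives of F, u w = 1 recovers the point.\<close>

definition basis4 :: "(nat \<Rightarrow> nat \<Rightarrow> 'k::field) \<Rightarrow> bool" where
  "basis4 u \<longleftrightarrow> (\<forall>i<4. u i \<in> vec4) \<and> (\<exists>w. \<forall>i<4. \<forall>j<4.
     (\<Sum>l<4. u i l * w l j) = of_bool (i = j) \<and> (\<Sum>l<4. w i l * u l j) = of_bool (i = j))"

text \<open>Translates the index type \<open>4\<close>, whose matrix calculus supplies inverses and
  dimensions, into the indices 0 to 3.\<close>

definition coord4 :: "4 \<Rightarrow> nat" where
  "coord4 r = (if r = 1 then 0 else if r = 2 then 1 else if r = 3 then 2 else 3)"

definition vec_of :: "(nat \<Rightarrow> 'k) \<Rightarrow> 'k^4" where
  "vec_of v = (\<chi> r. v (coord4 r))"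

lemma numerals_4_distinct: "(1::4) \<noteq> 2" "(1::4) \<noteq> 3" "(1::4) \<noteq> 4" "(2::4) \<noteq> 3" "(2::4) \<noteq> 4" "(3::4) \<noteq> 4"
  by simp_all

lemma coord4_simps [simp]: "coord4 1 = 0" "coord4 2 = 1" "coord4 3 = 2" "coord4 4 = 3"
  using numerals_4_distinct by (simp_all add: coord4_def)

lemma bij_coord4: "bij_betw coord4 UNIV {..<4}"
proof -
  have "inj coord4"
    unfolding inj_def using exhaust_4 numerals_4_distinct coord4_simps
    by (smt (verit) One_nat_def numeral_eq_iff numeral_One semiring_norm zero_neq_numeral zero_neq_one)
  moreover have "range coord4 = {..<4}"
    by (simp add: UNIV_4 eval_nat_numeral lessThan_Suc) auto
  ultimately show ?thesis by (simp add: bij_betw_def)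
qed

lemma sum_coord4: "(\<Sum>r\<in>UNIV. f (coord4 r)) = (\<Sum>i<4. f i)"
  using sum.reindex_bij_betw[OF bij_coord4] .

lemma coord4_surj: "i < 4 \<Longrightarrow> \<exists>r. i = coord4 r"
  using bij_coord4 unfolding bij_betw_def by auto

text \<open>An injective square matrix has a left inverse, which is then also a right inverse; so
  independence is all that has to be checked later.\<close>

lemma basis4I:
  fixes u :: "nat \<Rightarrow> nat \<Rightarrow> 'k::field"
  assumes u: "\<And>i. i < 4 \<Longrightarrow> u i \<in> vec4"
    and inj: "\<And>x i. (\<And>j. j < 4 \<Longrightarrow> lin_map u x j = 0) \<Longrightarrow> i < 4 \<Longrightarrow> x i = 0"
  shows "basis4 u"
proof -
  define A :: "'k^4^4" where "A = (\<chi> c r. u (coord4 r) (coord4 c))"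
  have "x = 0" if "A *v x = 0" for x
  proof -
    define x' where "x' i = x $ (the_inv coord4 i)" for i
    have x': "x' (coord4 r) = x $ r" for r
      unfolding x'_def by (simp add: the_inv_f_f bij_betw_imp_inj_on[OF bij_coord4])
    have "lin_map u x' j = 0" if j: "j < 4" for j
    proof -
      obtain c where c: "j = coord4 c" using coord4_surj[OF j] by auto
      have "lin_map u x' j = (A *v x) $ c"
        unfolding lin_map_def c by (simp add: sum_coord4[symmetric] x' A_def matrix_vector_mult_def mult.commute)
      then show ?thesis using \<open>A *v x = 0\<close> by simp
    qed
    then have "x' i = 0" if "i < 4" for i using inj that by blast
    then have "x $ r = 0" for r using x'[of r] bij_betwE[OF bij_coord4] by (metis UNIV_I lessThan_iff)
    then show ?thesis by (simp add: vec_eq_iff)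
  qed
  then have "inj ((*v) A)"
    using vec.linear_inj_iff_eq_0[OF matrix_vector_mul_linear_gen[of A]] by blast
  then obtain B where B: "B ** A = mat 1"
    using matrix_left_invertible_injective by blast
  then have B': "A ** B = mat 1" using matrix_left_right_inverse by blast
  define w where "w l j = B $ (the_inv coord4 j) $ (the_inv coord4 l)" for l j
  have w: "w (coord4 l) (coord4 j) = B $ j $ l" for l j
    unfolding w_def by (simp add: the_inv_f_f bij_betw_imp_inj_on[OF bij_coord4])
  have injc: "coord4 r = coord4 c \<longleftrightarrow> r = c" for r c
    using bij_betw_imp_inj_on[OF bij_coord4] by (auto dest: injD)
  have "(\<Sum>l<4. u i l * w l j) = of_bool (i = j) \<and> (\<Sum>l<4. w i l * u l j) = of_bool (i = j)"
    if ij: "i < 4" "j < 4" for i j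
  proof -
    obtain r c where rc: "i = coord4 r" "j = coord4 c" using coord4_surj ij by blast
    have "(\<Sum>l<4. u i l * w l j) = (B ** A) $ c $ r"
      unfolding rc by (simp add: sum_coord4[symmetric] w A_def matrix_matrix_mult_def mult.commute)
    moreover have "(\<Sum>l<4. w i l * u l j) = (A ** B) $ c $ r"
      unfolding rc by (simp add: sum_coord4[symmetric] w A_def matrix_matrix_mult_def mult.commute)
    ultimately show ?thesis unfolding B B' rc by (auto simp: mat_def injc)
  qed
  then show ?thesis unfolding basis4_def using u by blast
qed

text \<open>Three vectors span at most 3 dimensions, so some c lies outside. In a linear relation c
  has coefficient 0, since dividing by it would put c into the span.\<close>

lemma basis4_extend:
  fixes p a b :: "nat \<Rightarrow> 'k::field"
  assumes v: "p \<in> vec4" "a \<in> vec4" "b \<in> vec4"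
    and ind: "\<And>s t r. (\<And>j. j < 4 \<Longrightarrow> s * p j + t * a j + r * b j = 0) \<Longrightarrow> s = 0 \<and> t = 0 \<and> r = 0"
  shows "\<exists>c\<in>vec4. basis4 (\<lambda>i. if i = 0 then p else if i = 1 then a else if i = 2 then b else c)"
proof -
  let ?S = "{vec_of p, vec_of a, vec_of b}"
  have "vec.dim ?S \<le> card ?S" by (rule vec.dim_le_card') simp
  also have "card ?S \<le> 3" by (simp add: card_insert_if)
  finally have "vec.dim (vec.span ?S) < vec.dim (UNIV :: ('k^4) set)"
    by (simp add: vec.dim_UNIV card_cart_basis)
  then have "vec.span ?S \<noteq> UNIV" by (metis less_irrefl vec.dim_span)
  then obtain y where y: "y \<notin> vec.span ?S" by auto
  define c where "c i = (if i < 4 then y $ (the_inv coord4 i) else 0)" for i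
  have cr: "c (coord4 r) = y $ r" for r
    using bij_betwE[OF bij_coord4] unfolding c_def
    by (simp add: the_inv_f_f bij_betw_imp_inj_on[OF bij_coord4])
  have cv: "c \<in> vec4" by (simp add: c_def vec4_def)
  let ?u = "\<lambda>i::nat. if i = 0 then p else if i = 1 then a else if i = 2 then b else c"
  have "basis4 ?u"
  proof (rule basis4I)
    show "?u i \<in> vec4" for i using v cv by auto
    fix x i assume x: "\<And>j. j < 4 \<Longrightarrow> lin_map ?u x j = 0" and i: "i < (4::nat)"
    have e: "x 0 * p j + x 1 * a j + x 2 * b j + x 3 * c j = 0" if "j < 4" for j
      using x[OF that] by (simp add: lin_map_def sum_less4)
    have x3: "x 3 = 0"
    proof (rule ccontr)
      assume n: "x 3 \<noteq> 0"
      have "y = (- x 0 / x 3) *s vec_of p + (- x 1 / x 3) *s vec_of a + (- x 2 / x 3) *s vec_of b"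
      proof (rule iffD2[OF vec_eq_iff], rule allI)
        fix r :: 4
        have "coord4 r < 4" using bij_betwE[OF bij_coord4] by auto
        from e[OF this] have "x 3 * y $ r = - x 0 * p (coord4 r) - x 1 * a (coord4 r) - x 2 * b (coord4 r)"
          unfolding cr by (simp add: algebra_simps eq_neg_iff_add_eq_0)
        then have "y $ r = (- x 0 * p (coord4 r) - x 1 * a (coord4 r) - x 2 * b (coord4 r)) / x 3"
          using n by (simp add: eq_divide_eq mult.commute)
        then show "y $ r = ((- x 0 / x 3) *s vec_of p + (- x 1 / x 3) *s vec_of a + (- x 2 / x 3) *s vec_of b) $ r"
          by (simp add: diff_divide_distrib vec_of_def)
      qed
      also have "\<dots> \<in> vec.span ?S"
        by (intro vec.span_add vec.span_scale vec.span_base) auto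
      finally show False using y by blast
    qed
    have "x 0 = 0 \<and> x 1 = 0 \<and> x 2 = 0"
      using e x3 by (intro ind) auto
    then show "x i = 0" using x3 i by (auto simp: eval_nat_numeral less_Suc_eq)
  qed
  then show ?thesis using cv by blast
qed

lemma form_eval_cong: "(\<And>j. j < 4 \<Longrightarrow> x j = y j) \<Longrightarrow> form_eval h F x = form_eval h F y"
  unfolding form_eval_expand by simp

text \<open>A singular point x of the substituted form is carried to the point y = x u, which is
  singular on the original surface.\<close>

lemma smooth_form_subst:
  fixes F :: "nat \<times> nat \<times> nat \<times> nat \<Rightarrow> 'k::field"
  assumes s: "smooth_cubic_surface F" and b: "basis4 u"
  shows "smooth_cubic_surface (form_subst F u)"
proof (rule ccontr)
  assume "\<not> ?thesis"
  then obtain x :: "nat \<Rightarrow> 'k alg_closure" where x: "\<exists>i\<in>{0..3}. x i \<noteq> 0"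
    and ev: "form_eval to_ac (form_subst F u) x = 0"
    and dv: "\<forall>i\<in>{0..3}. form_deriv_eval to_ac (form_subst F u) i x = 0"
    unfolding smooth_cubic_surface_def by blast
  obtain w where w: "\<And>i j. i < 4 \<Longrightarrow> j < 4 \<Longrightarrow> (\<Sum>l<4. u i l * w l j) = of_bool (i = j)"
     "\<And>i j. i < 4 \<Longrightarrow> j < 4 \<Longrightarrow> (\<Sum>l<4. w i l * u l j) = of_bool (i = j)"
    using b unfolding basis4_def by blast
  define y where "y j = (\<Sum>i<4. x i * to_ac (u i j))" for j
  have ev': "form_eval to_ac F y = 0"
    using ev unfolding form_eval_subst[OF ring_hom_fun_to_ac] y_def .
  have dv': "form_deriv_eval to_ac F l y = 0" if l: "l < 4" for l
  proof -
    \<comment> \<open>Row l of the inverse is the direction that the substitution sends to the l-th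
      axis vector. The derivative of the substituted form along it is therefore the l-th partial
      derivative of F at y.\<close>
    define e where "e i = to_ac (w l i)" for i
    have e: "(\<Sum>i<4. e i * to_ac (u i j)) = of_bool (l = j)" if "j < 4" for j
      using arg_cong[OF w(2)[OF l that], of to_ac] by (simp add: e_def to_ac_sum)
    have "0 = (\<Sum>i<4. e i * form_deriv_eval to_ac (form_subst F u) i x)"
      using dv by (simp add: sum_less4)
    also have "\<dots> = coeff (form_eval (\<lambda>c. [:to_ac c:]) (form_subst F u) (\<lambda>j. [:x j, e j:])) 1"
      by (rule form_deriv_eval_eq_coeff[symmetric])
    also have "\<dots> = coeff (form_eval (\<lambda>c. [:to_ac c:]) F (\<lambda>j. \<Sum>i<4. [:x i, e i:] * [:to_ac (u i j):])) 1"
      by (simp only: form_eval_subst[OF ring_hom_fun_const_poly_comp[OF ring_hom_fun_to_ac]])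
    also have "form_eval (\<lambda>c. [:to_ac c:]) F (\<lambda>j. \<Sum>i<4. [:x i, e i:] * [:to_ac (u i j):])
      = form_eval (\<lambda>c. [:to_ac c:]) F (\<lambda>j. [:y j, of_bool (l = j):])"
      by (rule form_eval_cong) (simp add: y_def e[symmetric] sum_less4 mult.commute)
    also have "coeff \<dots> 1 = (\<Sum>i<4. of_bool (l = i) * form_deriv_eval to_ac F i y)"
      by (rule form_deriv_eval_eq_coeff)
    also have "\<dots> = form_deriv_eval to_ac F l y"
      using l by (subst sum.remove[of _ l]) auto
    finally show ?thesis by simp
  qed
  have "\<exists>j<4. y j \<noteq> 0"
  proof (rule ccontr)
    assume "\<not> ?thesis"
    then have y0: "y j = 0" if "j < 4" for j using that by blast
    have "x i = 0" if i: "i < 4" for i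
    proof -
      have "0 = (\<Sum>j<4. y j * to_ac (w j i))" using y0 by simp
      also have "\<dots> = (\<Sum>j<4. \<Sum>l<4. x l * to_ac (u l j * w j i))"
        unfolding y_def sum_distrib_right by (simp add: mult.assoc)
      also have "\<dots> = (\<Sum>l<4. x l * to_ac (\<Sum>j<4. u l j * w j i))"
        unfolding to_ac_sum sum_distrib_left by (rule sum.swap)
      also have "\<dots> = (\<Sum>l<4. x l * of_bool (l = i))"
        using i by (intro sum.cong refl) (simp add: w)
      also have "\<dots> = x i" using i by (subst sum.remove[of _ i]) auto
      finally show ?thesis by simp
    qed
    then have "x i = 0" if "i \<in> {0..3}" for i using that by auto
    then show False using x by blast
  qed
  then show False using s ev' dv' unfolding smooth_cubic_surface_def
by fastforce
qed

section \<open>Rational lines\<close>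

lemma prod_0_3: "(\<Prod>j\<in>{0..3::nat}. g j) = g 0 * g 1 * g 2 * (g 3 :: 'a::comm_monoid_mult)"
  by (simp add: eval_nat_numeral atLeast0_atMost_Suc ac_simps)

lemma form_deriv_eval_expand:
  fixes x :: "nat \<Rightarrow> 'a::comm_ring_1"
  shows "form_deriv_eval h F 0 x = 3 * h (F (3,0,0,0)) * x 0 ^ 2 + 2 * h (F (2,1,0,0)) * x 0 * x 1
     + 2 * h (F (2,0,1,0)) * x 0 * x 2 + 2 * h (F (2,0,0,1)) * x 0 * x 3 + h (F (1,2,0,0)) * x 1 ^ 2
     + h (F (1,0,2,0)) * x 2 ^ 2 + h (F (1,0,0,2)) * x 3 ^ 2 + h (F (1,1,1,0)) * x 1 * x 2
     + h (F (1,1,0,1)) * x 1 * x 3 + h (F (1,0,1,1)) * x 2 * x 3" (is ?A)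
  and "form_deriv_eval h F 1 x = 3 * h (F (0,3,0,0)) * x 1 ^ 2 + h (F (2,1,0,0)) * x 0 ^ 2
     + 2 * h (F (1,2,0,0)) * x 0 * x 1 + 2 * h (F (0,2,1,0)) * x 1 * x 2 + 2 * h (F (0,2,0,1)) * x 1 * x 3
     + h (F (0,1,2,0)) * x 2 ^ 2 + h (F (0,1,0,2)) * x 3 ^ 2 + h (F (1,1,1,0)) * x 0 * x 2
     + h (F (1,1,0,1)) * x 0 * x 3 + h (F (0,1,1,1)) * x 2 * x 3" (is ?B)
  and "form_deriv_eval h F 2 x = 3 * h (F (0,0,3,0)) * x 2 ^ 2 + h (F (2,0,1,0)) * x 0 ^ 2
     + h (F (0,2,1,0)) * x 1 ^ 2 + 2 * h (F (1,0,2,0)) * x 0 * x 2 + 2 * h (F (0,1,2,0)) * x 1 * x 2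
     + 2 * h (F (0,0,2,1)) * x 2 * x 3 + h (F (0,0,1,2)) * x 3 ^ 2 + h (F (1,1,1,0)) * x 0 * x 1
     + h (F (1,0,1,1)) * x 0 * x 3 + h (F (0,1,1,1)) * x 1 * x 3" (is ?C)
  and "form_deriv_eval h F 3 x = 3 * h (F (0,0,0,3)) * x 3 ^ 2 + h (F (2,0,0,1)) * x 0 ^ 2
     + h (F (0,2,0,1)) * x 1 ^ 2 + h (F (0,0,2,1)) * x 2 ^ 2 + 2 * h (F (1,0,0,2)) * x 0 * x 3
     + 2 * h (F (0,1,0,2)) * x 1 * x 3 + 2 * h (F (0,0,1,2)) * x 2 * x 3 + h (F (1,1,0,1)) * x 0 * x 1
     + h (F (1,0,1,1)) * x 0 * x 2 + h (F (0,1,1,1)) * x 1 * x 2" (is ?D)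
proof -
  show ?A ?B ?C ?D
    unfolding form_deriv_eval_def cubic_monos_eq Let_def prod_0_3 by (simp_all add: ac_simps)
qed

lemma smooth_no_singular_point:
  fixes G :: "nat \<times> nat \<times> nat \<times> nat \<Rightarrow> 'k::field"
  assumes "smooth_cubic_surface G"
    and "\<And>i. i < 4 \<Longrightarrow> form_deriv_eval to_ac G i x = 0" "form_eval to_ac G x = 0" "i < 4"
  shows "x i = 0"
proof (rule ccontr)
  assume "x i \<noteq> 0"
  then have "\<exists>i\<in>{0..3}. x i \<noteq> 0" using assms(4) by (intro bexI[of _ i]) auto
  moreover have "\<forall>i\<in>{0..3}. form_deriv_eval to_ac G i x = 0" using assms(2) by auto
  ultimately show False using assms(1,3) unfolding smooth_cubic_surface_def by blast
qed

definition frame4 :: "(nat \<Rightarrow> 'k::zero) \<Rightarrow> (nat \<Rightarrow> 'k) \<Rightarrow> (nat \<Rightarrow> 'k) \<Rightarrow> (nat \<Rightarrow> 'k) \<Rightarrow> nat \<Rightarrow> nat \<Rightarrow> 'k" where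
  "frame4 p a b c = (\<lambda>i. if i = 0 then p else if i = 1 then a else if i = 2 then b else c)"

lemma frame4_simps [simp]:
  "frame4 p a b c 0 = p" "frame4 p a b c 1 = a" "frame4 p a b c (Suc 0) = a"
  "frame4 p a b c 2 = b" "frame4 p a b c 3 = c"
  by (simp_all add: frame4_def)

text \<open>In coordinates starting with u and v, restriction to the line keeps exactly the
  monomials in x0 and x1, whatever a and b are.\<close>

lemma line_on_surface_iff_coeffs:
  fixes F :: "nat \<times> nat \<times> nat \<times> nat \<Rightarrow> 'k::field"
  shows "line_on_surface F u v \<longleftrightarrow> form_subst F (frame4 u v a b) (3,0,0,0) = 0 \<and>
    form_subst F (frame4 u v a b) (2,1,0,0) = 0 \<and> form_subst F (frame4 u v a b) (1,2,0,0) = 0 \<and>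
    form_subst F (frame4 u v a b) (0,3,0,0) = 0"
proof -
  let ?G = "form_subst F (frame4 u v a b)"
  define x where "x i = (if i = 0 then 1 else if i = 1 then [:0,1:] else 0::'k poly)" for i :: nat
  have "form_eval (\<lambda>a. [:a:]) F (\<lambda>j. [:u j, v j:]) = form_eval (\<lambda>a. [:a:]) ?G x"
    unfolding form_eval_subst[OF ring_hom_fun_const_poly]
    by (intro form_eval_cong) (simp add: sum_less4 x_def one_pCons)
  also have "\<dots> = [:?G (3,0,0,0), ?G (2,1,0,0), ?G (1,2,0,0), ?G (0,3,0,0):]"
    unfolding form_eval_expand x_def by (simp add: eval_nat_numeral)
  finally show ?thesis unfolding line_on_surface_def by simp
qed

text \<open>The parameters s and t may lie in any ring receiving k: linear polynomials give changes
  of basis, scalars give rational points.\<close>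

lemma line_on_surface_vanish:
  fixes F :: "nat \<times> nat \<times> nat \<times> nat \<Rightarrow> 'k::field"
  assumes "line_on_surface F u v" and h: "ring_hom_fun h"
  shows "form_eval h F (\<lambda>j. s * h (u j) + t * h (v j)) = 0"
proof -
  let ?G = "form_subst F (frame4 u v (\<lambda>_. 0) (\<lambda>_. 0))"
  define x where "x i = (if i = 0 then s else if i = 1 then t else 0)" for i :: nat
  have "form_eval h F (\<lambda>j. s * h (u j) + t * h (v j)) = form_eval h ?G x"
    unfolding form_eval_subst[OF h] by (intro form_eval_cong) (simp add: sum_less4 x_def)
  also have "\<dots> = 0"
    using assms(1)[unfolded line_on_surface_iff_coeffs[of F u v "\<lambda>_. 0" "\<lambda>_. 0"]]
    unfolding form_eval_expand x_def by (simp add: ring_hom_fun_simps[OF h])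
  finally show ?thesis .
qed

section \<open>Lines as two-dimensional subspaces of \<open>k^4\<close>\<close>

lemma span2_iff: "x \<in> span2 u v \<longleftrightarrow> (\<exists>s t. x = (\<lambda>i. s * u i + t * v i))"
  unfolding span2_def by auto

lemma span2_memI: "(\<lambda>i. s * u i + t * v i) \<in> span2 u v"
  unfolding span2_def by auto

lemma span2_base: "u \<in> span2 u v" "v \<in> span2 u v"
  using span2_memI[of 1 u 0 v] span2_memI[of 0 u 1 v] by simp_all

lemma span2_closed:
  assumes "x \<in> span2 u v" "y \<in> span2 u v"
  shows "(\<lambda>i. s * x i + t * y i) \<in> span2 u v"
proof -
  obtain a b c d where "x = (\<lambda>i. a * u i + b * v i)" "y = (\<lambda>i. c * u i + d * v i)"
    using assms unfolding span2_iff by blast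
  then have "(\<lambda>i. s * x i + t * y i) = (\<lambda>i. (s * a + t * c) * u i + (s * b + t * d) * v i)"
    by (simp add: algebra_simps)
  then show ?thesis unfolding span2_iff by blast
qed

lemma span2_mono: "x \<in> span2 u v \<Longrightarrow> y \<in> span2 u v \<Longrightarrow> span2 x y \<subseteq> span2 u v"
  using span2_closed unfolding span2_iff[of _ x y] by (auto simp: subset_iff span2_iff[of _ x y])

lemma span2_eqI:
  fixes u v :: "nat \<Rightarrow> 'k::field"
  assumes xy: "x \<in> span2 u v" "y \<in> span2 u v" and ind: "lin_indep2 x y"
  shows "span2 x y = span2 u v"
proof
  show "span2 x y \<subseteq> span2 u v" by (rule span2_mono[OF xy])
  obtain a b c d where x: "x = (\<lambda>i. a * u i + b * v i)" and y: "y = (\<lambda>i. c * u i + d * v i)"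
    using xy unfolding span2_iff by blast
  let ?D = "a * d - b * c"
  have D: "?D \<noteq> 0"
  proof
    assume D: "?D = 0"
    have ind': "s = 0 \<and> t = 0" if "\<And>i. s * x i + t * y i = 0" for s t
      using ind that unfolding lin_indep2_def by blast
    \<comment> \<open>If the determinant is 0, Cramer's combinations of x and y vanish, and
      independence then kills all four coefficients.\<close>
    have "d = 0 \<and> - b = 0"
    proof (rule ind')
      fix i
      have "d * x i + - b * y i = ?D * u i" unfolding x y by (simp add: algebra_simps)
      then show "d * x i + - b * y i = 0" using D by simp
    qed
    moreover have "- c = 0 \<and> a = 0"
    proof (rule ind')
      fix i
      have "- c * x i + a * y i = ?D * v i" unfolding x y by (simp add: algebra_simps)
      then show "- c * x i + a * y i = 0" using D by simp
    qed
    ultimately show False using ind'[of 1 0] by (auto simp: x y)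
  qed
  have "u = (\<lambda>i. (d / ?D) * x i + (- b / ?D) * y i)"
  proof
    fix i
    have "?D * u i = d * x i + - b * y i" unfolding x y by (simp add: algebra_simps)
    then have "u i = (d * x i + - b * y i) / ?D" using D by (simp add: eq_divide_eq mult.commute)
    then show "u i = (d / ?D) * x i + (- b / ?D) * y i" by (simp add: add_divide_distrib diff_divide_distrib)
  qed
  moreover have "v = (\<lambda>i. (- c / ?D) * x i + (a / ?D) * y i)"
  proof
    fix i
    have "?D * v i = - c * x i + a * y i" unfolding x y by (simp add: algebra_simps)
    then have "v i = (- c * x i + a * y i) / ?D" using D by (simp add: eq_divide_eq mult.commute)
    then show "v i = (- c / ?D) * x i + (a / ?D) * y i" by (simp add: add_divide_distrib diff_divide_distrib)
  qed
  ultimately show "span2 u v \<subseteq> span2 x y"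
    by (intro span2_mono) (unfold span2_iff, blast+)
qed

lemma line_on_surface_basis_change:
  fixes F :: "nat \<times> nat \<times> nat \<times> nat \<Rightarrow> 'k::field"
  assumes l: "line_on_surface F u v" and xy: "x \<in> span2 u v" "y \<in> span2 u v"
  shows "line_on_surface F x y"
proof -
  obtain a b c d where x: "x = (\<lambda>i. a * u i + b * v i)" and y: "y = (\<lambda>i. c * u i + d * v i)"
    using xy unfolding span2_iff by blast
  have "form_eval (\<lambda>a. [:a:]) F (\<lambda>j. [:a, c:] * [:u j:] + [:b, d:] * [:v j:]) = 0"
    by (rule line_on_surface_vanish[OF l ring_hom_fun_const_poly])
  then show ?thesis unfolding line_on_surface_def x y by (simp add: mult.commute)
qed

lemma vec4_combine: "u \<in> vec4 \<Longrightarrow> v \<in> vec4 \<Longrightarrow> (\<lambda>i. s * u i + t * v i) \<in> vec4"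
  by (simp add: vec4_def)

lemma span2_vec4: "u \<in> vec4 \<Longrightarrow> v \<in> vec4 \<Longrightarrow> span2 u v \<subseteq> vec4"
  unfolding span2_def using vec4_combine by blast

lemma k_linesE:
  assumes "L \<in> k_lines F"
  obtains u v where "L = span2 u v" "u \<in> vec4" "v \<in> vec4" "lin_indep2 u v" "line_on_surface F u v"
  using assms unfolding k_lines_def by blast

lemma k_lines_basis:
  fixes F :: "nat \<times> nat \<times> nat \<times> nat \<Rightarrow> 'k::field"
  assumes "L \<in> k_lines F" "x \<in> L" "y \<in> L" "lin_indep2 x y"
  shows "L = span2 x y" "x \<in> vec4" "y \<in> vec4" "line_on_surface F x y"
proof -
  obtain u v where uv: "L = span2 u v" "u \<in> vec4" "v \<in> vec4" "line_on_surface F u v"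
    using assms(1) by (rule k_linesE)
  show "L = span2 x y" using span2_eqI[of x u v y] assms uv by simp
  show "x \<in> vec4" "y \<in> vec4" using span2_vec4[of u v] uv assms(2,3) by auto
  show "line_on_surface F x y" using line_on_surface_basis_change[of F u v x y] uv assms by simp
qed

lemma span2_in_k_lines_iff:
  fixes F :: "nat \<times> nat \<times> nat \<times> nat \<Rightarrow> 'k::field"
  assumes "x \<in> vec4" "y \<in> vec4" "lin_indep2 x y"
  shows "span2 x y \<in> k_lines F \<longleftrightarrow> line_on_surface F x y"
proof
  assume "span2 x y \<in> k_lines F"
  then show "line_on_surface F x y" by (rule k_lines_basis(4)) (use assms span2_base in auto)
qed (use assms in \<open>auto simp: k_lines_def\<close>)

lemma k_lines_subset_vec4: "L \<in> k_lines F \<Longrightarrow> L \<subseteq> vec4"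
  by (elim k_linesE) (simp add: span2_vec4)

lemma k_lines_closed: "L \<in> k_lines F \<Longrightarrow> x \<in> L \<Longrightarrow> y \<in> L \<Longrightarrow> (\<lambda>i. s * x i + t * y i) \<in> L"
  by (elim k_linesE) (simp add: span2_closed)

lemma k_lines_vanish:
  fixes F :: "nat \<times> nat \<times> nat \<times> nat \<Rightarrow> 'k::field"
  assumes "L \<in> k_lines F" "x \<in> L"
  shows "form_eval (\<lambda>c. c) F x = 0"
proof -
  obtain u v where "L = span2 u v" "line_on_surface F u v" using assms(1) by (rule k_linesE)
  then show ?thesis using line_on_surface_vanish[OF _ ring_hom_fun_id] assms(2) by (auto simp: span2_iff)
qed

lemma lin_indep2I:
  fixes x y :: "nat \<Rightarrow> 'k::field"
  assumes "x \<noteq> (\<lambda>_. 0)" "\<And>c. y \<noteq> (\<lambda>i. c * x i)"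
  shows "lin_indep2 x y"
  unfolding lin_indep2_def
proof (intro allI impI)
  fix s t assume e: "\<forall>i. s * x i + t * y i = 0"
  have t: "t = 0"
  proof (rule ccontr)
    assume t: "t \<noteq> 0"
    have "y i = (- s / t) * x i" for i
      using e[rule_format, of i] t by (simp add: field_simps eq_neg_iff_add_eq_0)
    then show False using assms(2)[of "- s / t"] by blast
  qed
  moreover have "s = 0"
  proof (rule ccontr)
    assume "s \<noteq> 0"
    then have "x i = 0" for i using e[rule_format, of i] t by simp
    then show False using assms(1) by auto
  qed
  ultimately show "s = 0 \<and> t = 0" by simp
qed

lemma lin_indep2_nonzero: 
  assumes i: "lin_indep2 x y"
  shows "x \<noteq> (\<lambda>_. 0)" "y \<noteq> (\<lambda>_. 0)"
proof -
  show "x \<noteq> (\<lambda>_. 0)" using i[unfolded lin_indep2_def, rule_format, of 1 0] by auto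
  show "y \<noteq> (\<lambda>_. 0)" using i[unfolded lin_indep2_def, rule_format, of 0 1] by auto
qed

lemma k_lines_through:
  fixes F :: "nat \<times> nat \<times> nat \<times> nat \<Rightarrow> 'k::field"
  assumes L: "L \<in> k_lines F" and p: "p \<in> L" "p \<noteq> (\<lambda>_. 0)"
  obtains a where "a \<in> L" "lin_indep2 p a"
proof -
  obtain u v where uv: "L = span2 u v" "lin_indep2 u v" using L by (rule k_linesE)
  have "\<exists>a\<in>{u,v}. \<forall>c. a \<noteq> (\<lambda>i. c * p i)"
  proof (rule ccontr)
    assume "\<not> ?thesis"
    then obtain c d where c: "u = (\<lambda>i. c * p i)" "v = (\<lambda>i. d * p i)" by auto
    have "d * u i + (- c) * v i = 0" for i by (simp add: c)
    then have "c = 0" using uv(2) unfolding lin_indep2_def by (metis neg_equal_0_iff_equal)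
    then show False using lin_indep2_nonzero(1)[OF uv(2)] c by simp
  qed
  then obtain a where a: "a \<in> {u,v}" "\<forall>c. a \<noteq> (\<lambda>i. c * p i)" by blast
  have "a \<in> L" using a(1) uv(1) span2_base by blast
  moreover have "lin_indep2 p a" by (rule lin_indep2I[OF p(2)]) (use a(2) in blast)
  ultimately show ?thesis by (rule that)
qed

lemma k_lines_two_points:
  fixes F :: "nat \<times> nat \<times> nat \<times> nat \<Rightarrow> 'k::field"
  assumes "L \<in> k_lines F" "M \<in> k_lines F" "L \<noteq> M" "x \<in> L" "x \<in> M" "x \<noteq> (\<lambda>_. 0)" "y \<in> L" "y \<in> M"
  shows "\<exists>c. y = (\<lambda>i. c * x i)"
proof (rule ccontr)
  assume "\<not> ?thesis"
  then have "lin_indep2 x y" using assms by (intro lin_indep2I) auto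
  then show False using k_lines_basis(1)[of L F x y] k_lines_basis(1)[of M F x y] assms by auto
qed

section \<open>Transport of lines along coordinate changes\<close>

lemma lin_map_combine: "lin_map u (\<lambda>i. s * x i + t * y i) = (\<lambda>j. s * lin_map u x j + t * lin_map u y j)"
  unfolding lin_map_def by (simp add: sum_less4 algebra_simps)

lemma lin_map_span2: "lin_map u ` span2 x y = span2 (lin_map u x) (lin_map u y)"
proof (intro equalityI subsetI)
  fix z assume "z \<in> lin_map u ` span2 x y"
  then obtain s t where "z = lin_map u (\<lambda>i. s * x i + t * y i)" unfolding span2_def by blast
  then show "z \<in> span2 (lin_map u x) (lin_map u y)" by (simp add: lin_map_combine span2_memI)
next
  fix z assume "z \<in> span2 (lin_map u x) (lin_map u y)"
  then obtain s t where "z = lin_map u (\<lambda>i. s * x i + t * y i)"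
    unfolding span2_iff lin_map_combine by blast
  then show "z \<in> lin_map u ` span2 x y" using span2_memI by blast
qed

lemma lin_map_vec4: "basis4 u \<Longrightarrow> lin_map u x \<in> vec4"
  unfolding basis4_def lin_map_def vec4_def by (simp add: sum_less4)

lemma bij_lin_map:
  fixes u :: "nat \<Rightarrow> nat \<Rightarrow> 'k::field"
  assumes "basis4 u"
  shows "bij_betw (lin_map u) vec4 vec4"
proof -
  obtain w where w: "\<And>i j. i < 4 \<Longrightarrow> j < 4 \<Longrightarrow> (\<Sum>l<4. u i l * w l j) = of_bool (i = j)"
     "\<And>i j. i < 4 \<Longrightarrow> j < 4 \<Longrightarrow> (\<Sum>l<4. w i l * u l j) = of_bool (i = j)"
    using assms unfolding basis4_def by blast
  define w' where "w' i j = (if j < 4 then w i j else 0)" for i j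
  have inv: "lin_map B (lin_map A x) = x"
    if AB: "\<And>i j. i < 4 \<Longrightarrow> j < 4 \<Longrightarrow> (\<Sum>l<4. A i l * B l j) = of_bool (i = j)" 
      and x: "x \<in> vec4" and B: "\<And>i. i < 4 \<Longrightarrow> B i \<in> vec4" for A B and x :: "nat \<Rightarrow> 'k"
  proof
    fix j
    show "lin_map B (lin_map A x) j = x j"
    proof (cases "j < 4")
      case True
      have "lin_map B (lin_map A x) j = (\<Sum>i<4. x i * (\<Sum>l<4. A i l * B l j))"
        unfolding lin_map_def sum_distrib_right sum_distrib_left by (subst sum.swap) (simp add: mult.assoc)
      also have "\<dots> = (\<Sum>i<4. x i * of_bool (i = j))" using True by (intro sum.cong refl) (simp add: AB)
      also have "\<dots> = x j" using True by (subst sum.remove[of _ j]) auto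
      finally show ?thesis .
    next
      case False
      then show ?thesis using x B by (simp add: lin_map_def vec4_def)
    qed
  qed
  have w'v: "w' i \<in> vec4" for i by (simp add: w'_def vec4_def)
  have uv: "u i \<in> vec4" if "i < 4" for i using assms that by (simp add: basis4_def)
  show ?thesis
  proof (rule bij_betwI)
    show "lin_map u \<in> vec4 \<rightarrow> vec4" using lin_map_vec4[OF assms] by auto
    show "lin_map w' \<in> vec4 \<rightarrow> vec4" using w'v by (auto simp: lin_map_def vec4_def sum_less4)
    show "lin_map w' (lin_map u x) = x" if "x \<in> vec4" for x
      by (rule inv) (use w that w'v in \<open>auto simp: w'_def\<close>)
    show "lin_map u (lin_map w' x) = x" if "x \<in> vec4" for x
      by (rule inv) (use w that uv in \<open>auto simp: w'_def\<close>)
  qed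
qed

lemma line_on_form_subst: 
  fixes F :: "nat \<times> nat \<times> nat \<times> nat \<Rightarrow> 'k::field"
  shows "line_on_surface (form_subst F u) x y \<longleftrightarrow> line_on_surface F (lin_map u x) (lin_map u y)"
proof -
  have "form_eval (\<lambda>a. [:a:]) (form_subst F u) (\<lambda>j. [:x j, y j:]) =
     form_eval (\<lambda>a. [:a:]) F (\<lambda>j. [:lin_map u x j, lin_map u y j:])"
    unfolding form_eval_subst[OF ring_hom_fun_const_poly]
    by (intro form_eval_cong) (simp add: sum_less4 lin_map_def mult.commute)
  then show ?thesis by (simp add: line_on_surface_def)
qed

lemma lin_indep2_lin_map:
  fixes u :: "nat \<Rightarrow> nat \<Rightarrow> 'k::field"
  assumes u: "basis4 u" and v: "x \<in> vec4" "y \<in> vec4"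
  shows "lin_indep2 (lin_map u x) (lin_map u y) \<longleftrightarrow> lin_indep2 x y"
proof -
  have z: "lin_map u (\<lambda>i. 0) = (\<lambda>j. 0)" by (simp add: lin_map_def)
  have zv: "(\<lambda>i. 0) \<in> (vec4 :: (nat \<Rightarrow> 'k) set)" by (simp add: vec4_def)
  have "(\<forall>i. s * lin_map u x i + t * lin_map u y i = 0) \<longleftrightarrow> (\<forall>i. s * x i + t * y i = 0)" for s t
  proof -
    have "(\<forall>i. s * lin_map u x i + t * lin_map u y i = 0) \<longleftrightarrow> lin_map u (\<lambda>i. s * x i + t * y i) = lin_map u (\<lambda>i. 0)"
      unfolding lin_map_combine z by (simp add: fun_eq_iff)
    also have "\<dots> \<longleftrightarrow> (\<lambda>i. s * x i + t * y i) = (\<lambda>i. 0)"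
      using inj_on_eq_iff[OF bij_betw_imp_inj_on[OF bij_lin_map[OF u]] vec4_combine[OF v] zv] .
    finally show ?thesis by (simp add: fun_eq_iff)
  qed
  then show ?thesis unfolding lin_indep2_def by blast
qed

lemma k_lines_form_subst:
  fixes F :: "nat \<times> nat \<times> nat \<times> nat \<Rightarrow> 'k::field"
  assumes u: "basis4 u"
  shows "bij_betw ((`) (lin_map u)) (k_lines (form_subst F u)) (k_lines F)"
  unfolding bij_betw_def
proof
  have inj: "inj_on (lin_map u) vec4" and surj: "lin_map u ` vec4 = vec4"
    using bij_lin_map[OF u] by (auto simp: bij_betw_def)
  show "inj_on ((`) (lin_map u)) (k_lines (form_subst F u))"
    using inj_on_image[of "lin_map u" "k_lines (form_subst F u)"] inj k_lines_subset_vec4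
    by (metis Union_least inj_on_subset)
  show "(`) (lin_map u) ` k_lines (form_subst F u) = k_lines F"
  proof (intro equalityI subsetI)
    fix L assume "L \<in> (`) (lin_map u) ` k_lines (form_subst F u)"
    then obtain L' where L': "L' \<in> k_lines (form_subst F u)" and L: "L = lin_map u ` L'" by blast
    from L'(1) obtain x y where "L' = span2 x y" "x \<in> vec4" "y \<in> vec4" "lin_indep2 x y"
        "line_on_surface (form_subst F u) x y" by (rule k_linesE)
    then show "L \<in> k_lines F"
      unfolding L by (simp add: lin_map_span2 span2_in_k_lines_iff lin_map_vec4[OF u] line_on_form_subst lin_indep2_lin_map[OF u])
  next
    fix L assume "L \<in> k_lines F"
    then obtain x y where L: "L = span2 x y" "x \<in> vec4" "y \<in> vec4" "lin_indep2 x y"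
        "line_on_surface F x y" by (rule k_linesE)
    obtain x' y' where xy: "x = lin_map u x'" "y = lin_map u y'" "x' \<in> vec4" "y' \<in> vec4"
      using L(2,3) surj by blast
    have "span2 x' y' \<in> k_lines (form_subst F u)"
      using L xy by (simp add: span2_in_k_lines_iff line_on_form_subst lin_indep2_lin_map[OF u])
    then show "L \<in> (`) (lin_map u) ` k_lines (form_subst F u)"
      unfolding L(1) xy(1,2) lin_map_span2[symmetric] by blast
  qed
qed

section \<open>Coplanar lines and the third line in a plane\<close>

definition axis4 :: "nat \<Rightarrow> nat \<Rightarrow> 'k::zero_neq_one" where
  "axis4 i = (\<lambda>j. of_bool (i = j))"

lemma lin_map_axis4: "i < 4 \<Longrightarrow> lin_map u (axis4 i) = u i" for u :: "nat \<Rightarrow> nat \<Rightarrow> 'k::comm_ring_1"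
  unfolding lin_map_def axis4_def
  by (rule ext, subst sum.remove[of _ i]) auto

lemma line_axes:
  fixes G :: "nat \<times> nat \<times> nat \<times> nat \<Rightarrow> 'k::field"
  shows "line_on_surface G (axis4 0) (axis4 1) \<longleftrightarrow> G (3,0,0,0) = 0 \<and> G (2,1,0,0) = 0 \<and> G (1,2,0,0) = 0 \<and> G (0,3,0,0) = 0"
    "line_on_surface G (axis4 0) (axis4 2) \<longleftrightarrow> G (3,0,0,0) = 0 \<and> G (2,0,1,0) = 0 \<and> G (1,0,2,0) = 0 \<and> G (0,0,3,0) = 0"
    "line_on_surface G (axis4 0) (axis4 3) \<longleftrightarrow> G (3,0,0,0) = 0 \<and> G (2,0,0,1) = 0 \<and> G (1,0,0,2) = 0 \<and> G (0,0,0,3) = 0"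
    "line_on_surface G (axis4 2) (axis4 3) \<longleftrightarrow> G (0,0,3,0) = 0 \<and> G (0,0,2,1) = 0 \<and> G (0,0,1,2) = 0 \<and> G (0,0,0,3) = 0"
  unfolding line_on_surface_def form_eval_expand axis4_def by (simp_all add: eval_nat_numeral)

lemma quadratic_has_root:
  fixes q0 q1 q2 :: "'a::alg_closed_field"
  obtains s t where "s \<noteq> 0 \<or> t \<noteq> 0" "q0 * s ^ 2 + q1 * s * t + q2 * t ^ 2 = 0"
proof (cases "q0 = 0")
  case True
  then show ?thesis using that[of 1 0] by simp
next
  case False
  then have "degree [:q2, q1, q0:] > 0" by simp
  then obtain s where "poly [:q2, q1, q0:] s = 0" using alg_closed_imp_poly_has_root by blast
  then show ?thesis using that[of s 1] by (simp add: algebra_simps power2_eq_square)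
qed

text \<open>Lines are subspaces of \<open>k^4\<close> here, so a common point of P^3 is a common
  nonzero vector. Rational points suffice: the intersection of two subspaces over k is again defined
  over k.\<close>

definition meets :: "(nat \<Rightarrow> 'k::zero) set \<Rightarrow> (nat \<Rightarrow> 'k) set \<Rightarrow> bool" where
  "meets L M \<longleftrightarrow> (\<exists>p. p \<noteq> (\<lambda>_. 0) \<and> p \<in> L \<and> p \<in> M)"

text \<open>The sum of subspaces; a plane of P^3 when L and M are distinct lines that meet.\<close>

definition plane_join :: "(nat \<Rightarrow> 'k::plus) set \<Rightarrow> (nat \<Rightarrow> 'k) set \<Rightarrow> (nat \<Rightarrow> 'k) set" where
  "plane_join L M = {\<lambda>i. x i + y i | x y. x \<in> L \<and> y \<in> M}"

lemma plane_joinI: "x \<in> L \<Longrightarrow> y \<in> M \<Longrightarrow> (\<lambda>i. x i + y i) \<in> plane_join L M"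
  unfolding plane_join_def by blast

lemma meets_sym: "meets L M \<longleftrightarrow> meets M L"
  unfolding meets_def by blast

lemma meets_self: "L \<in> k_lines F \<Longrightarrow> meets L L"
  by (elim k_linesE) (use lin_indep2_nonzero(1) span2_base(1) in \<open>unfold meets_def, blast\<close>)

text \<open>The frame puts the common point first: with coordinates (x, y, z) for p, a, b, the line
  L is z = 0 and M is y = 0.\<close>

lemma common_point_frame:
  fixes F :: "nat \<times> nat \<times> nat \<times> nat \<Rightarrow> 'k::field"
  assumes L: "L \<in> k_lines F" and M: "M \<in> k_lines F" and ne: "L \<noteq> M"
    and p: "p \<noteq> (\<lambda>_. 0)" "p \<in> L" "p \<in> M"
  obtains a b where "L = span2 p a" "M = span2 p b" "line_on_surface F p a" "line_on_surface F p b"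
    "p \<in> vec4" "a \<in> vec4" "b \<in> vec4" "lin_indep2 p a" "lin_indep2 p b"
    "\<And>s t r. (\<And>j. j < 4 \<Longrightarrow> s * p j + t * a j + r * b j = 0) \<Longrightarrow> s = 0 \<and> t = 0 \<and> r = 0"
    "plane_join L M = {\<lambda>j. x * p j + y * a j + z * b j | x y z. True}"
proof -
  obtain a where a: "a \<in> L" "lin_indep2 p a" using k_lines_through[OF L p(2,1)] .
  obtain b where b: "b \<in> M" "lin_indep2 p b" using k_lines_through[OF M p(3,1)] .
  note La = k_lines_basis[OF L p(2) a] and Mb = k_lines_basis[OF M p(3) b]
  have ind: "s = 0 \<and> t = 0 \<and> r = 0" if z: "\<And>j. j < 4 \<Longrightarrow> s * p j + t * a j + r * b j = 0" for s t r
  proof -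
    have z': "s * p j + t * a j + r * b j = 0" for j
      using z La(2,3) Mb(3) by (cases "j < 4") (auto simp: vec4_def)
    have "r = 0"
    proof (rule ccontr)
      assume r: "r \<noteq> 0"
      have "b j = (- s / r) * p j + (- t / r) * a j" for j
        using z'[of j] r by (simp add: field_simps eq_neg_iff_add_eq_0)
      then have "b = (\<lambda>j. (- s / r) * p j + (- t / r) * a j)" by blast
      then have "b \<in> L" unfolding La(1) using span2_memI by metis
      then obtain c where "b = (\<lambda>i. c * p i)"
        using k_lines_two_points[OF L M ne p(2,3,1) _ b(1)] by blast
      then have "c * p i + (- 1) * b i = 0" for i by simp
      then show False using b(2) unfolding lin_indep2_def by (metis neg_equal_0_iff_equal zero_neq_one)
    qed
    then have "\<forall>j. s * p j + t * a j = 0" using z' by simp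
    then show ?thesis using a(2) \<open>r = 0\<close> unfolding lin_indep2_def by blast
  qed
  have J: "plane_join L M = {\<lambda>j. x * p j + y * a j + z * b j | x y z. True}" (is "_ = ?R")
  proof (intro equalityI subsetI)
    fix w assume "w \<in> plane_join L M"
    then obtain s t s' t' where "w = (\<lambda>i. (s * p i + t * a i) + (s' * p i + t' * b i))"
      unfolding plane_join_def La(1) Mb(1) span2_def by blast
    then have "w = (\<lambda>i. (s + s') * p i + t * a i + t' * b i)" by (simp add: algebra_simps)
    then show "w \<in> ?R" by blast
  next
    fix w assume "w \<in> ?R"
    then obtain x y z where w: "w = (\<lambda>j. (x * p j + y * a j) + (0 * p j + z * b j))" by auto
    show "w \<in> plane_join L M" unfolding w La(1) Mb(1) by (intro plane_joinI span2_memI)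
  qed
  show ?thesis
    by (rule that[OF La(1) Mb(1) La(4) Mb(4) La(2,3) Mb(3) a(2) b(2) _ J]) (use ind in blast)+
qed

lemma plane_join_closed:
  assumes "L \<in> k_lines F" "M \<in> k_lines F" "x \<in> plane_join L M" "y \<in> plane_join L M"
  shows "(\<lambda>i. s * x i + t * y i) \<in> plane_join L M"
proof -
  obtain a b c d where xy: "x = (\<lambda>i. a i + b i)" "y = (\<lambda>i. c i + d i)"
    and m: "a \<in> L" "b \<in> M" "c \<in> L" "d \<in> M"
    using assms(3,4) unfolding plane_join_def by blast
  have "(\<lambda>i. s * x i + t * y i) = (\<lambda>i. (s * a i + t * c i) + (s * b i + t * d i))"
    unfolding xy by (simp add: algebra_simps)
  then show ?thesis
    using plane_joinI[OF k_lines_closed[OF assms(1) m(1,3)] k_lines_closed[OF assms(2) m(2,4)]] by simp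
qed

lemma subset_plane_join:
  assumes "L \<in> k_lines F" "M \<in> k_lines F"
  shows "L \<subseteq> plane_join L M" "M \<subseteq> plane_join L M"
proof -
  have z: "(\<lambda>_. 0) \<in> K" if K: "K \<in> k_lines F" for K
  proof -
    obtain u v where "K = span2 u v" using K by (rule k_linesE)
    then show ?thesis using span2_memI[of 0 u 0 v] by simp
  qed
  show "L \<subseteq> plane_join L M" "M \<subseteq> plane_join L M"
    unfolding plane_join_def using z[OF assms(1)] z[OF assms(2)] by (auto, force+)
qed

lemma plane_join_least:
  assumes "L \<in> k_lines F" "M \<in> k_lines F" "A \<subseteq> plane_join L M" "B \<subseteq> plane_join L M"
  shows "plane_join A B \<subseteq> plane_join L M"
proof
  fix w assume "w \<in> plane_join A B"
  then obtain x y where "w = (\<lambda>i. 1 * x i + 1 * y i)" "x \<in> plane_join L M" "y \<in> plane_join L M"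
    using assms(3,4) unfolding plane_join_def[of A B] by auto
  then show "w \<in> plane_join L M" using plane_join_closed[OF assms(1,2), of x y 1 1] by blast
qed

lemma k_line_subset_plane_join:
  fixes F :: "nat \<times> nat \<times> nat \<times> nat \<Rightarrow> 'k::field"
  assumes "L \<in> k_lines F" "M \<in> k_lines F" "N \<in> k_lines F"
    "x \<in> N" "y \<in> N" "lin_indep2 x y" "x \<in> plane_join L M" "y \<in> plane_join L M"
  shows "N \<subseteq> plane_join L M"
  unfolding k_lines_basis(1)[OF assms(3-6)]
  using plane_join_closed[OF assms(1,2,7,8)] by (auto simp: span2_iff)

text \<open>All lines on the surface through p lie in its tangent plane at p. If p, a, b, c were a
  basis, F would have vanishing derivatives in three independent directions and at p itself, so p
  would be singular.\<close>

lemma concurrent_coplanar: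
  fixes F :: "nat \<times> nat \<times> nat \<times> nat \<Rightarrow> 'k::field"
  assumes sm: "smooth_cubic_surface F" and L: "L \<in> k_lines F" and M: "M \<in> k_lines F" and N: "N \<in> k_lines F"
    and ne: "L \<noteq> M" and p: "p \<noteq> (\<lambda>_. 0)" "p \<in> L" "p \<in> M" "p \<in> N"
  shows "N \<subseteq> plane_join L M"
proof -
  obtain a b where ab: "L = span2 p a" "M = span2 p b" "line_on_surface F p a" "line_on_surface F p b"
    "p \<in> vec4" "a \<in> vec4" "b \<in> vec4" "lin_indep2 p a" "lin_indep2 p b"
    and ind: "\<And>s t r. (\<And>j. j < 4 \<Longrightarrow> s * p j + t * a j + r * b j = 0) \<Longrightarrow> s = 0 \<and> t = 0 \<and> r = 0"
    and J: "plane_join L M = {\<lambda>j. x * p j + y * a j + z * b j | x y z. True}"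
    using common_point_frame[OF L M ne p(1-3)] by blast
  obtain c where c: "c \<in> N" "lin_indep2 p c" using k_lines_through[OF N p(4,1)] .
  note Nc = k_lines_basis[OF N p(4) c]
  have pJ: "p \<in> plane_join L M" using subset_plane_join[OF L M] p by blast
  show ?thesis
  proof (cases "c \<in> plane_join L M")
    case True
    then show ?thesis using k_line_subset_plane_join[OF L M N p(4) c pJ] by blast
  next
    case False
    let ?u = "frame4 p a b c"
    have "basis4 ?u"
    proof (rule basis4I)
      show "?u i \<in> vec4" for i using ab Nc(3) by (simp add: frame4_def)
      fix x :: "nat \<Rightarrow> 'k" and i :: nat
      assume x: "\<And>j. j < 4 \<Longrightarrow> lin_map ?u x j = 0" and i: "i < 4"
      have e: "x 0 * p j + x 1 * a j + x 2 * b j + x 3 * c j = 0" for j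
        using x[of j] ab Nc(3) by (cases "j < 4") (auto simp: lin_map_def sum_less4 vec4_def)
      have x3: "x 3 = 0"
      proof (rule ccontr)
        assume n: "x 3 \<noteq> 0"
        have "c j = (- x 0 / x 3) * p j + (- x 1 / x 3) * a j + (- x 2 / x 3) * b j" for j
        proof -
          have "x 3 * c j = - x 0 * p j + - x 1 * a j + - x 2 * b j"
            using e[of j] by (simp add: algebra_simps eq_neg_iff_add_eq_0)
          then have "c j = (- x 0 * p j + - x 1 * a j + - x 2 * b j) / x 3"
            using n by (simp add: eq_divide_eq mult.commute)
          then show ?thesis by (simp add: diff_divide_distrib)
        qed
        then have "c = (\<lambda>j. (- x 0 / x 3) * p j + (- x 1 / x 3) * a j + (- x 2 / x 3) * b j)" by blast
        then show False using False unfolding J by blast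
      qed
      then have "x 0 = 0 \<and> x 1 = 0 \<and> x 2 = 0" using e by (intro ind) simp
      then show "x i = 0" using x3 i by (auto simp: eval_nat_numeral less_Suc_eq)
    qed
    then have sG: "smooth_cubic_surface (form_subst F ?u)" by (rule smooth_form_subst[OF sm])
    define G where "G = form_subst F ?u"
    have "line_on_surface G (axis4 0) (axis4 1)" "line_on_surface G (axis4 0) (axis4 2)"
      "line_on_surface G (axis4 0) (axis4 3)"
      unfolding G_def line_on_form_subst using ab(3,4) Nc(4) by (simp_all add: lin_map_axis4)
    then have z: "G (3,0,0,0) = 0" "G (2,1,0,0) = 0" "G (2,0,1,0) = 0" "G (2,0,0,1) = 0"
      unfolding line_axes by blast+
    \<comment> \<open>The simplifier rewrites 1 to \<open>Suc 0\<close>, also inside exponent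
      tuples, so the facts are kept in both spellings.\<close>
    note z = z z[unfolded One_nat_def]
    have "axis4 0 0 = (0 :: 'k alg_closure)"
    proof (rule smooth_no_singular_point[OF sG[folded G_def], where x = "axis4 0" and i = 0])
      show "form_eval to_ac G (axis4 0) = 0"
        unfolding form_eval_expand using z by (simp add: axis4_def)
      fix i :: nat assume "i < 4"
      then have "i = 0 \<or> i = 1 \<or> i = 2 \<or> i = 3" by linarith
      then show "form_deriv_eval to_ac G i (axis4 0) = 0"
        by (elim disjE) (simp_all only: form_deriv_eval_expand, simp_all add: z axis4_def)
    qed simp
    then show ?thesis by (simp add: axis4_def)
  qed
qed

text \<open>The plane section is a cubic curve containing two lines, hence y z (\<alpha> x + \<beta>
  y + \<gamma> z); the residual linear factor is the third line, and smoothness makes it different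
  from L and M.\<close>

lemma third_line:
  fixes F :: "nat \<times> nat \<times> nat \<times> nat \<Rightarrow> 'k::field"
  assumes sm: "smooth_cubic_surface F" and L: "L \<in> k_lines F" and M: "M \<in> k_lines F"
    and ne: "L \<noteq> M" and m: "meets L M"
  obtains N where "N \<in> k_lines F" "N \<noteq> L" "N \<noteq> M" "N \<subseteq> plane_join L M"
    "\<And>K. K \<in> k_lines F \<Longrightarrow> K \<subseteq> plane_join L M \<Longrightarrow> K \<in> {L, M, N}"
    "\<And>q. q \<in> plane_join L M \<Longrightarrow> form_eval (\<lambda>c. c) F q = 0 \<Longrightarrow> q \<in> L \<union> M \<union> N"
    "meets N L" "meets N M"
    "\<And>K. K \<in> k_lines F \<Longrightarrow> \<exists>q\<in>K. q \<noteq> (\<lambda>_. 0) \<and> q \<in> plane_join L M"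
proof -
  obtain p where p: "p \<noteq> (\<lambda>_. 0)" "p \<in> L" "p \<in> M" using m unfolding meets_def by blast
  obtain a b where ab: "L = span2 p a" "M = span2 p b" "line_on_surface F p a" "line_on_surface F p b"
    "p \<in> vec4" "a \<in> vec4" "b \<in> vec4" "lin_indep2 p a" "lin_indep2 p b"
    and ind: "\<And>s t r. (\<And>j. j < 4 \<Longrightarrow> s * p j + t * a j + r * b j = 0) \<Longrightarrow> s = 0 \<and> t = 0 \<and> r = 0"
    and J: "plane_join L M = {\<lambda>j. x * p j + y * a j + z * b j | x y z. True}"
    using common_point_frame[OF L M ne p(1-3)] by blast
  obtain c where c: "c \<in> vec4" "basis4 (frame4 p a b c)"
    using basis4_extend[OF ab(5-7) ind] unfolding frame4_def by blast
  define u where "u = frame4 p a b c"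
  have bu: "basis4 u" using c(2) by (simp add: u_def)
  define G where "G = form_subst F u"
  have sG: "smooth_cubic_surface G" unfolding G_def by (rule smooth_form_subst[OF sm bu])
  have "line_on_surface G (axis4 0) (axis4 1)" "line_on_surface G (axis4 0) (axis4 2)"
    unfolding G_def line_on_form_subst using ab(3,4) by (simp_all add: lin_map_axis4 u_def)
  then have z: "G (3,0,0,0) = 0" "G (2,1,0,0) = 0" "G (2,0,1,0) = 0" "G (1,2,0,0) = 0" "G (0,3,0,0) = 0"
      "G (1,0,2,0) = 0" "G (0,0,3,0) = 0"
    unfolding line_axes by blast+
  note z = z z[unfolded One_nat_def]
  define \<alpha> \<beta> \<gamma> where abc: "\<alpha> = G (1,1,1,0)" "\<beta> = G (0,2,1,0)" "\<gamma> = G (0,1,2,0)"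
  note abc = abc abc[unfolded One_nat_def]
  \<comment> \<open>The seven vanishing coefficients leave only y z times a linear form. Arbitrary
    rings are allowed because the formula is needed over k for points and over k[t] for
    lines.\<close>
  have ev: "form_eval h F (\<lambda>j. x * h (p j) + y * h (a j) + z * h (b j)) = y * z * (h \<alpha> * x + h \<beta> * y + h \<gamma> * z)"
    if h: "ring_hom_fun h" for h :: "'k \<Rightarrow> 'r::comm_ring_1" and x y z
  proof -
    define v where "v i = (if i = 0 then x else if i = 1 then y else if i = 2 then z else 0)" for i :: nat
    have "form_eval h F (\<lambda>j. x * h (p j) + y * h (a j) + z * h (b j)) = form_eval h G v"
      unfolding G_def form_eval_subst[OF h]
      by (intro form_eval_cong) (simp add: sum_less4 v_def u_def)
    also have "\<dots> = y * z * (h \<alpha> * x + h \<beta> * y + h \<gamma> * z)"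
      unfolding form_eval_expand by (simp add: z ring_hom_fun_simps(1)[OF h] v_def abc power2_eq_square algebra_simps)
    finally show ?thesis .
  qed
  define pt where "pt x y z = (\<lambda>j. x * p j + y * a j + z * b j)" for x y z
  have pt_inj: "pt x y z = pt x' y' z' \<longleftrightarrow> x = x' \<and> y = y' \<and> z = z'" for x y z x' y' z'
  proof
    assume e: "pt x y z = pt x' y' z'"
    have "(x - x') * p j + (y - y') * a j + (z - z') * b j = 0" for j
      using fun_cong[OF e, of j] by (simp add: pt_def algebra_simps)
    then show "x = x' \<and> y = y' \<and> z = z'" using ind[of "x - x'" "y - y'" "z - z'"] by simp
  qed simp
  have pt0: "pt 0 0 0 = (\<lambda>_. 0)" by (simp add: pt_def)
  have ptL: "pt x y z \<in> L \<longleftrightarrow> z = 0" for x y z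
  proof
    assume "pt x y z \<in> L"
    then obtain s t where "pt x y z = (\<lambda>i. s * p i + t * a i)" unfolding ab(1) span2_iff by blast
    then have "pt x y z = pt s t 0" by (simp add: pt_def)
    then show "z = 0" by (simp add: pt_inj)
  next
    assume "z = 0" then show "pt x y z \<in> L" unfolding ab(1) pt_def using span2_memI[of x p y a] by simp
  qed
  have ptM: "pt x y z \<in> M \<longleftrightarrow> y = 0" for x y z
  proof
    assume "pt x y z \<in> M"
    then obtain s t where "pt x y z = (\<lambda>i. s * p i + t * b i)" unfolding ab(2) span2_iff by blast
    then have "pt x y z = pt s 0 t" by (simp add: pt_def)
    then show "y = 0" by (simp add: pt_inj)
  next
    assume "y = 0" then show "pt x y z \<in> M" unfolding ab(2) pt_def using span2_memI[of x p z b] by simp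
  qed
  have ptJ: "pt x y z \<in> plane_join L M" for x y z unfolding J pt_def by blast
  have Jpt: "\<exists>x y z. w = pt x y z" if "w \<in> plane_join L M" for w using that unfolding J pt_def by blast
  have ptv: "pt x y z \<in> vec4" for x y z using ab(5-7) by (simp add: pt_def vec4_def)
  have four: "i = 0 \<or> i = 1 \<or> i = 2 \<or> i = 3" if "i < 4" for i :: nat using that by linarith
  \<comment> \<open>Otherwise the section is \<gamma> y z^2 and the plane is tangent along all of L.
    On L only the derivative transverse to the plane survives; it is a quadratic form in (s, t), and
    its zero over the closure is a singular point. The same argument on M excludes \<alpha> =
    \<gamma> = 0.\<close>
  have "\<alpha> \<noteq> 0 \<or> \<beta> \<noteq> 0"
  proof (rule ccontr)
    assume n: "\<not> ?thesis"
    obtain s t where st: "s \<noteq> 0 \<or> t \<noteq> 0"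
      "to_ac (G (2,0,0,1)) * s ^ 2 + to_ac (G (1,1,0,1)) * s * t + to_ac (G (0,2,0,1)) * t ^ 2 = 0"
      by (rule quadratic_has_root)
    define v where "v i = (if i = 0 then s else if i = 1 then t else 0)" for i :: nat
    have nG: "G (1,1,1,0) = 0" "G (0,2,1,0) = 0" using n abc by auto
    note nG = nG nG[unfolded One_nat_def] and st' = st(2) st(2)[unfolded One_nat_def]
    have "v i = 0" if "i < 4" for i
    proof (rule smooth_no_singular_point[OF sG _ _ that])
      show "form_eval to_ac G v = 0"
        unfolding form_eval_expand v_def by (simp add: z)
      fix i :: nat assume "i < 4"
      from four[OF this] show "form_deriv_eval to_ac G i v = 0"
        by (elim disjE) (simp_all only: form_deriv_eval_expand, use st' in \<open>simp_all add: z v_def nG ac_simps\<close>)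
    qed
    from this[of 0] this[of 1] show False using st(1) by (simp add: v_def)
  qed
  moreover have "\<alpha> \<noteq> 0 \<or> \<gamma> \<noteq> 0"
  proof (rule ccontr)
    assume n: "\<not> ?thesis"
    obtain s t where st: "s \<noteq> 0 \<or> t \<noteq> 0"
      "to_ac (G (2,0,0,1)) * s ^ 2 + to_ac (G (1,0,1,1)) * s * t + to_ac (G (0,0,2,1)) * t ^ 2 = 0"
      by (rule quadratic_has_root)
    define v where "v i = (if i = 0 then s else if i = 2 then t else 0)" for i :: nat
    have nG: "G (1,1,1,0) = 0" "G (0,1,2,0) = 0" using n abc by auto
    note nG = nG nG[unfolded One_nat_def] and st' = st(2) st(2)[unfolded One_nat_def]
    have "v i = 0" if "i < 4" for i
    proof (rule smooth_no_singular_point[OF sG _ _ that])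
      show "form_eval to_ac G v = 0"
        unfolding form_eval_expand v_def by (simp add: z)
      fix i :: nat assume "i < 4"
      from four[OF this] show "form_deriv_eval to_ac G i v = 0"
        by (elim disjE) (simp_all only: form_deriv_eval_expand, use st' in \<open>simp_all add: z v_def nG ac_simps\<close>)
    qed
    from this[of 0] this[of 2] show False using st(1) by (simp add: v_def)
  qed
  ultimately have nz: "\<alpha> \<noteq> 0 \<or> \<beta> \<noteq> 0" "\<alpha> \<noteq> 0 \<or> \<gamma> \<noteq> 0" by blast+
  define N where "N = {pt x y z | x y z. \<alpha> * x + \<beta> * y + \<gamma> * z = 0}"
  have ptN: "pt x y z \<in> N \<longleftrightarrow> \<alpha> * x + \<beta> * y + \<gamma> * z = 0" for x y z
    unfolding N_def by (auto simp: pt_inj)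
  have pt_comb: "(\<lambda>i. s * pt x y z i + t * pt x' y' z' i) = pt (s*x+t*x') (s*y+t*y') (s*z+t*z')" for s t x y z x' y' z'
    by (simp add: pt_def algebra_simps)
  have pt_ind: "lin_indep2 (pt x y z) (pt x' y' z')"
    if "x * y' - y * x' \<noteq> 0 \<or> x * z' - z * x' \<noteq> 0 \<or> y * z' - z * y' \<noteq> 0" for x y z x' y' z'
    unfolding lin_indep2_def
  proof (intro allI impI)
    fix s t assume "\<forall>i. s * pt x y z i + t * pt x' y' z' i = 0"
    then have "pt (s*x+t*x') (s*y+t*y') (s*z+t*z') = pt 0 0 0" unfolding pt_comb[symmetric] pt0 by blast
    then have e: "s*x+t*x' = 0" "s*y+t*y' = 0" "s*z+t*z' = 0" unfolding pt_inj by blast+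
    have elim: "s * (c * d' - d * c') = 0 \<and> t * (c * d' - d * c') = 0"
      if "s * c + t * c' = 0" "s * d + t * d' = 0" for c d c' d'
    proof -
      have "s * (c * d' - d * c') = d' * (s * c + t * c') - c' * (s * d + t * d')"
        "t * (c * d' - d * c') = c * (s * d + t * d') - d * (s * c + t * c')"
        by (simp_all add: algebra_simps)
      then show ?thesis using that by simp
    qed
    from elim[OF e(1,2)] elim[OF e(1,3)] elim[OF e(2,3)]
     show "s = 0 \<and> t = 0" using that by auto
  qed
  have line_pt: "line_on_surface F (pt x y z) (pt x' y' z') \<longleftrightarrow>
     [:y, y':] * [:z, z':] * ([:\<alpha>:] * [:x, x':] + [:\<beta>:] * [:y, y':] + [:\<gamma>:] * [:z, z':]) = 0" for x y z x' y' z'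
  proof -
    have "(\<lambda>j. [:pt x y z j, pt x' y' z' j:]) = (\<lambda>j. [:x, x':] * [:p j:] + [:y, y':] * [:a j:] + [:z, z':] * [:b j:])"
      by (simp add: pt_def algebra_simps)
    then show ?thesis unfolding line_on_surface_def ev[OF ring_hom_fun_const_poly, symmetric] by simp
  qed
  have "\<exists>x y z x' y' z'. N = span2 (pt x y z) (pt x' y' z') \<and> lin_indep2 (pt x y z) (pt x' y' z') \<and> pt x y z \<in> N \<and> pt x' y' z' \<in> N"
  \<comment> \<open>Both cases give a basis of the solutions of \<alpha> x + \<beta> y + \<gamma> z
    = 0. For \<alpha> = 0 the three lines are concurrent in p, and \<beta>, \<gamma> are both
    nonzero.\<close>
  proof (cases "\<alpha> = 0")
    case False
    have "N = span2 (pt (-\<beta>) \<alpha> 0) (pt (-\<gamma>) 0 \<alpha>)"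
    proof (intro equalityI subsetI)
      fix w assume "w \<in> N"
      then obtain x y z where w: "w = pt x y z" "\<alpha> * x + \<beta> * y + \<gamma> * z = 0" unfolding N_def by blast
      have "x = (y / \<alpha>) * (-\<beta>) + (z / \<alpha>) * (-\<gamma>)"
      proof -
        have "\<alpha> * x = - \<beta> * y - \<gamma> * z" using w(2) by (simp add: algebra_simps eq_neg_iff_add_eq_0)
        then have "x = (- \<beta> * y - \<gamma> * z) / \<alpha>" using False by (simp add: eq_divide_eq mult.commute)
        then show ?thesis by (simp add: diff_divide_distrib mult.commute)
      qed
      then have "w = (\<lambda>i. (y / \<alpha>) * pt (-\<beta>) \<alpha> 0 i + (z / \<alpha>) * pt (-\<gamma>) 0 \<alpha> i)"
        unfolding pt_comb w(1) pt_inj using False by simp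
      then show "w \<in> span2 (pt (-\<beta>) \<alpha> 0) (pt (-\<gamma>) 0 \<alpha>)" unfolding span2_iff by blast
    next
      fix w assume "w \<in> span2 (pt (-\<beta>) \<alpha> 0) (pt (-\<gamma>) 0 \<alpha>)"
      then show "w \<in> N" unfolding span2_iff pt_comb by (auto simp: ptN algebra_simps)
    qed
    moreover have "lin_indep2 (pt (-\<beta>) \<alpha> 0) (pt (-\<gamma>) 0 \<alpha>)" using False by (intro pt_ind) simp
    ultimately show ?thesis by (metis span2_base)
  next
    case True
    then have bg: "\<beta> \<noteq> 0" "\<gamma> \<noteq> 0" using nz by auto
    have "N = span2 (pt 1 0 0) (pt 0 (-\<gamma>) \<beta>)"
    proof (intro equalityI subsetI)
      fix w assume "w \<in> N"
      then obtain x y z where w: "w = pt x y z" "\<alpha> * x + \<beta> * y + \<gamma> * z = 0" unfolding N_def by blast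
      have "y = (z / \<beta>) * (-\<gamma>)"
      proof -
        have "\<beta> * y = - \<gamma> * z" using w(2) True by (simp add: algebra_simps eq_neg_iff_add_eq_0)
        then have "y = (- \<gamma> * z) / \<beta>" using bg by (metis nonzero_mult_div_cancel_left)
        then show ?thesis by (simp add: mult.commute)
      qed
      then have "w = (\<lambda>i. x * pt 1 0 0 i + (z / \<beta>) * pt 0 (-\<gamma>) \<beta> i)"
        unfolding pt_comb w(1) pt_inj using bg by simp
      then show "w \<in> span2 (pt 1 0 0) (pt 0 (-\<gamma>) \<beta>)" unfolding span2_iff by blast
    next
      fix w assume "w \<in> span2 (pt 1 0 0) (pt 0 (-\<gamma>) \<beta>)"
      then show "w \<in> N" unfolding span2_iff pt_comb using True by (auto simp: ptN algebra_simps)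
    qed
    moreover have "lin_indep2 (pt 1 0 0) (pt 0 (-\<gamma>) \<beta>)" using bg by (intro pt_ind) simp
    ultimately show ?thesis by (metis span2_base)
  qed
  then obtain n1 n2 where n12: "N = span2 n1 n2" "lin_indep2 n1 n2" "n1 \<in> N" "n2 \<in> N" by blast
  have N_line: "N \<in> k_lines F"
  proof -
    obtain x y z x' y' z' where e: "n1 = pt x y z" "n2 = pt x' y' z'"
      "\<alpha> * x + \<beta> * y + \<gamma> * z = 0" "\<alpha> * x' + \<beta> * y' + \<gamma> * z' = 0"
      using n12(3,4) unfolding N_def by blast
    have "[:\<alpha>:] * [:x, x':] + [:\<beta>:] * [:y, y':] + [:\<gamma>:] * [:z, z':] = 0"
      using e(3,4) by (simp add: mult.commute)
    then have "line_on_surface F n1 n2" unfolding e(1,2) line_pt by (simp only: mult_zero_right)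
    then show ?thesis unfolding n12(1) using n12(2) e(1,2) by (simp add: span2_in_k_lines_iff ptv)
  qed
  show ?thesis
  proof (rule that[OF N_line])
    \<comment> \<open>Points of N lying off L or off M: one of \<alpha>, \<beta> is nonzero, and so
      is one of \<alpha>, \<gamma>.\<close>
    have "pt (-\<gamma>) 0 \<alpha> \<in> N" "pt (-\<beta>) \<alpha> 0 \<in> N" by (simp_all add: ptN)
    moreover have "pt 0 (-\<gamma>) \<beta> \<in> N" by (simp add: ptN)
    ultimately show "N \<noteq> L" "N \<noteq> M" using ptL ptM nz by (metis, metis neg_equal_0_iff_equal)
    show "N \<subseteq> plane_join L M" unfolding N_def using ptJ by blast
    show "meets N L" unfolding meets_def
      by (rule exI[of _ "pt \<beta> (-\<alpha>) 0"]) (use nz in \<open>simp add: ptN ptL pt0[symmetric] pt_inj, blast\<close>)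
    show "meets N M" unfolding meets_def
      by (rule exI[of _ "pt \<gamma> 0 (-\<alpha>)"]) (use nz in \<open>simp add: ptN ptM pt0[symmetric] pt_inj, blast\<close>)
    show "q \<in> L \<union> M \<union> N" if q0: "q \<in> plane_join L M" "form_eval (\<lambda>c. c) F q = 0" for q
    proof -
      obtain x y z where q: "q = pt x y z" using Jpt q0(1) by blast
      have "y * z * (\<alpha> * x + \<beta> * y + \<gamma> * z) = 0"
        using q0(2) unfolding q pt_def ev[OF ring_hom_fun_id] .
      then show ?thesis unfolding q by (auto simp: ptL ptM ptN)
    qed
    show "\<exists>q\<in>K. q \<noteq> (\<lambda>_. 0) \<and> q \<in> plane_join L M" if K: "K \<in> k_lines F" for K
    proof -
      obtain k1 k2 where k: "K = span2 k1 k2" "k1 \<in> vec4" "k2 \<in> vec4" "lin_indep2 k1 k2" using K by (rule k_linesE)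
      obtain x1 x2 where x: "k1 = lin_map u x1" "k2 = lin_map u x2"
        using bij_lin_map[OF bu] k(2,3) unfolding bij_betw_def by blast
      \<comment> \<open>The combination of k1 and k2 that cancels the fourth coordinate is where K
        crosses the plane. If k1 is already in the plane, it is taken itself, so that the two
        coefficients never vanish together.\<close>
      define q where "q = (\<lambda>i. (if x1 3 = 0 then 1 else x2 3) * k1 i + (if x1 3 = 0 then 0 else - x1 3) * k2 i)"
      have qK: "q \<in> K" unfolding q_def k(1) by (rule span2_memI)
      moreover have "q \<noteq> (\<lambda>_. 0)"
      proof
        assume q0: "q = (\<lambda>_. 0)"
        have "(if x1 3 = 0 then 1 else x2 3) = 0 \<and> (if x1 3 = 0 then 0 else - x1 3) = 0"
          by (rule k(4)[unfolded lin_indep2_def, rule_format]) (use fun_cong[OF q0] in \<open>unfold q_def, blast\<close>)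
        then show False by (auto split: if_splits)
      qed
      moreover have "q \<in> plane_join L M"
      proof -
        define y where "y i = (if x1 3 = 0 then 1 else x2 3) * x1 i + (if x1 3 = 0 then 0 else - x1 3) * x2 i" for i
        have "q = lin_map u y" unfolding q_def x y_def lin_map_combine ..
        also have "\<dots> = pt (y 0) (y 1) (y 2)"
          unfolding lin_map_def pt_def by (rule ext) (simp add: sum_less4 u_def y_def)
        finally show ?thesis using ptJ by simp
      qed
      ultimately show ?thesis by blast
    qed
    show "K \<in> {L, M, N}" if K: "K \<in> k_lines F" "K \<subseteq> plane_join L M" for K
    proof -
      obtain k1 k2 where k: "K = span2 k1 k2" "lin_indep2 k1 k2" "line_on_surface F k1 k2"
        using K(1) by (rule k_linesE)
      have mem: "k1 \<in> K" "k2 \<in> K" unfolding k(1) by (rule span2_base)+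
      obtain x y z where e1: "k1 = pt x y z" using Jpt[of k1] K(2) mem(1) by blast
      obtain x' y' z' where e2: "k2 = pt x' y' z'" using Jpt[of k2] K(2) mem(2) by blast
      note e = e1 e2
      have *: "K = K'" if "K' \<in> k_lines F" "k1 \<in> K'" "k2 \<in> K'" for K'
        using k_lines_basis(1)[OF that k(2)] k(1) by simp
      \<comment> \<open>k[t] is a domain, so one of the three linear factors of the plane section
        vanishes identically on K.\<close>
      have "[:y, y':] = 0 \<or> [:z, z':] = 0 \<or> [:\<alpha>:] * [:x, x':] + [:\<beta>:] * [:y, y':] + [:\<gamma>:] * [:z, z':] = 0"
        using k(3) unfolding e line_pt by (simp only: mult_eq_0_iff disj_assoc)
      then have "y = 0 \<and> y' = 0 \<or> z = 0 \<and> z' = 0 \<or>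
          \<alpha> * x + \<beta> * y + \<gamma> * z = 0 \<and> \<alpha> * x' + \<beta> * y' + \<gamma> * z' = 0"
        by (elim disjE) (simp_all add: mult.commute)
      then consider "y = 0" "y' = 0" | "z = 0" "z' = 0" 
        | "\<alpha> * x + \<beta> * y + \<gamma> * z = 0" "\<alpha> * x' + \<beta> * y' + \<gamma> * z' = 0" by blast
      then show ?thesis
      proof cases
        case 1
        then have "K = M" by (intro * M) (simp_all add: e ptM)
        then show ?thesis by simp
      next
        case 2
        then have "K = L" by (intro * L) (simp_all add: e ptL)
        then show ?thesis by simp
      next
        case 3
        then have "K = N" by (intro * N_line) (simp_all add: e ptN)
        then show ?thesis by simp
      qed
    qed
  qed
qed

text \<open>A further line K meets L and M. It is not in their plane, so it meets both in the same
  point; then the three lines are concurrent, hence coplanar after all.\<close>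

lemma card_no_skew:
  fixes F :: "nat \<times> nat \<times> nat \<times> nat \<Rightarrow> 'k::field"
  assumes sm: "smooth_cubic_surface F"
    and meet: "\<And>L M. L \<in> k_lines F \<Longrightarrow> M \<in> k_lines F \<Longrightarrow> meets L M"
  shows "finite (k_lines F) \<and> card (k_lines F) \<in> {0, 1, 3}"
proof (cases "\<exists>L M. L \<in> k_lines F \<and> M \<in> k_lines F \<and> L \<noteq> M")
  case False
  then have "k_lines F = {L}" if "L \<in> k_lines F" for L using that by blast
  then have "k_lines F = {} \<or> (\<exists>L. k_lines F = {L})" by blast
  then show ?thesis by (elim disjE exE) simp_all
next
  case True
  then obtain L M where L: "L \<in> k_lines F" and M: "M \<in> k_lines F" and ne: "L \<noteq> M" by blast
  obtain N where N: "N \<in> k_lines F" "N \<noteq> L" "N \<noteq> M" "N \<subseteq> plane_join L M"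
    and N': "\<And>K. K \<in> k_lines F \<Longrightarrow> K \<subseteq> plane_join L M \<Longrightarrow> K \<in> {L, M, N}"
    by (rule third_line[OF sm L M ne meet[OF L M]], rule that, assumption+)
  have "K \<in> {L, M, N}" if K: "K \<in> k_lines F" for K
  proof (rule ccontr)
    assume n: "K \<notin> {L, M, N}"
    then have nJ: "\<not> K \<subseteq> plane_join L M" using N'[OF K] by blast
    obtain x where x: "x \<noteq> (\<lambda>_. 0)" "x \<in> K" "x \<in> L" using meet[OF K L] unfolding meets_def by blast
    obtain y where y: "y \<noteq> (\<lambda>_. 0)" "y \<in> K" "y \<in> M" using meet[OF K M] unfolding meets_def by blast
    have "\<not> lin_indep2 y x"
      using k_line_subset_plane_join[OF L M K y(2) x(2)] nJ x y subset_plane_join[OF L M] by blast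
    then obtain c where c: "x = (\<lambda>i. c * y i)" using lin_indep2I[of y x] y by blast
    have "(\<lambda>i. c * y i + 0 * y i) \<in> M" using k_lines_closed[OF M y(3) y(3)] .
    then have "x \<in> M" by (simp add: c)
    then show False using concurrent_coplanar[OF sm L M K ne x(1,3) _ x(2)] nJ by blast
  qed
  then have "k_lines F = {L, M, N}" using L M N by blast
  then show ?thesis using ne N(2,3) by (simp add: card_insert_if)
qed

text \<open>For N meeting L let P be the third line of their plane. M crosses this plane in a point
  of the surface, which lies on N or P because M misses L. If M met both, it would lie in the plane
  and be one of N and P, yet these meet L. So passing to the third line is an involution exchanging
  the lines that meet M with those that do not.\<close>

lemma transversal_partners_bij:
  fixes F :: "nat \<times> nat \<times> nat \<times> nat \<Rightarrow> 'k::field"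
  assumes sm: "smooth_cubic_surface F" and L: "L \<in> k_lines F" and M: "M \<in> k_lines F" and skew: "\<not> meets L M"
  shows "bij_betw (\<lambda>N. SOME N'. N' \<in> k_lines F \<and> N' \<noteq> L \<and> N' \<noteq> N \<and> N' \<subseteq> plane_join L N)
    {N \<in> k_lines F. meets N L \<and> meets N M} {N \<in> k_lines F. N \<noteq> L \<and> meets N L \<and> \<not> meets N M}"
proof -
  define f where "f = (\<lambda>N. SOME N'. N' \<in> k_lines F \<and> N' \<noteq> L \<and> N' \<noteq> N \<and> N' \<subseteq> plane_join L N)"
  have f: "f N \<in> k_lines F \<and> f N \<noteq> L \<and> f N \<noteq> N \<and> meets (f N) L \<and> (meets (f N) M \<longleftrightarrow> \<not> meets N M) \<and> f (f N) = N"
    if N: "N \<in> k_lines F" "N \<noteq> L" "meets N L" for N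
  proof -
    obtain P where P: "P \<in> k_lines F" "P \<noteq> L" "P \<noteq> N" "P \<subseteq> plane_join L N"
      and P1: "\<And>K. K \<in> k_lines F \<Longrightarrow> K \<subseteq> plane_join L N \<Longrightarrow> K \<in> {L, N, P}"
      and P2: "\<And>q. q \<in> plane_join L N \<Longrightarrow> form_eval (\<lambda>c. c) F q = 0 \<Longrightarrow> q \<in> L \<union> N \<union> P"
      and P3: "meets P L" "meets P N"
      and P4: "\<And>K. K \<in> k_lines F \<Longrightarrow> \<exists>q\<in>K. q \<noteq> (\<lambda>_. 0) \<and> q \<in> plane_join L N"
      by (rule third_line[OF sm L N(1) N(2)[symmetric] N(3)[unfolded meets_sym[of N L]]], rule that, assumption+)
    have P_unique: "P' = P" if "P' \<in> k_lines F \<and> P' \<noteq> L \<and> P' \<noteq> N \<and> P' \<subseteq> plane_join L N" for P'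
      using P1[of P'] that by blast
    have fN: "f N = P" unfolding f_def by (rule some_equality) (use P P_unique in blast)+
    \<comment> \<open>The construction applied to P returns N: the plane of L and P lies in that of
      L and N, whose only lines are L, N and P.\<close>
    obtain Q where Q: "Q \<in> k_lines F" "Q \<noteq> L" "Q \<noteq> P" "Q \<subseteq> plane_join L P"
      and Q1: "\<And>K. K \<in> k_lines F \<Longrightarrow> K \<subseteq> plane_join L P \<Longrightarrow> K \<in> {L, P, Q}"
      by (rule third_line[OF sm L P(1) P(2)[symmetric] P3(1)[unfolded meets_sym[of P L]]], rule that, assumption+)
    have sub: "plane_join L P \<subseteq> plane_join L N"
      by (rule plane_join_least[OF L N(1) subset_plane_join(1)[OF L N(1)] P(4)])
    have QN: "Q = N" using P1[OF Q(1)] Q sub by blast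
    have "f P = Q" unfolding f_def by (rule some_equality) (use Q Q1 in blast)+
    then have ff: "f (f N) = N" by (simp add: fN QN)
    have neML: "M \<noteq> L" using skew meets_self[OF L] by blast
    have "meets P M \<longleftrightarrow> \<not> meets N M"
    proof
      assume pm: "meets P M"
      show "\<not> meets N M"
      proof
        assume "meets N M"
        then obtain q where q: "q \<noteq> (\<lambda>_. 0)" "q \<in> N" "q \<in> M" unfolding meets_def by blast
        obtain q' where q': "q' \<noteq> (\<lambda>_. 0)" "q' \<in> P" "q' \<in> M" using pm unfolding meets_def by blast
        have "M \<subseteq> plane_join L N"
        \<comment> \<open>Two different points of the plane put M into it; if the two points
          coincide, then M, N, P are concurrent and therefore coplanar.\<close>
        proof (cases "lin_indep2 q q'")
          case True
          show ?thesis
            by (rule k_line_subset_plane_join[OF L N(1) M q(3) q'(3) True]) (use q q' P(4) subset_plane_join[OF L N(1)] in blast)+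
        next
          case False
          then obtain c where c: "q' = (\<lambda>i. c * q i)" using lin_indep2I[of q q'] q by blast
          have "(\<lambda>i. c * q i + 0 * q i) \<in> N" using k_lines_closed[OF N(1) q(2) q(2)] .
          then have "q' \<in> N" by (simp add: c)
          then have "M \<subseteq> plane_join N P" using concurrent_coplanar[OF sm N(1) P(1) M P(3)[symmetric] q'(1) _ q'(2,3)] by blast
          also have "plane_join N P \<subseteq> plane_join L N"
            by (rule plane_join_least[OF L N(1) subset_plane_join(2)[OF L N(1)] P(4)])
          finally show ?thesis .
        qed
        then show False using P1[OF M] neML P3 skew N meets_sym by blast
      qed
    next
      assume nm: "\<not> meets N M"
      obtain q where q: "q \<in> M" "q \<noteq> (\<lambda>_. 0)" "q \<in> plane_join L N" using P4[OF M] by blast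
      have "q \<in> L \<union> N \<union> P" by (rule P2[OF q(3) k_lines_vanish[OF M q(1)]])
      then show "meets P M" using q nm skew unfolding meets_def by blast
    qed
    then show ?thesis using P fN P3 ff by blast
  qed
  have TL: "N \<noteq> L" if "meets N M" for N using that skew by blast
  show ?thesis
    unfolding f_def[symmetric]
    by (rule bij_betw_byWitness[of _ f]) (use f TL in \<open>auto simp: image_subset_iff\<close>)
qed

lemma card_skew:
  fixes F :: "nat \<times> nat \<times> nat \<times> nat \<Rightarrow> 'k::field"
  assumes sm: "smooth_cubic_surface F" and L: "L \<in> k_lines F" and M: "M \<in> k_lines F" and skew: "\<not> meets L M"
    and fT: "finite {N \<in> k_lines F. meets N L \<and> meets N M}"
    and fQ: "finite {N \<in> k_lines F. \<not> meets N L \<and> \<not> meets N M}"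
  shows "finite (k_lines F) \<and> card (k_lines F) =
    2 + 3 * card {N \<in> k_lines F. meets N L \<and> meets N M} + card {N \<in> k_lines F. \<not> meets N L \<and> \<not> meets N M}"
proof -
  let ?T = "{N \<in> k_lines F. meets N L \<and> meets N M}" and ?Q = "{N \<in> k_lines F. \<not> meets N L \<and> \<not> meets N M}"
  let ?P = "{N \<in> k_lines F. N \<noteq> L \<and> meets N L \<and> \<not> meets N M}"
  let ?P' = "{N \<in> k_lines F. N \<noteq> M \<and> meets N M \<and> \<not> meets N L}"
  have T': "{N \<in> k_lines F. meets N M \<and> meets N L} = ?T" by blast
  note b = transversal_partners_bij[OF sm L M skew]
  note b' = transversal_partners_bij[OF sm M L skew[unfolded meets_sym[of L M]], unfolded T']
  have P: "finite ?P" "card ?P = card ?T" using bij_betw_finite[OF b] bij_betw_same_card[OF b] fT by auto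
  have P': "finite ?P'" "card ?P' = card ?T" using bij_betw_finite[OF b'] bij_betw_same_card[OF b'] fT by auto
  have LM: "L \<noteq> M" using skew meets_self[OF L] by blast
  have mL: "meets L L" "meets M M" using meets_self L M by blast+
  have skew': "\<not> meets M L" using skew meets_sym by blast
  have S: "k_lines F = {L, M} \<union> (?T \<union> (?P \<union> (?P' \<union> ?Q)))" (is "_ = ?R")
  proof (intro equalityI subsetI)
    fix N assume N: "N \<in> k_lines F"
    consider "N = L" | "N = M" | "N \<noteq> L" "N \<noteq> M" "meets N L" "meets N M" | "N \<noteq> L" "N \<noteq> M" "meets N L" "\<not> meets N M"
      | "N \<noteq> L" "N \<noteq> M" "\<not> meets N L" "meets N M" | "N \<noteq> L" "N \<noteq> M" "\<not> meets N L" "\<not> meets N M" by blast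
    then show "N \<in> ?R" by cases (use N in simp_all)
  next
    fix N assume "N \<in> ?R"
    then show "N \<in> k_lines F" using L M by (elim UnE) (simp_all, blast)
  qed
  have fin: "finite (k_lines F)" by (subst S) (use fT fQ P P' in simp)
  have "card (k_lines F) = card {L, M} + (card ?T + (card ?P + (card ?P' + card ?Q)))"
    apply (subst S)
    apply (subst card_Un_disjoint, use fT fQ P P' in simp, use fT fQ P P' in simp, use skew skew' mL in blast)
    apply (subst card_Un_disjoint, use fT fQ P P' in simp, use fT fQ P P' in simp, blast)
    apply (subst card_Un_disjoint, use fT fQ P P' in simp, use fT fQ P P' in simp, blast)
    apply (subst card_Un_disjoint, use fT fQ P P' in simp, use fT fQ P P' in simp, blast)
    by simp
  then show ?thesis using fin P(2) P'(2) LM by simp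
qed

section \<open>Quadratic factors of a squarefree quintic\<close>

lemma linear_prod_dvd:
  fixes f :: "'k::field poly"
  assumes "finite A" "\<And>z. z \<in> A \<Longrightarrow> poly f z = 0"
  shows "(\<Prod>z\<in>A. [:-z, 1:]) dvd f"
  using assms
proof (induction A)
  case (insert a A)
  then have "(\<Prod>z\<in>A. [:-z, 1:]) dvd f" by simp
  then obtain k where k: "f = (\<Prod>z\<in>A. [:-z, 1:]) * k" by (elim dvdE)
  have "poly (\<Prod>z\<in>A. [:-z, 1:]) a \<noteq> 0" using insert(1,2) by (auto simp: poly_prod)
  moreover have "poly f a = 0" using insert by simp
  ultimately have "poly k a = 0" unfolding k by simp
  then have "[:-a, 1:] dvd k" by (simp add: poly_eq_0_iff_dvd)
  then have "[:-a, 1:] * (\<Prod>z\<in>A. [:-z, 1:]) dvd k * (\<Prod>z\<in>A. [:-z, 1:])"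
    by (rule mult_dvd_mono) simp
  then show ?case unfolding k prod.insert[OF insert(1,2)] mult.commute[of k] .
qed simp

lemma prime_elem_dvd_prod:
  assumes "prime_elem p" "finite A" "p dvd prod f A"
  shows "\<exists>x\<in>A. p dvd f x"
  using assms(2,3)
proof (induction A)
  case empty
  then show ?case using assms(1) by (simp add: prime_elem_def)
next
  case (insert a A)
  then show ?case using assms(1) by (auto simp: prime_elem_dvd_mult_iff)
qed

lemma degree_linear_prod: "degree (\<Prod>z\<in>A. [:-z, 1:]) = card A" for A :: "'k::field set"
proof (cases "finite A")
  case True
  then show ?thesis by (subst degree_prod_eq_sum_degree) auto
qed simp

lemma lead_coeff_linear_prod: "lead_coeff (\<Prod>z\<in>A. [:-z, 1:]) = 1" for A :: "'k::field set"
  by (simp add: lead_coeff_prod)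

lemma monic_dvd_eq:
  fixes p q :: "'k::field poly"
  assumes "p dvd q" "degree p = degree q" "lead_coeff p = 1" "lead_coeff q = 1"
  shows "p = q"
proof -
  obtain k where k: "q = p * k" using assms(1) by (elim dvdE)
  have nz: "p \<noteq> 0" "k \<noteq> 0" using assms(3,4) k by auto
  then have "degree k = 0" using assms(2) unfolding k by (simp add: degree_mult_eq)
  then obtain c where c: "k = [:c:]" by (elim degree_eq_zeroE)
  have "lead_coeff k = 1" using assms(3,4) unfolding k lead_coeff_mult by simp
  then show ?thesis unfolding k c by simp
qed

lemma monic_associate:
  fixes p :: "'k::field poly"
  assumes "p \<noteq> 0"
  defines "p' \<equiv> smult (inverse (lead_coeff p)) p"
  shows "lead_coeff p' = 1" "degree p' = degree p" "p' dvd p" "p dvd p'"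
proof -
  have l: "lead_coeff p \<noteq> 0" using assms(1) by simp
  show "lead_coeff p' = 1" unfolding p'_def lead_coeff_smult using l by (rule left_inverse)
  show "degree p' = degree p" unfolding p'_def using l by (simp del: leading_coeff_0_iff)
  show "p dvd p'" unfolding p'_def by (rule dvd_smult) simp
  have "smult (lead_coeff p) p' = p" unfolding p'_def smult_smult right_inverse[OF l] by simp
  then show "p' dvd p" by (metis dvd_refl dvd_smult)
qed

lemma degree_1_has_root:
  fixes p :: "'k::field poly"
  assumes "degree p = 1"
  shows "\<exists>z. poly p z = 0"
proof -
  obtain a b where "p = [:a, b:]" "b \<noteq> 0" using degree1_coeffs[OF assms] by blast
  then have "poly p (- a / b) = 0" by simp
  then show ?thesis ..
qed

lemma rootfree_quadratic_prime:
  fixes p :: "'k::field poly"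
  assumes d: "degree p = 2" and r: "\<And>z. poly p z \<noteq> 0"
  shows "prime_elem p"
proof (rule field_poly_irreducible_imp_prime)
  show "comm_semiring_1_class.irreducible p"
  proof (rule irreducibleI)
    show "p \<noteq> 0" using d by auto
    show "\<not> p dvd 1" using d is_unit_iff_degree[of p] by fastforce
    fix a b assume ab: "p = a * b"
    have nz: "a \<noteq> 0" "b \<noteq> 0" using ab d by auto
    have "degree a \<noteq> 1" "degree b \<noteq> 1" using degree_1_has_root r unfolding ab by fastforce+
    moreover have "degree a + degree b = 2" using d unfolding ab by (simp add: degree_mult_eq nz)
    ultimately have "degree a = 0 \<or> degree b = 0" by linarith
    then show "a dvd 1 \<or> b dvd 1" using nz by (simp add: is_unit_iff_degree)
  qed
qed

text \<open>The list gives the degree with the number of monic quadratic factors. A cofactor without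
  zeros never has degree 1, which excludes quadratic factors in degree 3 and a second one in degree
  5. In degree 4 the cofactor of one quadratic is another, different from it by squarefreeness, so
  the number is 0 or 2.\<close>

lemma rootfree_factor_count:
  fixes f :: "'k::field poly"
  assumes d: "degree f \<le> 5" and f0: "f \<noteq> 0"
    and r: "\<And>z. poly f z \<noteq> 0" and sq: "\<And>h. h * h dvd f \<Longrightarrow> degree h = 0"
  defines "Q \<equiv> {h. lead_coeff h = 1 \<and> h dvd f \<and> degree h = 2}"
  shows "finite Q \<and> (degree f, card Q) \<in> {(0,0), (2,1), (3,0), (4,0), (4,2), (5,0), (5,1)}"
proof -
  have cof: "\<exists>k. f = h * k \<and> k \<noteq> 0 \<and> degree f = 2 + degree k \<and> degree k \<noteq> 1 \<and> prime_elem h" if "h \<in> Q" for h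
  proof -
    obtain k where k: "f = h * k" using \<open>h \<in> Q\<close> unfolding Q_def by (auto elim: dvdE)
    have nz: "h \<noteq> 0" "k \<noteq> 0" using k f0 by auto
    have "degree k \<noteq> 1" using degree_1_has_root[of k] r unfolding k by fastforce
    moreover have "prime_elem h" using \<open>h \<in> Q\<close> r unfolding k Q_def by (intro rootfree_quadratic_prime) auto
    ultimately show ?thesis using k nz \<open>h \<in> Q\<close> unfolding Q_def by (auto simp: degree_mult_eq)
  qed
  have "degree f \<noteq> 1" using degree_1_has_root[of f] r by blast
  show ?thesis
  proof (cases "Q = {}")
    case True
    have "degree f \<noteq> 2"
    proof
      assume d2: "degree f = 2"
      have "smult (inverse (lead_coeff f)) f \<in> Q"
        unfolding Q_def using monic_associate[OF f0] d2 by (simp only: mem_Collect_eq simp_thms)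
      then show False using True by blast
    qed
    then show ?thesis using True d \<open>degree f \<noteq> 1\<close> by auto
  next
    case False
    then obtain h where h: "h \<in> Q" by blast
    obtain k where k: "f = h * k" "k \<noteq> 0" "degree f = 2 + degree k" "degree k \<noteq> 1" using cof[OF h] by blast
    have hm: "lead_coeff h = 1" "degree h = 2" using h unfolding Q_def by auto
    have other: "h' = h \<or> h' dvd k" if h': "h' \<in> Q" for h'
    proof -
      have "prime_elem h'" "h' dvd h * k" using cof[OF h'] h' k unfolding Q_def by auto
      then have "h' dvd h \<or> h' dvd k" by (simp add: prime_elem_dvd_mult_iff)
      then show ?thesis using monic_dvd_eq[of h' h] h' hm unfolding Q_def by auto
    qed
    consider "degree k = 0" | "degree k = 2" | "degree k = 3" using k(3,4) d by linarith
    then show ?thesis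
    proof cases
      case 1
      have "h' = h" if "h' \<in> Q" for h'
        using other[OF that] that 1 k(2) dvd_imp_degree_le[of h' k] unfolding Q_def by auto
      then have "Q = {h}" using h by blast
      then show ?thesis using 1 k(3) by simp
    next
      case 2
      define k' where "k' = smult (inverse (lead_coeff k)) k"
      have k': "lead_coeff k' = 1" "degree k' = 2" "k' dvd k" "k dvd k'"
        unfolding k'_def using monic_associate[OF k(2)] 2 by (simp_all only:)
      have kQ: "k' \<in> Q" unfolding Q_def using k' k(1) by auto
      have "k' \<noteq> h"
      proof
        assume e: "k' = h"
        have "h * h dvd f" unfolding k(1) using k'(3) unfolding e by (intro mult_dvd_mono) auto
        then show False using sq[of h] hm by simp
      qed
      moreover have "h' = h \<or> h' = k'" if "h' \<in> Q" for h'
        using other[OF that] that k' monic_dvd_eq[of h' k'] dvd_trans[of h' k k'] unfolding Q_def by auto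
      then have "Q = {h, k'}" using h kQ by blast
      ultimately show ?thesis using 2 k(3) by simp
    next
      case 3
      have "h' = h" if h': "h' \<in> Q" for h'
      proof (rule ccontr)
        assume "h' \<noteq> h"
        then obtain l where l: "k = h' * l" using other[OF h'] by (auto elim: dvdE)
        have "h' \<noteq> 0" "l \<noteq> 0" using l k(2) by auto
        then have "degree l = 1" using 3 h' unfolding l Q_def by (simp add: degree_mult_eq)
        then show False using degree_1_has_root[of l] r unfolding k(1) l by fastforce
      qed
      then have "Q = {h}" using h by blast
      then show ?thesis using 3 k(3) by simp
    qed
  qed
qed

lemma choose_2_cases: "(0::nat) choose 2 = 0" "(1::nat) choose 2 = 0" "(2::nat) choose 2 = 1" "(3::nat) choose 2 = 3"
    "(4::nat) choose 2 = 6" "(5::nat) choose 2 = 10"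
  by (simp_all add: choose_two)

text \<open>A quintic form is dehomogenized: in degree 4 it has a further root at infinity, which is counted by
  5 - degree f, and R then contains linear polynomials, standing for quadratic forms vanishing at infinity.\<close>
lemma quintic_factor_count:
  fixes f :: "'k::field poly"
  assumes d: "degree f = 4 \<or> degree f = 5" and sq: "\<And>h. h * h dvd f \<Longrightarrow> degree h = 0"
  defines "Z \<equiv> {z. poly f z = 0}"
  defines "R \<equiv> {h. lead_coeff h = 1 \<and> h dvd f \<and> degree h \<le> 2 \<and> degree f \<le> 3 + degree h}"
  shows "finite Z \<and> finite R \<and> 2 + 3 * (card Z + (5 - degree f)) + card R \<in> {2, 3, 5, 7, 9, 15, 27}"
proof -
  have f0: "f \<noteq> 0" using d by auto
  have fZ: "finite Z" unfolding Z_def using poly_roots_finite[OF f0] .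
  define lp :: "'k set \<Rightarrow> 'k poly" where "lp A = (\<Prod>z\<in>A. [:-z, 1:])" for A
  have lp_root: "poly (lp A) a = 0 \<longleftrightarrow> a \<in> A" if "finite A" for A a
    using that unfolding lp_def by (auto simp: poly_prod)
  have "lp Z dvd f" unfolding lp_def by (rule linear_prod_dvd[OF fZ]) (simp add: Z_def)
  then obtain f' where f': "f = lp Z * f'" by (elim dvdE)
  have nz: "lp Z \<noteq> 0" "f' \<noteq> 0" using f' f0 by auto
  have deg: "degree f = card Z + degree f'"
    unfolding f' degree_mult_eq[OF nz] by (simp add: lp_def degree_linear_prod)
  have r': "poly f' z \<noteq> 0" for z
  proof
    assume z: "poly f' z = 0"
    then have "poly f z = 0" by (simp add: f')
    then have "[:-z,1:] dvd lp Z" using lp_root[OF fZ, of z] by (simp add: Z_def poly_eq_0_iff_dvd)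
    moreover have "[:-z,1:] dvd f'" using z by (simp add: poly_eq_0_iff_dvd)
    ultimately have "[:-z,1:] * [:-z,1:] dvd f" unfolding f' by (rule mult_dvd_mono)
    then show False using sq by fastforce
  qed
  define Q where "Q = {h. lead_coeff h = 1 \<and> h dvd f' \<and> degree h = 2}"
  have Q: "finite Q \<and> (degree f', card Q) \<in> {(0,0), (2,1), (3,0), (4,0), (4,2), (5,0), (5,1)}"
    unfolding Q_def
  proof (rule rootfree_factor_count[OF _ nz(2) r'])
    show "degree f' \<le> 5" using deg d by linarith
    show "degree h = 0" if "h * h dvd f'" for h
      using that by (intro sq) (simp add: f')
  qed
  \<comment> \<open>\<open>B\<close> holds the products of two finite linear factors,
    \<open>C\<close> the single ones, each standing for its product with the zero at infinity;
    \<open>Q\<close> has the quadratic factors without zeros.\<close>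
  define B where "B = lp ` {A. A \<subseteq> Z \<and> card A = 2}"
  define C where "C = (if degree f = 4 then lp ` (\<lambda>z. {z}) ` Z else {})"
  have finB: "finite {A. A \<subseteq> Z \<and> card A = 2}" using fZ by simp
  have inj: "inj_on lp {A. A \<subseteq> Z}"
  proof (rule inj_onI)
    fix A A' assume "A \<in> {A. A \<subseteq> Z}" "A' \<in> {A. A \<subseteq> Z}" "lp A = lp A'"
    then have "a \<in> A \<longleftrightarrow> a \<in> A'" for a
      using lp_root[of A a] lp_root[of A' a] finite_subset[OF _ fZ] by simp
    then show "A = A'" by blast
  qed
  have "inj_on lp {A. A \<subseteq> Z \<and> card A = 2}" by (rule inj_on_subset[OF inj]) blast
  then have cB: "finite B" "card B = card Z choose 2"
    unfolding B_def using finB n_subsets[OF fZ, of 2] by (simp_all add: card_image)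
  have cC: "finite C" "card C = (5 - degree f) * card Z"
  proof -
    have "card (lp ` (\<lambda>z. {z}) ` Z) = card Z"
      by (subst card_image[OF inj_on_subset[OF inj]]) (auto simp: card_image)
    then show "finite C" "card C = (5 - degree f) * card Z" unfolding C_def using d fZ by auto
  qed
  have sub_dvd: "lp A dvd f" if "A \<subseteq> Z" for A
    unfolding f' lp_def using prod_dvd_prod_subset[OF fZ that] by (rule dvd_mult2)
  have mon: "lead_coeff (lp A) = 1" "degree (lp A) = card A" for A
    unfolding lp_def by (rule lead_coeff_linear_prod, rule degree_linear_prod)
  have lin: "\<exists>z\<in>Z. h = lp {z}" if h: "lead_coeff h = 1" "h dvd f" "degree h = 1" for h
  proof -
    obtain z where z: "poly h z = 0" using degree_1_has_root[OF h(3)] by blast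
    then have "[:-z,1:] = h" using h by (intro monic_dvd_eq) (auto simp: poly_eq_0_iff_dvd)
    moreover have "z \<in> Z" using z h(2) by (auto simp: Z_def elim: dvdE)
    ultimately show ?thesis by (auto simp: lp_def)
  qed
  have quad: "h \<in> B \<union> Q" if h: "lead_coeff h = 1" "h dvd f" "degree h = 2" for h
  proof (cases "\<exists>z. poly h z = 0")
    case True
    then obtain a where a: "poly h a = 0" by blast
    then obtain k where k: "h = [:-a,1:] * k" by (auto simp: poly_eq_0_iff_dvd elim: dvdE)
    have k0: "k \<noteq> 0" using k h by auto
    have dk: "degree k = 1" using h(3) unfolding k by (subst (asm) degree_mult_eq) (auto simp: k0)
    have lk: "lead_coeff k = 1" using h(1) unfolding k lead_coeff_mult by simp
    have kh: "k dvd h" unfolding k by (rule dvd_triv_right)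
    obtain b where b: "b \<in> Z" "k = lp {b}"
      using lin[OF lk dvd_trans[OF kh h(2)] dk] by blast
    have kb: "k = [:-b,1:]" using b by (simp add: lp_def)
    have "a \<noteq> b"
    proof
      assume "a = b"
      then have "[:-a,1:] * [:-a,1:] dvd f" using h(2) unfolding k kb by simp
      then show False using sq by fastforce
    qed
    moreover have "a \<in> Z" using a h(2) by (auto simp: Z_def elim: dvdE)
    moreover have "h = lp {a, b}" using \<open>a \<noteq> b\<close> unfolding k kb lp_def by simp
    ultimately show ?thesis unfolding B_def using b(1) by auto
  next
    case False
    then have "prime_elem h" by (intro rootfree_quadratic_prime[OF h(3)]) blast
    moreover have "\<not> h dvd lp Z"
    proof
      assume "h dvd lp Z"
      then obtain z where "h dvd [:-z,1:]" using prime_elem_dvd_prod[OF \<open>prime_elem h\<close> fZ] unfolding lp_def by blast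
      then have "degree h \<le> 1" using dvd_imp_degree_le[of h "[:-z,1:]"] by simp
      then show False using h(3) by simp
    qed
    ultimately have "h dvd f'" using h(2) unfolding f' by (simp add: prime_elem_dvd_mult_iff)
    then show ?thesis using h unfolding Q_def by blast
  qed
  have "R = C \<union> (B \<union> Q)"
  proof (intro equalityI subsetI)
    fix h assume h: "h \<in> R"
    \<comment> \<open>The cofactor has degree at most 3, so h has degree 2, except that for degree f
      = 4 the missing factor may be the one at infinity.\<close>
    then consider "degree h = 2" | "degree h = 1" "degree f = 4" using d unfolding R_def by fastforce
    then show "h \<in> C \<union> (B \<union> Q)"
      by cases (use h quad[of h] lin[of h] in \<open>auto simp: R_def C_def\<close>)
  next
    fix h assume "h \<in> C \<union> (B \<union> Q)"
    then show "h \<in> R"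
    proof (elim UnE)
      assume "h \<in> C"
      then obtain z where "z \<in> Z" "h = lp {z}" "degree f = 4" unfolding C_def by (auto split: if_splits)
      then show ?thesis unfolding R_def using sub_dvd[of "{z}"] mon[of "{z}"] by simp
    next
      assume "h \<in> B"
      then obtain A where "A \<subseteq> Z" "h = lp A" "card A = 2" unfolding B_def by blast
      then show ?thesis unfolding R_def using sub_dvd[of A] mon[of A] d by auto
    next
      assume "h \<in> Q"
      then show ?thesis unfolding R_def Q_def f' using d deg f' by auto
    qed
  qed
  moreover have "B \<inter> Q = {}"
  proof -
    have "poly h z \<noteq> 0" if "h \<in> Q" for h z using that r'[of z] unfolding Q_def by (auto elim: dvdE)
    moreover have "\<exists>z. poly h z = 0" if "h \<in> B" for h
    proof -
      obtain A where A: "A \<subseteq> Z" "h = lp A" "card A = 2" using \<open>h \<in> B\<close> unfolding B_def by blast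
      then have "finite A" "A \<noteq> {}" using finite_subset fZ by auto
      then show ?thesis using lp_root[of A] A by blast
    qed
    ultimately show ?thesis by blast
  qed
  moreover have "C \<inter> (B \<union> Q) = {}"
  proof -
    have "degree h = 1" if "h \<in> C" for h using that mon unfolding C_def by (auto split: if_splits)
    moreover have "degree h = 2" if "h \<in> B \<union> Q" for h using that mon unfolding B_def Q_def by auto
    ultimately show ?thesis by fastforce
  qed
  ultimately have R: "finite R" "card R = (5 - degree f) * card Z + ((card Z choose 2) + card Q)"
    using cB cC Q by (simp_all add: card_Un_disjoint)
  define e where "e = 5 - degree f"
  have A: "card Z + e + degree f' = 5" using deg d unfolding e_def by auto
  have e01: "e = 0 \<or> e = 1" using d unfolding e_def by auto
  \<comment> \<open>Pairs of zeros of the quintic form, split by whether they contain the zero at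
    infinity, present exactly for e = 1.\<close>
  have "(card Z + e) choose 2 = e * card Z + (card Z choose 2)"
    using e01 by (auto simp: numeral_2_eq_2)
  then have N: "2 + 3 * (card Z + (5 - degree f)) + card R = 2 + 3 * (card Z + e) + (((card Z + e) choose 2) + card Q)"
    unfolding R(2) e_def[symmetric] by simp
  define a where "a = card Z + e"
  have "a + degree f' = 5" using A by (simp add: a_def)
  \<comment> \<open>The factor types of a squarefree quintic form with their values: 1+1+1+1+1 gives
    27, 1+1+1+2 gives 15, 1+1+3 gives 9, 1+4 gives 5, 1+2+2 gives 7, 5 gives 2 and 2+3 gives
    3.\<close>
  then have "(a = 5 \<and> card Q = 0) \<or> (a = 3 \<and> card Q = 1) \<or> (a = 2 \<and> card Q = 0) \<or> (a = 1 \<and> card Q = 0) \<or> (a = 1 \<and> card Q = 2)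
     \<or> (a = 0 \<and> card Q = 0) \<or> (a = 0 \<and> card Q = 1)"
    using conjunct2[OF Q] unfolding insert_iff prod.inject empty_iff by presburger
  then have "2 + 3 * a + ((a choose 2) + card Q) \<in> {2, 3, 5, 7, 9, 15, 27}"
    by (elim disjE conjE) (simp_all add: choose_2_cases[unfolded One_nat_def])
  then have "2 + 3 * (card Z + (5 - degree f)) + card R \<in> {2, 3, 5, 7, 9, 15, 27}"
    by (simp only: N a_def)
  then show ?thesis using fZ R(1) by blast
qed

section \<open>Graphs skew to two given lines\<close>

lemma degree_le_1_coeffs:
  fixes p :: "'k::comm_ring_1 poly"
  assumes "degree p \<le> 1"
  shows "\<exists>a b. p = [:a, b:]"
proof -
  have "p = [:coeff p 0, coeff p 1:]"
    using assms by (auto intro!: poly_eqI simp: coeff_pCons coeff_eq_0 split: nat.splits)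
  then show ?thesis by blast
qed

text \<open>The form is y2 * A2(x) + y3 * A3(x) + C0(x) * y2^2 + C1(x) * y2 * y3 + C2(x) * y3^2, with binary forms in
  x = (1, z) dehomogenized to polynomials in z. A form vanishing at z = infinity shows as a drop of the degree,
  so the degree bounds are part of the data. The pair (P, Q) stands for the graph of (1, z) \<mapsto> (P(z), Q(z)).\<close>
locale skew_graphs =
  fixes A2 A3 C0 C1 C2 U V f :: "'k::field poly"
  assumes dA: "degree A2 \<le> 2" "degree A3 \<le> 2" "degree A2 = 2 \<or> degree A3 = 2"
    and dC: "degree C0 \<le> 1" "degree C1 \<le> 1" "degree C2 \<le> 1"
    and bez: "U * A2 + V * A3 = 1"
    and f_def: "f = C0 * A3\<^sup>2 - C1 * A2 * A3 + C2 * A2\<^sup>2"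
    and df: "degree f = 4 \<or> degree f = 5"
    and sq: "\<And>h. h * h dvd f \<Longrightarrow> degree h = 0"
    and C_pt: "\<And>v w. smult (v\<^sup>2) C0 + smult (v * w) C1 + smult (w\<^sup>2) C2 = 0 \<Longrightarrow> v = 0 \<and> w = 0"
begin

text \<open>The determinant of the linear map given by (P, Q). The graph misses L exactly when it is
  nonzero; a graph over L misses M in any case.\<close>

definition graph_det :: "'k poly \<Rightarrow> 'k poly \<Rightarrow> 'k" where
  "graph_det P Q = coeff P 0 * coeff Q 1 - coeff P 1 * coeff Q 0"

definition quad_part :: "'k poly \<Rightarrow> 'k poly \<Rightarrow> 'k poly" where
  "quad_part P Q = C0 * P\<^sup>2 + C1 * P * Q + C2 * Q\<^sup>2"

definition skew_sols :: "('k poly \<times> 'k poly) set" where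
  "skew_sols = {(P, Q). degree P \<le> 1 \<and> degree Q \<le> 1 \<and> graph_det P Q \<noteq> 0 \<and> A2 * P + A3 * Q + quad_part P Q = 0}"

text \<open>By coprimality a solution is a multiple of (A3, -A2), one entry of which has degree 2,
  too much for P and Q. So (P, Q) \<mapsto> A2 P + A3 Q is injective on pairs of linear
  forms.\<close>

lemma kernel:
  assumes "degree P \<le> 1" "degree Q \<le> 1" "A2 * P + A3 * Q = 0"
  shows "P = 0 \<and> Q = 0"
proof -
  have "Q = Q * (U * A2 + V * A3)" unfolding bez by simp
  also have "\<dots> = A2 * (U * Q - V * P) + V * (A2 * P + A3 * Q)" by (simp add: algebra_simps)
  finally have Q: "Q = A2 * (U * Q - V * P)" unfolding assms(3) by simp
  have "P = P * (U * A2 + V * A3)" unfolding bez by simp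
  also have "\<dots> = A3 * (V * P - U * Q) + U * (A2 * P + A3 * Q)" by (simp add: algebra_simps)
  finally have P: "P = A3 * (V * P - U * Q)" unfolding assms(3) by simp
  have "U * Q - V * P = 0"
  proof (rule ccontr)
    assume n: "U * Q - V * P \<noteq> 0"
    then have n': "V * P - U * Q \<noteq> 0" by simp
    show False
    proof (cases "degree A2 = 2")
      case True
      then have "degree (A2 * (U * Q - V * P)) \<ge> 2" using n by (subst degree_mult_eq) auto
      then show False using Q assms(2) by simp
    next
      case False
      then have "degree A3 = 2" using dA(3) by blast
      then have "degree (A3 * (V * P - U * Q)) \<ge> 2" using n' by (subst degree_mult_eq) auto
      then show False using P assms(1) by simp
    qed
  qed
  moreover from this have "V * P - U * Q = 0" by (simp add: algebra_simps)
  ultimately show ?thesis using P Q by simp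
qed

lemma degree_mult_le_add: "degree p \<le> m \<Longrightarrow> degree q \<le> n \<Longrightarrow> degree (p * q) \<le> m + n" for p q :: "'k poly"
  using degree_mult_le[of p q] by linarith

text \<open>Multiplying the Bezout identity by g gives a solution of unbounded degree; reducing the
  coefficient of A' modulo A bounds Q, and A P = g - A' Q then bounds P.\<close>

lemma cubic_preimage_aux:
  fixes A A' W W' g :: "'k poly"
  assumes "degree A = 2" "degree A' \<le> 2" "W * A + W' * A' = 1" "degree g \<le> 3"
  shows "\<exists>P Q. degree P \<le> 1 \<and> degree Q \<le> 1 \<and> A * P + A' * Q = g"
proof -
  define Q where "Q = (g * W') mod A"
  define D where "D = (g * W') div A"
  define P where "P = g * W + A' * D"
  have A0: "A \<noteq> 0" using assms(1) by auto
  have "degree Q < 2 \<or> Q = 0" unfolding Q_def using degree_mod_less[OF A0, of "g * W'"] assms(1) by auto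
  then have dQ: "degree Q \<le> 1" by auto
  have e: "g * W' = A * D + Q" unfolding Q_def D_def by simp
  have "g * (W * A + W' * A') = A * (g * W) + A' * (g * W')" by (simp add: algebra_simps)
  also have "\<dots> = A * P + A' * Q" unfolding e P_def by (simp add: algebra_simps)
  finally have "g * (W * A + W' * A') = A * P + A' * Q" .
  then have g: "A * P + A' * Q = g" using assms(3) by simp
  have "degree P \<le> 1"
  proof (rule ccontr)
    assume n: "\<not> degree P \<le> 1"
    then have "degree (A * P) \<ge> 4" using assms(1) A0 by (subst degree_mult_eq) auto
    moreover have "A * P = g - A' * Q" using g by (simp add: algebra_simps)
    moreover have "degree (g - A' * Q) \<le> 3"
      using degree_mult_le_add[OF assms(2) dQ] assms(4) by (intro degree_diff_le) auto
    ultimately show False by simp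
  qed
  then show ?thesis using dQ g by blast
qed

lemma cubic_preimage:
  assumes "degree g \<le> 3"
  shows "\<exists>P Q. degree P \<le> 1 \<and> degree Q \<le> 1 \<and> A2 * P + A3 * Q = g"
proof (cases "degree A2 = 2")
  case True
  then show ?thesis by (intro cubic_preimage_aux[OF _ dA(2) bez assms])
next
  case False
  then have "degree A3 = 2" using dA(3) by blast
  moreover have "V * A3 + U * A2 = 1" using bez by (simp add: add.commute)
  ultimately obtain P Q where "degree P \<le> 1" "degree Q \<le> 1" "A3 * P + A2 * Q = g"
    using cubic_preimage_aux[OF _ dA(1) _ assms] by blast
  then show ?thesis by (intro exI[of _ Q] exI[of _ P]) (simp add: add.commute)
qed

text \<open>f is the value of the quadratic form at the common zero (A3, -A2) of the linear form A2 * y2 + A3 * y3,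
  so modulo g it agrees with the value at (P, Q) up to the square of the proportionality factor.\<close>
lemma resultant_identities:
  fixes P Q defines "g \<equiv> A2 * P + A3 * Q"
  shows "f * P\<^sup>2 = A3\<^sup>2 * quad_part P Q + g * (C2 * g - C1 * A3 * P - 2 * C2 * A3 * Q)" (is ?A)
    and "f * Q\<^sup>2 = A2\<^sup>2 * quad_part P Q + g * (C0 * g - 2 * C0 * A2 * P - C1 * A2 * Q)" (is ?B)
    and "f * (P * Q) = - (A2 * A3) * quad_part P Q + g * (C0 * A3 * P + C2 * A2 * Q)" (is ?C)
  unfolding f_def g_def quad_part_def by (simp_all add: algebra_simps power2_eq_square)

lemma degree_power2_le: "degree p \<le> m \<Longrightarrow> degree (p\<^sup>2) \<le> 2 * m" for p :: "'k poly"
  using degree_mult_le_add[of p m p m] by (simp add: power2_eq_square)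

text \<open>As binary forms these have degrees 3, 3, 4 and 4; the bounds retain this information
  after dehomogenization, where it controls the behaviour at infinity.\<close>

lemma degree_remainders:
  assumes "degree P \<le> 1" "degree Q \<le> 1"
  defines "g \<equiv> A2 * P + A3 * Q"
  shows "degree g \<le> 3" "degree (quad_part P Q) \<le> 3"
    "degree (C2 * g - C1 * A3 * P - 2 * C2 * A3 * Q) \<le> 4"
    "degree (C0 * g - 2 * C0 * A2 * P - C1 * A2 * Q) \<le> 4"
proof -
  have d2: "degree (2 * p) \<le> degree p" for p :: "'k poly"
    using degree_smult_le[of 2 p] by (simp add: numeral_poly)
  show g: "degree g \<le> 3" unfolding g_def
    by (rule degree_add_le) (use degree_mult_le_add[OF dA(1) assms(1)] degree_mult_le_add[OF dA(2) assms(2)] in auto)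
  have p: "degree (p * q) \<le> 3" if "degree p \<le> 1" "degree q \<le> 2" for p q :: "'k poly"
    using degree_mult_le_add[OF that] by simp
  have q: "degree (p * q * r) \<le> 4" if "degree p \<le> 1" "degree q \<le> 2" "degree r \<le> 1" for p q r :: "'k poly"
    using degree_mult_le_add[OF p[OF that(1,2)] that(3)] by simp
  have c: "degree (p * g) \<le> 4" if "degree p \<le> 1" for p :: "'k poly" using degree_mult_le_add[OF that g] by simp
  have dd: "degree (2 * p) \<le> 1" if "degree p \<le> 1" for p :: "'k poly" using d2[of p] that by simp
  have pp: "degree (p\<^sup>2) \<le> 2" if "degree p \<le> 1" for p :: "'k poly" using degree_power2_le[OF that] by simp
  have "degree (C1 * P * Q) \<le> 3"
    using degree_mult_le_add[OF degree_mult_le_add[OF dC(2) assms(1)] assms(2)] by simp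
  then show "degree (quad_part P Q) \<le> 3" unfolding quad_part_def
    by (intro degree_add_le[OF degree_add_le[OF p[OF dC(1) pp[OF assms(1)]] _] p[OF dC(3) pp[OF assms(2)]]])
  show "degree (C2 * g - C1 * A3 * P - 2 * C2 * A3 * Q) \<le> 4"
    "degree (C0 * g - 2 * C0 * A2 * P - C1 * A2 * Q) \<le> 4"
    by (intro degree_diff_le q c dd dC dA assms)+
qed

text \<open>P and Q form a basis of the polynomials of degree at most 1; the coefficients of 1 in it
  come from Cramer's rule.\<close>

lemma det_bezout:
  assumes "degree P \<le> 1" "degree Q \<le> 1" "graph_det P Q \<noteq> 0"
  shows "\<exists>u v. smult u P + smult v Q = 1"
proof -
  obtain p r q s where P: "P = [:p, r:]" and Q: "Q = [:q, s:]"
    using degree_le_1_coeffs[OF assms(1)] degree_le_1_coeffs[OF assms(2)] by blast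
  define D where "D = p * s - r * q"
  have D: "D \<noteq> 0" using assms(3) unfolding graph_det_def P Q D_def by simp
  have "s / D * p + - r / D * q = (p * s - r * q) / D" by (simp add: diff_divide_distrib mult.commute)
  also have "\<dots> = 1" using D unfolding D_def[symmetric] by simp
  finally have "smult (s / D) P + smult (- r / D) Q = 1" unfolding P Q by (simp add: one_pCons mult.commute)
  then show ?thesis by blast
qed

text \<open>For a solution the quadratic part is -g, so the resultant identities make g divide f
  P^2, f P Q and f Q^2. As 1 is a constant combination of P and Q, its square shows that g divides
  f.\<close>

lemma sol_divides:
  assumes "(P, Q) \<in> skew_sols"
  defines "g \<equiv> A2 * P + A3 * Q"
  obtains h where "f = g * h" "g \<noteq> 0" "h \<noteq> 0" "degree h \<le> 2" "degree f \<le> 3 + degree h"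
proof -
  have PQ: "degree P \<le> 1" "degree Q \<le> 1" "graph_det P Q \<noteq> 0" and "A2 * P + A3 * Q + quad_part P Q = 0"
    using assms(1) unfolding skew_sols_def by auto
  then have Bg: "quad_part P Q = - g" unfolding g_def by (metis minus_unique)
  have f0: "f \<noteq> 0" using df by auto
  obtain u v where uv: "smult u P + smult v Q = 1" using det_bezout[OF PQ] by blast
  note ids = resultant_identities[where P = P and Q = Q, folded g_def, unfolded Bg]
  define a b where ab: "a = [:u:]" "b = [:v:]"
  have "f = f * (a * P + b * Q)\<^sup>2" using uv unfolding ab by simp
  also have "\<dots> = a * a * (f * P\<^sup>2) + 2 * a * b * (f * (P * Q)) + b * b * (f * Q\<^sup>2)"
    by (simp add: power2_eq_square algebra_simps)
  also have "g dvd \<dots>"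
    
  proof -
    have "g dvd y * (- g) + g * z" for y z by (intro dvd_add) simp_all
    then show ?thesis unfolding ids by (intro dvd_add[OF dvd_add] dvd_mult)
  qed
  finally have "g dvd f" .
  then obtain h where h: "f = g * h" by (elim dvdE)
  have nz: "g \<noteq> 0" "h \<noteq> 0" using h f0 by auto
  have deg: "degree f = degree g + degree h" unfolding h by (rule degree_mult_eq[OF nz])
  \<comment> \<open>Cancelling g in an identity gives h T^2 = S - A^2 of degree at most 4, with T
    one of P and Q. Choosing T of degree exactly 1, which a nonzero determinant permits, bounds the
    degree of h by 2.\<close>
  have "degree P = 1 \<or> degree Q = 1"
  proof (rule ccontr)
    assume "\<not> ?thesis"
    then have "degree P < 1" "degree Q < 1" using PQ by auto
    then show False using PQ(3) by (simp add: graph_det_def coeff_eq_0)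
  qed
  moreover have "degree h \<le> 2" if "f * T\<^sup>2 = A\<^sup>2 * (- g) + g * S" "degree T = 1" "degree A \<le> 2" "degree S \<le> 4" for T A S
  proof -
    have "g * (h * T\<^sup>2) = g * (S - A\<^sup>2)" using that(1) unfolding h by (simp add: algebra_simps)
    then have e: "h * T\<^sup>2 = S - A\<^sup>2" using nz by simp
    have "T \<noteq> 0" using that(2) by auto
    then have "degree (h * T\<^sup>2) = degree h + 2" using nz that(2)
      by (simp add: degree_mult_eq power2_eq_square)
    moreover have "degree (S - A\<^sup>2) \<le> 4" using degree_power2_le[OF that(3)] that(4) by (intro degree_diff_le) auto
    ultimately show ?thesis using e by simp
  qed
  then have "degree h \<le> 2" if "degree P = 1 \<or> degree Q = 1"
    using that ids(1,2) dA degree_remainders(3,4)[OF PQ(1,2), folded g_def] by blast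
  ultimately have "degree h \<le> 2" by blast
  moreover have "degree g \<le> 3" using degree_remainders(1)[OF PQ(1,2)] unfolding g_def .
  ultimately show ?thesis using that[OF h nz] deg by simp
qed

lemma quad_part_scale: "quad_part (smult c P) (smult c Q) = smult (c\<^sup>2) (quad_part P Q)"
  unfolding quad_part_def by (simp add: power2_eq_square algebra_simps smult_add_right)

lemma quad_part_const: "quad_part (smult v T) (smult w T) = T\<^sup>2 * (smult (v\<^sup>2) C0 + smult (v * w) C1 + smult (w\<^sup>2) C2)"
  unfolding quad_part_def by (simp add: power2_eq_square algebra_simps smult_add_right)

text \<open>Write B = x0 E(y) + x1 D(y). If this vanishes on the graph, then E(\<phi>(x)) = x1 l(x)
  and D(\<phi>(x)) = - x0 l(x) for one linear form l. At a zero of l both E and D vanish, and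
  \<phi>(x) is nonzero there, against \<open>C_pt\<close>.\<close>

lemma quad_part_nonzero:
  assumes PQ: "degree P \<le> 1" "degree Q \<le> 1" "graph_det P Q \<noteq> 0"
  shows "quad_part P Q \<noteq> 0"
proof
  assume B0: "quad_part P Q = 0"
  obtain c0 d0 c1 d1 c2 d2 where C: "C0 = [:c0, d0:]" "C1 = [:c1, d1:]" "C2 = [:c2, d2:]"
    using dC by (metis degree_le_1_coeffs)
  obtain p r q s where P: "P = [:p, r:]" and Q: "Q = [:q, s:]" using PQ by (metis degree_le_1_coeffs)
  have det: "p * s - r * q \<noteq> 0" using PQ(3) unfolding graph_det_def P Q by simp
  define E where "E v w = c0 * v\<^sup>2 + c1 * v * w + c2 * w\<^sup>2" for v w
  define D where "D v w = d0 * v\<^sup>2 + d1 * v * w + d2 * w\<^sup>2" for v w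
  have pt: "v = 0 \<and> w = 0" if "E v w = 0" "D v w = 0" for v w
  proof (rule C_pt)
    show "smult (v\<^sup>2) C0 + smult (v * w) C1 + smult (w\<^sup>2) C2 = 0"
      unfolding C using that unfolding E_def D_def by (simp add: algebra_simps)
  qed
  define m where "m = 2 * d0 * p * r + d1 * (p * s + q * r) + 2 * d2 * q * s"
  have "quad_part P Q = C0 * P\<^sup>2 + C1 * P * Q + C2 * Q\<^sup>2" by (rule quad_part_def)
  also have "\<dots> = [: E p q, D p q + (2 * c0 * p * r + c1 * (p * s + q * r) + 2 * c2 * q * s), E r s + m, D r s :]"
    unfolding P Q C E_def D_def m_def by (simp add: power2_eq_square algebra_simps)
  finally have "quad_part P Q = [: E p q, D p q + (2 * c0 * p * r + c1 * (p * s + q * r) + 2 * c2 * q * s), E r s + m, D r s :]" .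
  then have z: "E p q = 0" "D p q + (2 * c0 * p * r + c1 * (p * s + q * r) + 2 * c2 * q * s) = 0"
      "E r s + m = 0" "D r s = 0" using B0 by simp_all
  show False
  \<comment> \<open>The common linear form is l(1, t) = - D(p, q) - m t. Its zero is at infinity,
    with image (r, s), when m = 0.\<close>
  proof (cases "m = 0")
    case True
    then have "r = 0 \<and> s = 0" using pt[of r s] z by simp
    then show False using det by simp
  next
    case False
    define t where "t = - D p q / m"
    have tm: "t * m = - D p q" unfolding t_def using False by simp
    have "D (p + r * t) (q + s * t) = D p q + t * m + t\<^sup>2 * D r s"
      unfolding D_def m_def by (simp add: power2_eq_square algebra_simps)
    then have "D (p + r * t) (q + s * t) = 0" using z tm by simp
    moreover have "E (p + r * t) (q + s * t) = E p q + t * (2 * c0 * p * r + c1 * (p * s + q * r) + 2 * c2 * q * s) + t * t * E r s"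
      unfolding E_def by (simp add: power2_eq_square algebra_simps)
    moreover have "\<dots> = 0"
    proof -
      have 1: "2 * c0 * p * r + c1 * (p * s + q * r) + 2 * c2 * q * s = t * m"
        using minus_unique[OF z(2)] unfolding tm by (rule sym)
      have 2: "E r s = - m" using z(3) by (simp add: eq_neg_iff_add_eq_0)
      show ?thesis unfolding 1 2 z(1) by simp
    qed
    ultimately have "p + r * t = 0 \<and> q + s * t = 0" by (intro pt) simp_all
    then have "p = - r * t" "q = - s * t" by (simp_all add: eq_neg_iff_add_eq_0)
    then show False using det by simp
  qed
qed

lemma degenerate_split:
  assumes PQ: "degree P \<le> 1" "degree Q \<le> 1" "graph_det P Q = 0"
  obtains T v w where "P = smult v T" "Q = smult w T" "degree T \<le> 1"
proof -
  obtain p r q s where P: "P = [:p, r:]" and Q: "Q = [:q, s:]" using PQ by (metis degree_le_1_coeffs)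
  have det: "p * s = r * q" using PQ(3) unfolding graph_det_def P Q by simp
  show ?thesis
  proof (cases "P = 0")
    case True
    then show ?thesis using that[of 0 Q 1] PQ by simp
  next
    case False
    show ?thesis
    proof (cases "p = 0")
      case True
      then have "r \<noteq> 0" using False P by simp
      then have "Q = smult (s / r) P" using det True by (simp add: P Q)
      then show ?thesis using that[of 1 P "s / r"] PQ by simp
    next
      case p: False
      then have "Q = smult (q / p) P" using det by (simp add: P Q field_simps)
      then show ?thesis using that[of 1 P "q / p"] PQ by simp
    qed
  qed
qed

text \<open>Solve A2 P + A3 Q = g first. Divisibility and degrees force the quadratic part to be c g
  with constant c, and scaling (P, Q) by -1/c makes the two parts cancel.\<close>

lemma factor_gives_sol:
  assumes h: "f = g * h" "degree h \<le> 2" "degree f \<le> 3 + degree h"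
  shows "\<exists>P Q c. (P, Q) \<in> skew_sols \<and> c \<noteq> 0 \<and> A2 * P + A3 * Q = smult c g"
proof -
  have f0: "f \<noteq> 0" using df by auto
  have nz: "g \<noteq> 0" "h \<noteq> 0" using h f0 by auto
  have deg: "degree f = degree g + degree h" unfolding h by (rule degree_mult_eq[OF nz])
  obtain P Q where PQ: "degree P \<le> 1" "degree Q \<le> 1" and g: "A2 * P + A3 * Q = g"
    using cubic_preimage[of g] deg h(3) by auto
  note ids = resultant_identities[where P = P and Q = Q, unfolded g]
  note drem = degree_remainders[OF PQ, unfolded g]
  \<comment> \<open>The resultant identities read modulo g, where f is 0. The squared Bezout
    identity afterwards removes the factors A2 and A3.\<close>
  have dv: "g dvd A3\<^sup>2 * quad_part P Q" "g dvd A2\<^sup>2 * quad_part P Q" "g dvd A2 * A3 * quad_part P Q"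
  proof -
    have gf: "g dvd f * x" for x unfolding h(1) by simp
    have *: "g dvd y" if "f * x = y + g * z" for x y z
      using gf[of x] unfolding that by (simp add: dvd_add_left_iff)
    show "g dvd A3\<^sup>2 * quad_part P Q" "g dvd A2\<^sup>2 * quad_part P Q" by (rule *[OF ids(1)], rule *[OF ids(2)])
    have "g dvd - (A2 * A3) * quad_part P Q" by (rule *[OF ids(3)])
    then show "g dvd A2 * A3 * quad_part P Q" by simp
  qed
  have "quad_part P Q = (U * A2 + V * A3)\<^sup>2 * quad_part P Q" unfolding bez by simp
  also have "\<dots> = U\<^sup>2 * (A2\<^sup>2 * quad_part P Q) + 2 * U * V * (A2 * A3 * quad_part P Q) + V\<^sup>2 * (A3\<^sup>2 * quad_part P Q)"
    by (simp add: power2_eq_square algebra_simps)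
  also have "g dvd \<dots>" by (rule dvd_add[OF dvd_add[OF dvd_mult[OF dv(2)] dvd_mult[OF dv(3)]] dvd_mult[OF dv(1)]])
  finally obtain k where k: "quad_part P Q = g * k" by (elim dvdE)
  \<comment> \<open>Cancelling g leaves A^2 k = h T^2 - S of degree at most 4, while A^2 alone has
    degree 4 when A is the one of A2 and A3 of full degree.\<close>
  have "degree k = 0"
  proof (cases "k = 0")
    case False
    have *: "degree k = 0" if id: "f * T\<^sup>2 = A\<^sup>2 * quad_part P Q + g * S" and "degree A = 2" "degree T \<le> 1" "degree S \<le> 4" for T A S
    proof -
      have "g * (A\<^sup>2 * k) = g * (h * T\<^sup>2 - S)" using id unfolding k h(1) by (simp add: algebra_simps)
      then have e: "A\<^sup>2 * k = h * T\<^sup>2 - S" using nz by simp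
      have "A \<noteq> 0" using that(2) by auto
      then have "degree (A\<^sup>2 * k) = 4 + degree k" using False that(2) by (simp add: degree_mult_eq power2_eq_square)
      moreover have "degree (h * T\<^sup>2 - S) \<le> 4"
        using degree_mult_le_add[OF h(2) degree_power2_le[OF that(3)]] that(4) by (intro degree_diff_le) auto
      ultimately show ?thesis using e by simp
    qed
    show ?thesis using dA(3) *[OF ids(1) _ PQ(1) drem(3)] *[OF ids(2) _ PQ(2) drem(4)] by blast
  qed simp
  then obtain c where c: "k = [:c:]" by (elim degree_eq_zeroE)
  have Bg: "quad_part P Q = smult c g" unfolding k c by simp
  \<comment> \<open>If P = v T and Q = w T, then g = T Av and the quadratic part is T^2 Cv, so T Cv
    = c Av. Here c is nonzero by \<open>C_pt\<close>, hence T^2 divides g and f. Squarefreeness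
    makes T constant, but then g has degree at most 1 and f at most 3.\<close>
  have det: "graph_det P Q \<noteq> 0"
  proof
    assume "graph_det P Q = 0"
    then obtain T v w where T: "P = smult v T" "Q = smult w T" "degree T \<le> 1" using degenerate_split[OF PQ] by blast
    define Av where "Av = smult v A2 + smult w A3"
    define Cv where "Cv = smult (v\<^sup>2) C0 + smult (v * w) C1 + smult (w\<^sup>2) C2"
    have gT: "g = T * Av" unfolding g[symmetric] T Av_def by (simp add: algebra_simps)
    have T0: "T \<noteq> 0" using gT nz by auto
    have "T * (T * Cv) = T * (smult c Av)"
      using Bg unfolding gT T(1,2) quad_part_const Cv_def[symmetric] by (simp add: power2_eq_square algebra_simps)
    then have e: "T * Cv = smult c Av" using mult_left_cancel[OF T0] by blast
    have "c \<noteq> 0"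
    proof
      assume "c = 0"
      then have "Cv = 0" using e T0 by simp
      then have "v = 0 \<and> w = 0" unfolding Cv_def by (rule C_pt)
      then show False using nz gT unfolding Av_def by simp
    qed
    then have Av: "Av = smult (inverse c) (T * Cv)" unfolding e by simp
    have "f = T * T * (smult (inverse c) Cv * h)" unfolding h(1) gT Av by (simp add: algebra_simps)
    then have "T * T dvd f" by (rule dvdI)
    then have "degree T = 0" by (rule sq)
    moreover have "degree Cv \<le> 1" unfolding Cv_def
      by (intro degree_add_le) (use dC degree_smult_le order_trans in blast)+
    ultimately have "degree (T * Cv) \<le> 1" using degree_mult_le[of T Cv] by linarith
    then have "degree Av \<le> 1" unfolding Av by simp
    then have "degree g \<le> 1" using degree_mult_le[of T Av] \<open>degree T = 0\<close> unfolding gT by linarith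
    then show False using deg df h(2) by linarith
  qed
  have c0: "c \<noteq> 0" using quad_part_nonzero[OF PQ det] Bg by auto
  let ?P = "smult (- inverse c) P" and ?Q = "smult (- inverse c) Q"
  have g': "A2 * ?P + A3 * ?Q = smult (- inverse c) g" unfolding g[symmetric] by (simp add: smult_add_right)
  have "(- inverse c)\<^sup>2 * c = inverse c" using c0 by (simp add: power2_eq_square)
  then have "quad_part ?P ?Q = smult (inverse c) g" unfolding quad_part_scale Bg smult_smult by (simp only:)
  then have s0: "A2 * ?P + A3 * ?Q + quad_part ?P ?Q = 0" unfolding g' by simp
  have "graph_det ?P ?Q = (inverse c)\<^sup>2 * graph_det P Q"
    unfolding graph_det_def by (simp add: power2_eq_square algebra_simps)
  then have "graph_det ?P ?Q \<noteq> 0" using det c0 by simp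
  then have "(?P, ?Q) \<in> skew_sols"
    unfolding skew_sols_def mem_Collect_eq prod.case using s0 PQ degree_smult_le order_trans by blast
  then show ?thesis using g' c0 by (intro exI[of _ ?P] exI[of _ ?Q] exI[of _ "- inverse c"]) simp
qed

text \<open>The complementary factor h is determined up to a scalar, so the monic one is taken as
  the label of the solution.\<close>

lemma sols_bij_factors:
  "bij_betw (\<lambda>(P, Q). THE h. lead_coeff h = 1 \<and> (\<exists>c. c \<noteq> 0 \<and> f = (A2 * P + A3 * Q) * smult c h)) skew_sols
    {h. lead_coeff h = 1 \<and> h dvd f \<and> degree h \<le> 2 \<and> degree f \<le> 3 + degree h}"
proof -
  define R where "R = {h. lead_coeff h = 1 \<and> h dvd f \<and> degree h \<le> 2 \<and> degree f \<le> 3 + degree h}"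
  define rel where "rel P Q h \<longleftrightarrow> lead_coeff h = 1 \<and> (\<exists>c. c \<noteq> 0 \<and> f = (A2 * P + A3 * Q) * smult c h)" for P Q h
  have f0: "f \<noteq> 0" using df by auto
  have uniq: "h = h'" if rel: "rel P Q h" "rel P Q h'" for P Q h h'
  proof -
    obtain c c' where c: "f = (A2 * P + A3 * Q) * smult c h" "c \<noteq> 0" "f = (A2 * P + A3 * Q) * smult c' h'" "c' \<noteq> 0"
      "lead_coeff h = 1" "lead_coeff h' = 1" using rel unfolding rel_def by blast
    have g0: "A2 * P + A3 * Q \<noteq> 0" using c f0 by auto
    have "(A2 * P + A3 * Q) * smult c h = (A2 * P + A3 * Q) * smult c' h'" using c(1,3) by (rule trans[OF sym])
    then have e: "smult c h = smult c' h'" using mult_left_cancel[OF g0] by blast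
    then have "lead_coeff (smult c h) = lead_coeff (smult c' h')" by simp
    then have "c = c'" unfolding lead_coeff_smult using c by simp
    then show ?thesis using e c(2) by (metis smult_eq_iff divide_self_if smult_1_left)
  qed
  have ex: "\<exists>h\<in>R. rel P Q h" if PQ: "(P, Q) \<in> skew_sols" for P Q
  proof -
    obtain h where h: "f = (A2 * P + A3 * Q) * h" "h \<noteq> 0" "degree h \<le> 2" "degree f \<le> 3 + degree h"
      using sol_divides[OF PQ] by blast
    let ?h = "smult (inverse (lead_coeff h)) h"
    have l: "lead_coeff h \<noteq> 0" using h(2) by simp
    have "smult (lead_coeff h) ?h = h" unfolding smult_smult right_inverse[OF l] by simp
    then have "rel P Q ?h" unfolding rel_def using l h(1) monic_associate(1)[OF h(2)] by metis
    moreover have "?h \<in> R" unfolding R_def using monic_associate[OF h(2)] h dvd_trans[of ?h h f] by simp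
    ultimately show ?thesis by blast
  qed
  define \<Theta> where "\<Theta> = (\<lambda>(P, Q). THE h. rel P Q h)"
  have \<Theta>: "\<Theta> (P, Q) = h" if "rel P Q h" for P Q h
    unfolding \<Theta>_def using that uniq by (auto intro: the_equality)
  have "bij_betw \<Theta> skew_sols R"
    unfolding bij_betw_def
  proof
    show "inj_on \<Theta> skew_sols"
    proof (rule inj_onI, clarify)
      fix P Q P' Q' assume s: "(P, Q) \<in> skew_sols" "(P', Q') \<in> skew_sols" and e: "\<Theta> (P, Q) = \<Theta> (P', Q')"
      obtain h where h: "rel P Q h" "rel P' Q' h" using ex[OF s(1)] ex[OF s(2)] e \<Theta> by metis
      then obtain c c' where c: "f = (A2 * P + A3 * Q) * smult c h" "c \<noteq> 0" "f = (A2 * P' + A3 * Q') * smult c' h" "c' \<noteq> 0"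
        unfolding rel_def by blast
      have h0: "h \<noteq> 0" using c f0 by auto
      define a where "a = c / c'"
      have a0: "a \<noteq> 0" using c by (simp add: a_def)
      have "h * smult c (A2 * P + A3 * Q) = h * smult c' (A2 * P' + A3 * Q')" using c(1,3) by (simp add: mult.commute)
      then have "smult c (A2 * P + A3 * Q) = smult c' (A2 * P' + A3 * Q')" using mult_left_cancel[OF h0] by blast
      then have "smult (inverse c') (smult c (A2 * P + A3 * Q)) = A2 * P' + A3 * Q'" using c(4) by simp
      then have g': "A2 * P' + A3 * Q' = smult a (A2 * P + A3 * Q)" by (simp add: a_def field_simps)
      have PQ: "degree P \<le> 1" "degree Q \<le> 1" "degree P' \<le> 1" "degree Q' \<le> 1"
        and z: "A2 * P + A3 * Q + quad_part P Q = 0" "A2 * P' + A3 * Q' + quad_part P' Q' = 0"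
        using s unfolding skew_sols_def by auto
      \<comment> \<open>Equal labels mean g' = a g; injectivity scales the whole solution by a. The
        quadratic part scales by a^2 and the linear part by a, which leaves a = 1.\<close>
      have "P' - smult a P = 0 \<and> Q' - smult a Q = 0"
      proof (rule kernel)
        show "degree (P' - smult a P) \<le> 1" "degree (Q' - smult a Q) \<le> 1"
          using PQ a0 by (auto intro!: degree_diff_le)
        show "A2 * (P' - smult a P) + A3 * (Q' - smult a Q) = 0"
          using g' by (simp add: algebra_simps smult_add_right)
      qed
      then have P': "P' = smult a P" "Q' = smult a Q" by auto
      have "quad_part P' Q' = smult (a\<^sup>2) (quad_part P Q)" unfolding P' by (rule quad_part_scale)
      moreover have "quad_part P Q = - (A2 * P + A3 * Q)" "quad_part P' Q' = - (A2 * P' + A3 * Q')" using z by (metis minus_unique)+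
      ultimately have "smult a (A2 * P + A3 * Q) = smult (a\<^sup>2) (A2 * P + A3 * Q)"
        unfolding g' by (simp only: smult_minus_right neg_equal_iff_equal)
      then have "smult (a - a\<^sup>2) (A2 * P + A3 * Q) = 0" by (simp add: smult_diff_left)
      moreover have "A2 * P + A3 * Q \<noteq> 0" using c f0 by auto
      ultimately have "a * (1 - a) = 0" by (simp add: power2_eq_square algebra_simps)
      then have "a = 1" using a0 by simp
      then show "P = P' \<and> Q = Q'" using P' by simp
    qed
    show "\<Theta> ` skew_sols = R"
    proof (intro equalityI subsetI)
      fix h assume "h \<in> \<Theta> ` skew_sols"
      then show "h \<in> R" using ex \<Theta> by force
    next
      fix h assume h: "h \<in> R"
      then have "h dvd f" unfolding R_def by blast
      then obtain g where "f = h * g" by (elim dvdE)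
      then have g: "f = g * h" by (simp only: mult.commute)
      obtain P Q c where s: "(P, Q) \<in> skew_sols" "c \<noteq> 0" "A2 * P + A3 * Q = smult c g"
        using factor_gives_sol[OF g] h unfolding R_def by blast
      have "rel P Q h" unfolding rel_def s(3) using h s(2) g unfolding R_def
        by (auto intro!: exI[of _ "inverse c"])
      then show "h \<in> \<Theta> ` skew_sols" using \<Theta>[of P Q h] s(1) by force
    qed
  qed
  then show ?thesis unfolding \<Theta>_def rel_def R_def .
qed

end

section \<open>Smoothness of the normalized cubic\<close>

text \<open>The Jacobian criterion for the cubic with coefficients a (of y2 * A2), b (of y3 * A3), and c, d (of x0 and x1
  in C0, C1, C2). The form itself has to be listed as well because of characteristic 3.\<close>
definition bihom_smooth :: "'a::field \<Rightarrow> 'a \<Rightarrow> 'a \<Rightarrow> 'a \<Rightarrow> 'a \<Rightarrow> 'a \<Rightarrow> 'a \<Rightarrow> 'a \<Rightarrow> 'a \<Rightarrow> 'a \<Rightarrow> 'a \<Rightarrow> 'a \<Rightarrow> bool" where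
  "bihom_smooth a0 a1 a2 b0 b1 b2 c0 c1 c2 d0 d1 d2 \<longleftrightarrow> (\<forall>x0 x1 x2 x3.
     2 * a0 * x0 * x2 + a1 * x1 * x2 + 2 * b0 * x0 * x3 + b1 * x1 * x3 + (c0 * x2\<^sup>2 + c1 * x2 * x3 + c2 * x3\<^sup>2) = 0 \<longrightarrow>
     a1 * x0 * x2 + 2 * a2 * x1 * x2 + b1 * x0 * x3 + 2 * b2 * x1 * x3 + (d0 * x2\<^sup>2 + d1 * x2 * x3 + d2 * x3\<^sup>2) = 0 \<longrightarrow>
     a0 * x0\<^sup>2 + a1 * x0 * x1 + a2 * x1\<^sup>2 + 2 * (c0 * x0 + d0 * x1) * x2 + (c1 * x0 + d1 * x1) * x3 = 0 \<longrightarrow>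
     b0 * x0\<^sup>2 + b1 * x0 * x1 + b2 * x1\<^sup>2 + (c1 * x0 + d1 * x1) * x2 + 2 * (c2 * x0 + d2 * x1) * x3 = 0 \<longrightarrow>
     x2 * (a0 * x0\<^sup>2 + a1 * x0 * x1 + a2 * x1\<^sup>2) + x3 * (b0 * x0\<^sup>2 + b1 * x0 * x1 + b2 * x1\<^sup>2)
       + ((c0 * x0 + d0 * x1) * x2\<^sup>2 + (c1 * x0 + d1 * x1) * x2 * x3 + (c2 * x0 + d2 * x1) * x3\<^sup>2) = 0 \<longrightarrow>
     x0 = 0 \<and> x1 = 0 \<and> x2 = 0 \<and> x3 = 0)"

lemma bihom_smooth_no_common_root:
  assumes "bihom_smooth a0 a1 a2 b0 b1 b2 c0 c1 c2 d0 d1 d2"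
    "a0 * s\<^sup>2 + a1 * s * t + a2 * t\<^sup>2 = 0" "b0 * s\<^sup>2 + b1 * s * t + b2 * t\<^sup>2 = 0"
  shows "s = 0 \<and> t = 0"
  \<comment> \<open>The variables first occur in the order x0, x2, x1, x3, so this is the point (s,
    t, 0, 0) of L.\<close>
  using assms(1)[unfolded bihom_smooth_def, rule_format, of s 0 t 0] assms(2,3) by simp

lemma bihom_smooth_point_M:
  assumes "bihom_smooth a0 a1 a2 b0 b1 b2 c0 c1 c2 d0 d1 d2"
    "c0 * v\<^sup>2 + c1 * v * w + c2 * w\<^sup>2 = 0" "d0 * v\<^sup>2 + d1 * v * w + d2 * w\<^sup>2 = 0"
  shows "v = 0 \<and> w = 0"
  using assms(1)[unfolded bihom_smooth_def, rule_format, of 0 v 0 w] assms(2,3) by simp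

lemma bihom_smooth_swap:
  assumes "bihom_smooth a0 a1 a2 b0 b1 b2 c0 c1 c2 d0 d1 d2"
  shows "bihom_smooth a2 a1 a0 b2 b1 b0 d0 d1 d2 c0 c1 c2"
  unfolding bihom_smooth_def
proof (intro allI impI, goal_cases)
  case (1 x0 x1 x2 x3)
  have "x1 = 0 \<and> x0 = 0 \<and> x2 = 0 \<and> x3 = 0"
    by (rule assms[unfolded bihom_smooth_def, rule_format]) (use 1 in \<open>simp_all add: ac_simps\<close>)
  then show ?case by blast
qed

text \<open>The singular point is on the transversal of the double root, at parameters (s, t) killing the derivatives
  in the y-directions.\<close>
lemma double_root_singular:
  fixes z :: "'a::field"
  assumes sm: "bihom_smooth a0 a1 a2 b0 b1 b2 c0 c1 c2 d0 d1 d2"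
    and \<alpha>2: "\<alpha>2 = a0 + a1 * z + a2 * z\<^sup>2" and \<alpha>3: "\<alpha>3 = b0 + b1 * z + b2 * z\<^sup>2"
    and p2: "p2 = a1 + 2 * a2 * z" and p3: "p3 = b1 + 2 * b2 * z"
    and \<gamma>: "\<gamma>0 = c0 + d0 * z" "\<gamma>1 = c1 + d1 * z" "\<gamma>2 = c2 + d2 * z"
    and f: "\<gamma>0 * \<alpha>3\<^sup>2 - \<gamma>1 * \<alpha>2 * \<alpha>3 + \<gamma>2 * \<alpha>2\<^sup>2 = 0"
    and f': "d0 * \<alpha>3\<^sup>2 - d1 * \<alpha>2 * \<alpha>3 + d2 * \<alpha>2\<^sup>2 + 2 * \<gamma>0 * \<alpha>3 * p3 - \<gamma>1 * (p2 * \<alpha>3 + \<alpha>2 * p3) + 2 * \<gamma>2 * \<alpha>2 * p2 = 0"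
  shows False
proof -
  have nz: "\<alpha>2 \<noteq> 0 \<or> \<alpha>3 \<noteq> 0"
    using bihom_smooth_no_common_root[OF sm, of 1 z] unfolding \<alpha>2 \<alpha>3 by auto
  \<comment> \<open>The point (s, s z, t \<alpha>3, - t \<alpha>2) moves along the transversal. Up
    to factors s and t, the conditions are the x2-, x3- and x1-derivatives; t nonzero keeps the
    point nonzero.\<close>
  have main: False if st: "s * \<alpha>2 + t * (2 * \<gamma>0 * \<alpha>3 - \<gamma>1 * \<alpha>2) = 0" "s * \<alpha>3 + t * (\<gamma>1 * \<alpha>3 - 2 * \<gamma>2 * \<alpha>2) = 0"
      "s * (\<alpha>3 * p2 - \<alpha>2 * p3) + t * (d0 * \<alpha>3\<^sup>2 - d1 * \<alpha>2 * \<alpha>3 + d2 * \<alpha>2\<^sup>2) = 0" and t: "t \<noteq> 0" for s t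
  proof -
    have "s = 0 \<and> s * z = 0 \<and> t * \<alpha>3 = 0 \<and> - t * \<alpha>2 = 0"
    proof (rule sm[unfolded bihom_smooth_def, rule_format])
      let ?D = "s * (\<alpha>3 * p2 - \<alpha>2 * p3) + t * (d0 * \<alpha>3\<^sup>2 - d1 * \<alpha>2 * \<alpha>3 + d2 * \<alpha>2\<^sup>2)"
      let ?f = "\<gamma>0 * \<alpha>3\<^sup>2 - \<gamma>1 * \<alpha>2 * \<alpha>3 + \<gamma>2 * \<alpha>2\<^sup>2"
      have a0: "a0 = \<alpha>2 - a1 * z - a2 * z\<^sup>2" and b0: "b0 = \<alpha>3 - b1 * z - b2 * z\<^sup>2"
        and c: "c0 = \<gamma>0 - d0 * z" "c1 = \<gamma>1 - d1 * z" "c2 = \<gamma>2 - d2 * z"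
        and a1: "a1 = p2 - 2 * a2 * z" and b1: "b1 = p3 - 2 * b2 * z"
        unfolding \<alpha>2 \<alpha>3 \<gamma> p2 p3 by simp_all
      have a1': "a1 * s + 2 * a2 * (s * z) = s * p2" and b1': "b1 * s + 2 * b2 * (s * z) = s * p3"
        unfolding p2 p3 by (simp_all add: algebra_simps)
      have a0': "2 * a0 * s + a1 * (s * z) = s * (2 * \<alpha>2 - z * p2)" and b0': "2 * b0 * s + b1 * (s * z) = s * (2 * \<alpha>3 - z * p3)"
        unfolding p2 p3 \<alpha>2 \<alpha>3 by (simp_all add: algebra_simps power2_eq_square)
      have A2: "a0 * s\<^sup>2 + a1 * s * (s * z) + a2 * (s * z)\<^sup>2 = s\<^sup>2 * \<alpha>2" 
        and A3: "b0 * s\<^sup>2 + b1 * s * (s * z) + b2 * (s * z)\<^sup>2 = s\<^sup>2 * \<alpha>3"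
        unfolding \<alpha>2 \<alpha>3 by (simp_all add: algebra_simps power2_eq_square)
      have g: "c0 * s + d0 * (s * z) = s * \<gamma>0" "c1 * s + d1 * (s * z) = s * \<gamma>1" "c2 * s + d2 * (s * z) = s * \<gamma>2"
        unfolding \<gamma> by (simp_all add: algebra_simps)
      have "a1 * s * (t * \<alpha>3) + 2 * a2 * (s * z) * (t * \<alpha>3) + b1 * s * (- t * \<alpha>2) + 2 * b2 * (s * z) * (- t * \<alpha>2) +
          (d0 * (t * \<alpha>3)\<^sup>2 + d1 * (t * \<alpha>3) * (- t * \<alpha>2) + d2 * (- t * \<alpha>2)\<^sup>2)
        = t * (\<alpha>3 * (a1 * s + 2 * a2 * (s * z)) - \<alpha>2 * (b1 * s + 2 * b2 * (s * z)) + t * (d0 * \<alpha>3\<^sup>2 - d1 * \<alpha>2 * \<alpha>3 + d2 * \<alpha>2\<^sup>2))"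
        by (simp add: algebra_simps power2_eq_square)
      also have "\<dots> = t * ?D" unfolding a1' b1' by (simp add: algebra_simps)
      also have "\<dots> = 0" using st(3) by simp
      finally show "a1 * s * (t * \<alpha>3) + 2 * a2 * (s * z) * (t * \<alpha>3) + b1 * s * (- t * \<alpha>2) + 2 * b2 * (s * z) * (- t * \<alpha>2) +
          (d0 * (t * \<alpha>3)\<^sup>2 + d1 * (t * \<alpha>3) * (- t * \<alpha>2) + d2 * (- t * \<alpha>2)\<^sup>2) = 0" .
      have "2 * a0 * s * (t * \<alpha>3) + a1 * (s * z) * (t * \<alpha>3) + 2 * b0 * s * (- t * \<alpha>2) + b1 * (s * z) * (- t * \<alpha>2) +
          (c0 * (t * \<alpha>3)\<^sup>2 + c1 * (t * \<alpha>3) * (- t * \<alpha>2) + c2 * (- t * \<alpha>2)\<^sup>2)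
        = t * (\<alpha>3 * (2 * a0 * s + a1 * (s * z)) - \<alpha>2 * (2 * b0 * s + b1 * (s * z)) + t * (c0 * \<alpha>3\<^sup>2 - c1 * \<alpha>2 * \<alpha>3 + c2 * \<alpha>2\<^sup>2))"
        by (simp add: algebra_simps power2_eq_square)
      \<comment> \<open>The x0-derivative follows from the x1-derivative and from f = 0, without
        dividing by the degree.\<close>
      also have "\<dots> = t * (t * ?f - z * ?D)" unfolding a0' b0' c by (simp add: algebra_simps power2_eq_square)
      also have "\<dots> = 0" unfolding f st(3) by simp
      finally show "2 * a0 * s * (t * \<alpha>3) + a1 * (s * z) * (t * \<alpha>3) + 2 * b0 * s * (- t * \<alpha>2) + b1 * (s * z) * (- t * \<alpha>2) +
          (c0 * (t * \<alpha>3)\<^sup>2 + c1 * (t * \<alpha>3) * (- t * \<alpha>2) + c2 * (- t * \<alpha>2)\<^sup>2) = 0" .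
      have "s\<^sup>2 * \<alpha>2 + 2 * (s * \<gamma>0) * (t * \<alpha>3) + (s * \<gamma>1) * (- t * \<alpha>2) = s * (s * \<alpha>2 + t * (2 * \<gamma>0 * \<alpha>3 - \<gamma>1 * \<alpha>2))"
        by (simp add: algebra_simps power2_eq_square)
      then show "a0 * s\<^sup>2 + a1 * s * (s * z) + a2 * (s * z)\<^sup>2 + 2 * (c0 * s + d0 * (s * z)) * (t * \<alpha>3) + (c1 * s + d1 * (s * z)) * (- t * \<alpha>2) = 0"
        unfolding A2 g st(1) by simp
      have "s\<^sup>2 * \<alpha>3 + (s * \<gamma>1) * (t * \<alpha>3) + 2 * (s * \<gamma>2) * (- t * \<alpha>2) = s * (s * \<alpha>3 + t * (\<gamma>1 * \<alpha>3 - 2 * \<gamma>2 * \<alpha>2))"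
        by (simp add: algebra_simps power2_eq_square)
      then show "b0 * s\<^sup>2 + b1 * s * (s * z) + b2 * (s * z)\<^sup>2 + (c1 * s + d1 * (s * z)) * (t * \<alpha>3) + 2 * (c2 * s + d2 * (s * z)) * (- t * \<alpha>2) = 0"
        unfolding A3 g st(2) by simp
      have "t * \<alpha>3 * (s\<^sup>2 * \<alpha>2) + - t * \<alpha>2 * (s\<^sup>2 * \<alpha>3) + (s * \<gamma>0 * (t * \<alpha>3)\<^sup>2 + s * \<gamma>1 * (t * \<alpha>3) * (- t * \<alpha>2) + s * \<gamma>2 * (- t * \<alpha>2)\<^sup>2)
        = s * t\<^sup>2 * ?f" by (simp add: algebra_simps power2_eq_square)
      then show "t * \<alpha>3 * (a0 * s\<^sup>2 + a1 * s * (s * z) + a2 * (s * z)\<^sup>2) + - t * \<alpha>2 * (b0 * s\<^sup>2 + b1 * s * (s * z) + b2 * (s * z)\<^sup>2) +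
          ((c0 * s + d0 * (s * z)) * (t * \<alpha>3)\<^sup>2 + (c1 * s + d1 * (s * z)) * (t * \<alpha>3) * (- t * \<alpha>2) + (c2 * s + d2 * (s * z)) * (- t * \<alpha>2)\<^sup>2) = 0"
        unfolding A2 A3 g f by simp
    qed
    then show False using t nz by simp
  qed
  show False
  proof (cases "\<alpha>2 = 0")
    case False
    \<comment> \<open>s and t solve the first equation identically. The second is then 2 f and the
      third a combination of f and f', in every characteristic.\<close>
    let ?s = "2 * \<gamma>0 * \<alpha>3 - \<gamma>1 * \<alpha>2" and ?t = "- \<alpha>2"
    show False
    proof (rule main[of ?s ?t])
      show "?s * \<alpha>2 + ?t * (2 * \<gamma>0 * \<alpha>3 - \<gamma>1 * \<alpha>2) = 0" by (simp add: algebra_simps)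
      have "?s * \<alpha>3 + ?t * (\<gamma>1 * \<alpha>3 - 2 * \<gamma>2 * \<alpha>2) = 2 * (\<gamma>0 * \<alpha>3\<^sup>2 - \<gamma>1 * \<alpha>2 * \<alpha>3 + \<gamma>2 * \<alpha>2\<^sup>2)"
        by (simp add: algebra_simps power2_eq_square)
      then show "?s * \<alpha>3 + ?t * (\<gamma>1 * \<alpha>3 - 2 * \<gamma>2 * \<alpha>2) = 0" unfolding f by simp
      have "?s * (\<alpha>3 * p2 - \<alpha>2 * p3) + ?t * (d0 * \<alpha>3\<^sup>2 - d1 * \<alpha>2 * \<alpha>3 + d2 * \<alpha>2\<^sup>2)
        = 2 * p2 * (\<gamma>0 * \<alpha>3\<^sup>2 - \<gamma>1 * \<alpha>2 * \<alpha>3 + \<gamma>2 * \<alpha>2\<^sup>2) - \<alpha>2 * (d0 * \<alpha>3\<^sup>2 - d1 * \<alpha>2 * \<alpha>3 + d2 * \<alpha>2\<^sup>2 + 2 * \<gamma>0 * \<alpha>3 * p3 - \<gamma>1 * (p2 * \<alpha>3 + \<alpha>2 * p3) + 2 * \<gamma>2 * \<alpha>2 * p2)"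
        by (simp add: algebra_simps power2_eq_square)
      then show "?s * (\<alpha>3 * p2 - \<alpha>2 * p3) + ?t * (d0 * \<alpha>3\<^sup>2 - d1 * \<alpha>2 * \<alpha>3 + d2 * \<alpha>2\<^sup>2) = 0" unfolding f f' by simp
      show "?t \<noteq> 0" using False by simp
    qed
  next
    case True
    then have n: "\<alpha>3 \<noteq> 0" using nz by simp
    let ?s = "\<gamma>1 * \<alpha>3 - 2 * \<gamma>2 * \<alpha>2" and ?t = "- \<alpha>3"
    show False
    proof (rule main[of ?s ?t])
      show "?s * \<alpha>3 + ?t * (\<gamma>1 * \<alpha>3 - 2 * \<gamma>2 * \<alpha>2) = 0" by (simp add: algebra_simps)
      have "?s * \<alpha>2 + ?t * (2 * \<gamma>0 * \<alpha>3 - \<gamma>1 * \<alpha>2) = - 2 * (\<gamma>0 * \<alpha>3\<^sup>2 - \<gamma>1 * \<alpha>2 * \<alpha>3 + \<gamma>2 * \<alpha>2\<^sup>2)"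
        by (simp add: algebra_simps power2_eq_square)
      then show "?s * \<alpha>2 + ?t * (2 * \<gamma>0 * \<alpha>3 - \<gamma>1 * \<alpha>2) = 0" unfolding f by simp
      have "?s * (\<alpha>3 * p2 - \<alpha>2 * p3) + ?t * (d0 * \<alpha>3\<^sup>2 - d1 * \<alpha>2 * \<alpha>3 + d2 * \<alpha>2\<^sup>2)
        = 2 * p3 * (\<gamma>0 * \<alpha>3\<^sup>2 - \<gamma>1 * \<alpha>2 * \<alpha>3 + \<gamma>2 * \<alpha>2\<^sup>2) - \<alpha>3 * (d0 * \<alpha>3\<^sup>2 - d1 * \<alpha>2 * \<alpha>3 + d2 * \<alpha>2\<^sup>2 + 2 * \<gamma>0 * \<alpha>3 * p3 - \<gamma>1 * (p2 * \<alpha>3 + \<alpha>2 * p3) + 2 * \<gamma>2 * \<alpha>2 * p2)"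
        by (simp add: algebra_simps power2_eq_square)
      then show "?s * (\<alpha>3 * p2 - \<alpha>2 * p3) + ?t * (d0 * \<alpha>3\<^sup>2 - d1 * \<alpha>2 * \<alpha>3 + d2 * \<alpha>2\<^sup>2) = 0" unfolding f f' by simp
      show "?t \<noteq> 0" using n by simp
    qed
  qed
qed

text \<open>The Sylvester resultant of two quadratics in terms of 2 by 2 minors. It carries the
  absence of common zeros over the closure to a Bezout identity over k.\<close>

definition quad_res :: "'a::comm_ring_1 \<Rightarrow> 'a \<Rightarrow> 'a \<Rightarrow> 'a \<Rightarrow> 'a \<Rightarrow> 'a \<Rightarrow> 'a" where
  "quad_res a0 a1 a2 b0 b1 b2 = (a0 * b2 - a2 * b0)\<^sup>2 - (a0 * b1 - a1 * b0) * (a1 * b2 - a2 * b1)"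

lemma quad_res_bezout:
  fixes a0 :: "'k::field"
  assumes "quad_res a0 a1 a2 b0 b1 b2 \<noteq> 0"
  shows "\<exists>U V. U * [:a0, a1, a2:] + V * [:b0, b1, b2:] = 1"
proof -
  define m12 where "m12 = a1 * b2 - a2 * b1"
  define m02 where "m02 = a0 * b2 - a2 * b0"
  let ?U = "[: m02 * b2 - m12 * b1, - m12 * b2 :]" and ?V = "[: m12 * a1 - m02 * a2, m12 * a2 :]"
  let ?R = "quad_res a0 a1 a2 b0 b1 b2"
  have "?U * [:a0, a1, a2:] + ?V * [:b0, b1, b2:] = [: ?R :]"
    unfolding quad_res_def m12_def m02_def by (simp add: algebra_simps power2_eq_square)
  then have "smult (inverse ?R) (?U * [:a0, a1, a2:] + ?V * [:b0, b1, b2:]) = 1"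
    using assms by (simp add: one_pCons)
  then have "smult (inverse ?R) ?U * [:a0, a1, a2:] + smult (inverse ?R) ?V * [:b0, b1, b2:] = 1"
    by (simp only: smult_add_right mult_smult_left)
  then show ?thesis by blast
qed

text \<open>With r and q the zeros of the first form, the resultant is a2^2 times the product of the
  values of the second form at them. For a2 = 0 a zero sits at (0, 1), and the other is (a1,
  -a0).\<close>

lemma quad_res_common_root:
  fixes a0 :: "'a::alg_closed_field"
  assumes R: "quad_res a0 a1 a2 b0 b1 b2 = 0"
  shows "\<exists>s t. (s \<noteq> 0 \<or> t \<noteq> 0) \<and> a0 * s\<^sup>2 + a1 * s * t + a2 * t\<^sup>2 = 0 \<and> b0 * s\<^sup>2 + b1 * s * t + b2 * t\<^sup>2 = 0"
proof -
  consider "a2 \<noteq> 0" | "a2 = 0" "a1 \<noteq> 0" | "a2 = 0" "a1 = 0" "a0 \<noteq> 0" | "a2 = 0" "a1 = 0" "a0 = 0" by blast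
  then show ?thesis
  proof cases
    case 1
    have "degree [:a0, a1, a2:] > 0" using 1 by simp
    then obtain r where r: "poly [:a0, a1, a2:] r = 0" using alg_closed_imp_poly_has_root by blast
    define q where "q = - a1 / a2 - r"
    have a1: "a1 = - a2 * (r + q)" unfolding q_def using 1 by (simp add: algebra_simps)
    have a0: "a0 = a2 * (r * q)"
    proof -
      have "a0 = - (r * a1 + r * r * a2)" using r by (simp add: algebra_simps eq_neg_iff_add_eq_0)
      then show ?thesis unfolding a1 by (simp add: algebra_simps)
    qed
    have "quad_res a0 a1 a2 b0 b1 b2 = a2 * a2 * ((b0 + b1 * r + b2 * r * r) * (b0 + b1 * q + b2 * q * q))"
      unfolding quad_res_def a1 a0 by (simp add: algebra_simps power2_eq_square)
    then have "b0 + b1 * r + b2 * r * r = 0 \<or> b0 + b1 * q + b2 * q * q = 0" using R 1 by simp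
    then obtain x where x: "x = r \<or> x = q" "b0 + b1 * x + b2 * x * x = 0" by blast
    have "a0 + a1 * x + a2 * x * x = 0" using x(1) unfolding a0 a1 by (auto simp: algebra_simps)
    then show ?thesis using x(2) by (intro exI[of _ 1] exI[of _ x]) (simp add: power2_eq_square mult.assoc)
  next
    case 2
    have "quad_res a0 a1 a2 b0 b1 b2 = b2 * (b0 * a1 * a1 - b1 * a0 * a1 + b2 * a0 * a0)"
      unfolding quad_res_def 2(1) by (simp add: algebra_simps power2_eq_square)
    then have "b2 = 0 \<or> b0 * a1 * a1 - b1 * a0 * a1 + b2 * a0 * a0 = 0" using R by simp
    then show ?thesis
    proof
      assume "b2 = 0"
      then show ?thesis using 2 by (intro exI[of _ 0] exI[of _ 1]) simp
    next
      assume "b0 * a1 * a1 - b1 * a0 * a1 + b2 * a0 * a0 = 0"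
      then show ?thesis using 2
        by (intro exI[of _ a1] exI[of _ "- a0"]) (simp add: power2_eq_square algebra_simps)
    qed
  next
    case 3
    then have "b2 = 0" using R unfolding quad_res_def by simp
    then show ?thesis using 3 by (intro exI[of _ 0] exI[of _ 1]) simp
  next
    case 4
    obtain s t where "s \<noteq> 0 \<or> t \<noteq> 0" "b0 * s ^ 2 + b1 * s * t + b2 * t ^ 2 = 0" by (rule quadratic_has_root)
    then show ?thesis using 4 by (intro exI[of _ s] exI[of _ t]) simp
  qed
qed

section \<open>Zeros over the closure and squarefreeness of the quintic\<close>

definition ac_eval :: "'k::field alg_closure \<Rightarrow> 'k poly \<Rightarrow> 'k alg_closure" where
  "ac_eval z p = poly (map_poly to_ac p) z"

lemma ac_eval_pCons [simp]: "ac_eval z (pCons a p) = to_ac a + z * ac_eval z p"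
  by (simp add: ac_eval_def map_poly_pCons)

lemma ac_eval_0 [simp]: "ac_eval z 0 = 0"
  by (simp add: ac_eval_def)

lemma ac_eval_add [simp]: "ac_eval z (p + q) = ac_eval z p + ac_eval z q"
  by (induction p q rule: poly_induct2) (simp_all add: algebra_simps)

lemma ac_eval_smult [simp]: "ac_eval z (smult a p) = to_ac a * ac_eval z p"
  by (induction p) (simp_all add: algebra_simps)

lemma ac_eval_mult [simp]: "ac_eval z (p * q) = ac_eval z p * ac_eval z q"
  by (induction p) (simp_all add: algebra_simps)

lemma ac_eval_diff [simp]: "ac_eval z (p - q) = ac_eval z p - ac_eval z q"
  using ac_eval_add[of z "p - q" q] by simp

lemma ac_eval_root:
  assumes "degree p > 0"
  shows "\<exists>z. ac_eval z p = 0"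
proof -
  have "degree (map_poly to_ac p) = degree p" by (rule degree_map_poly) simp
  then show ?thesis unfolding ac_eval_def using alg_closed_imp_poly_has_root[of "map_poly to_ac p"] assms by simp
qed

lemma transversal_quintic_squarefree:
  fixes a0 :: "'k::field"
  assumes sm: "bihom_smooth (to_ac a0) (to_ac a1) (to_ac a2) (to_ac b0) (to_ac b1) (to_ac b2)
     (to_ac c0) (to_ac c1) (to_ac c2) (to_ac d0) (to_ac d1) (to_ac d2)"
  defines "f \<equiv> [:c0, d0:] * [:b0, b1, b2:]\<^sup>2 - [:c1, d1:] * [:a0, a1, a2:] * [:b0, b1, b2:] + [:c2, d2:] * [:a0, a1, a2:]\<^sup>2"
  shows "degree f = 4 \<or> degree f = 5" and "coeff f 5 = d0 * b2\<^sup>2 - d1 * a2 * b2 + d2 * a2\<^sup>2"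
    and "\<And>h. h * h dvd f \<Longrightarrow> degree h = 0"
proof -
  \<comment> \<open>The two leading coefficients are the value and the derivative of the quintic at
    infinity; the coefficients in the middle can stay abstract.\<close>
  have fe: "f = [: c0 * b0\<^sup>2 - c1 * a0 * b0 + c2 * a0\<^sup>2, 
      d0 * b0\<^sup>2 - d1 * a0 * b0 + d2 * a0\<^sup>2 + 2 * c0 * b0 * b1 - c1 * (a1 * b0 + a0 * b1) + 2 * c2 * a0 * a1,
      coeff f 2, coeff f 3,
      c0 * b2\<^sup>2 - c1 * a2 * b2 + c2 * a2\<^sup>2 + 2 * d0 * b2 * b1 - d1 * (a1 * b2 + a2 * b1) + 2 * d2 * a2 * a1,
      d0 * b2\<^sup>2 - d1 * a2 * b2 + d2 * a2\<^sup>2 :]"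
    unfolding f_def by (simp add: power2_eq_square algebra_simps eval_nat_numeral)
  show c5: "coeff f 5 = d0 * b2\<^sup>2 - d1 * a2 * b2 + d2 * a2\<^sup>2"
    by (subst fe) (simp add: eval_nat_numeral)
  have c4: "coeff f 4 = c0 * b2\<^sup>2 - c1 * a2 * b2 + c2 * a2\<^sup>2 + 2 * d0 * b2 * b1 - d1 * (a1 * b2 + a2 * b1) + 2 * d2 * a2 * a1"
    by (subst fe) (simp add: eval_nat_numeral)
  have dle: "degree f \<le> 5" by (subst fe) (simp add: degree_pCons_le)
  \<comment> \<open>If both vanish, infinity is a double zero. Exchanging x0 and x1 moves it to 0,
    where the singular point is found.\<close>
  have "coeff f 5 \<noteq> 0 \<or> coeff f 4 \<noteq> 0"
  proof (rule ccontr)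
    assume "\<not> ?thesis"
    then have z: "to_ac (coeff f 5) = 0" "to_ac (coeff f 4) = 0" by simp_all
    show False
      by (rule double_root_singular[OF bihom_smooth_swap[OF sm], of "to_ac a2" 0 "to_ac b2" "to_ac a1" "to_ac b1" "to_ac d0" "to_ac d1" "to_ac d2"])
        (use z in \<open>simp_all add: c4 c5\<close>)
  qed
  then have "degree f \<ge> 4" using le_degree[of f 5] le_degree[of f 4] by linarith
  then show "degree f = 4 \<or> degree f = 5" using dle by linarith
  show "degree h = 0" if hh: "h * h dvd f" for h
  proof (rule ccontr)
    assume "degree h \<noteq> 0"
    \<comment> \<open>A zero of h over the closure is a common zero of f and its derivative, hence a
      double root.\<close>
    then obtain z where z: "ac_eval z h = 0" using ac_eval_root[of h] by auto
    obtain k where k: "f = h * h * k" using hh by (elim dvdE)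
    have e0: "ac_eval z f = 0" unfolding k using z by simp
    have "pderiv f = h * (pderiv h * k + pderiv h * k + h * pderiv k)"
      unfolding k by (simp add: pderiv_mult algebra_simps)
    then have e1: "ac_eval z (pderiv f) = 0" using z by simp
    have pd: "pderiv [:u, v:] = [:v:]" "pderiv [:u, v, w:] = [:v, 2 * w:]" for u v w :: 'k
      by (simp_all add: pderiv_pCons)
    have "pderiv f = [:d0:] * [:b0, b1, b2:]\<^sup>2 - [:d1:] * [:a0, a1, a2:] * [:b0, b1, b2:] + [:d2:] * [:a0, a1, a2:]\<^sup>2
       + [:2:] * [:c0, d0:] * [:b0, b1, b2:] * [:b1, 2 * b2:] 
       - [:c1, d1:] * ([:a1, 2 * a2:] * [:b0, b1, b2:] + [:a0, a1, a2:] * [:b1, 2 * b2:])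
       + [:2:] * [:c2, d2:] * [:a0, a1, a2:] * [:a1, 2 * a2:]"
    proof -
      have gen: "pderiv (C0 * B ^ 2 - C1 * A * B + C2 * A ^ 2) = pderiv C0 * B ^ 2 - pderiv C1 * A * B + pderiv C2 * A ^ 2
        + [:2:] * C0 * B * pderiv B - C1 * (pderiv A * B + A * pderiv B) + [:2:] * C2 * A * pderiv A" for A B C0 C1 C2 :: "'k poly"
        by (simp add: pderiv_mult pderiv_add pderiv_diff power2_eq_square algebra_simps numeral_poly[symmetric])
      show ?thesis unfolding f_def gen pd by simp
    qed
    then have e1': "ac_eval z ([:d0:] * [:b0, b1, b2:]\<^sup>2 - [:d1:] * [:a0, a1, a2:] * [:b0, b1, b2:] + [:d2:] * [:a0, a1, a2:]\<^sup>2
       + [:2:] * [:c0, d0:] * [:b0, b1, b2:] * [:b1, 2 * b2:] 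
       - [:c1, d1:] * ([:a1, 2 * a2:] * [:b0, b1, b2:] + [:a0, a1, a2:] * [:b1, 2 * b2:])
       + [:2:] * [:c2, d2:] * [:a0, a1, a2:] * [:a1, 2 * a2:]) = 0" using e1 by simp
    have ev: "ac_eval z [:u, v, w:] = to_ac u + to_ac v * z + to_ac w * z\<^sup>2" "ac_eval z [:u, v:] = to_ac u + to_ac v * z"
      "ac_eval z [:v, 2 * w:] = to_ac v + 2 * to_ac w * z" "ac_eval z [:u:] = to_ac u" for u v w
      by (simp_all add: power2_eq_square algebra_simps)
    have sq: "ac_eval z (p\<^sup>2) = (ac_eval z p)\<^sup>2" for p by (simp add: power2_eq_square)
    show False
      by (rule double_root_singular[OF sm refl refl refl refl refl refl refl, of z])
        (use e0[unfolded f_def] e1' in \<open>simp_all only: ac_eval_add ac_eval_diff ac_eval_mult sq ev to_ac_numeral to_ac_mult\<close>)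
  qed
qed

section \<open>Counting the lines\<close>

definition vec4_of :: "'k::zero \<Rightarrow> 'k \<Rightarrow> 'k \<Rightarrow> 'k \<Rightarrow> nat \<Rightarrow> 'k" where
  "vec4_of a b c d = (\<lambda>i. if i = 0 then a else if i = 1 then b else if i = 2 then c else if i = 3 then d else 0)"

lemma vec4_of_simps [simp]: "vec4_of a b c d 0 = a" "vec4_of a b c d (Suc 0) = b" "vec4_of a b c d 1 = b"
  "vec4_of a b c d 2 = c" "vec4_of a b c d 3 = d"
  by (simp_all add: vec4_of_def)

lemma vec4_of_eq_iff: "vec4_of a b c d = vec4_of a' b' c' d' \<longleftrightarrow> a = a' \<and> b = b' \<and> c = c' \<and> d = d'"
proof
  assume e: "vec4_of a b c d = vec4_of a' b' c' d'"
  show "a = a' \<and> b = b' \<and> c = c' \<and> d = d'"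
    using fun_cong[OF e, of 0] fun_cong[OF e, of 1] fun_cong[OF e, of 2] fun_cong[OF e, of 3] by simp
qed simp

lemma vec4_of_in_vec4: "vec4_of a b c d \<in> vec4"
  by (simp add: vec4_of_def vec4_def)

lemma vec4_eq_vec4_of: "x \<in> vec4 \<Longrightarrow> x = vec4_of (x 0) (x 1) (x 2) (x 3)"
  by (rule ext) (auto simp: vec4_of_def vec4_def eval_nat_numeral not_less_eq_eq le_Suc_eq Suc_le_eq less_Suc_eq)

lemma vec4_of_combine: "(\<lambda>i. s * vec4_of a b c d i + t * vec4_of a' b' c' d' i) =
    vec4_of (s * a + t * a') (s * b + t * b') (s * c + t * c') (s * d + t * d')" for s :: "'k::field"
  by (rule ext) (simp add: vec4_of_def)

lemma zero_eq_vec4_of: "(\<lambda>_. 0) = vec4_of 0 0 0 0"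
  by (rule ext) (simp add: vec4_of_def)

lemma span2_vec4_of_iff: "x \<in> span2 (vec4_of a b c d) (vec4_of a' b' c' d') \<longleftrightarrow>
    (\<exists>s t. x = vec4_of (s * a + t * a') (s * b + t * b') (s * c + t * c') (s * d + t * d'))" for a :: "'k::field"
  unfolding span2_iff vec4_of_combine ..

lemma lin_indep2_vec4_of: "lin_indep2 (vec4_of a b c d) (vec4_of a' b' c' d') \<longleftrightarrow>
    (\<forall>s t. s * a + t * a' = 0 \<and> s * b + t * b' = 0 \<and> s * c + t * c' = 0 \<and> s * d + t * d' = 0 \<longrightarrow> s = 0 \<and> t = 0)"
  for a :: "'k::field"
proof -
  have "(\<forall>i. s * vec4_of a b c d i + t * vec4_of a' b' c' d' i = 0) \<longleftrightarrow>
      s * a + t * a' = 0 \<and> s * b + t * b' = 0 \<and> s * c + t * c' = 0 \<and> s * d + t * d' = 0" for s t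
  proof -
    have "(\<forall>i. s * vec4_of a b c d i + t * vec4_of a' b' c' d' i = 0) \<longleftrightarrow>
        (\<lambda>i. s * vec4_of a b c d i + t * vec4_of a' b' c' d' i) = (\<lambda>_. 0)" by (simp add: fun_eq_iff)
    then show ?thesis unfolding vec4_of_combine zero_eq_vec4_of vec4_of_eq_iff .
  qed
  then show ?thesis unfolding lin_indep2_def by simp
qed

lemma axis4_eq_vec4_of: "axis4 0 = vec4_of 1 0 0 0" "axis4 1 = vec4_of 0 1 0 0" "axis4 2 = vec4_of 0 0 1 0" "axis4 3 = vec4_of 0 0 0 1"
  by (rule ext; simp add: axis4_def vec4_of_def)+

lemma normalized_count:
  fixes G :: "nat \<times> nat \<times> nat \<times> nat \<Rightarrow> 'k::field"
  assumes sm: "smooth_cubic_surface G"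
    and l01: "line_on_surface G (axis4 0) (axis4 1)" and l23: "line_on_surface G (axis4 2) (axis4 3)"
  shows "finite (k_lines G) \<and> card (k_lines G) \<in> {2, 3, 5, 7, 9, 15, 27}"
proof -
  have z: "G (3,0,0,0) = 0" "G (2,1,0,0) = 0" "G (1,2,0,0) = 0" "G (0,3,0,0) = 0"
      "G (0,0,3,0) = 0" "G (0,0,2,1) = 0" "G (0,0,1,2) = 0" "G (0,0,0,3) = 0"
    using l01 l23 unfolding line_axes by blast+
  note z = z z[unfolded One_nat_def]
  obtain a0 a1 a2 b0 b1 b2 c0 c1 c2 d0 d1 d2 where co: "G (2,0,1,0) = a0" "G (1,1,1,0) = a1" "G (0,2,1,0) = a2"
    "G (2,0,0,1) = b0" "G (1,1,0,1) = b1" "G (0,2,0,1) = b2" "G (1,0,2,0) = c0" "G (1,0,1,1) = c1" "G (1,0,0,2) = c2"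
    "G (0,1,2,0) = d0" "G (0,1,1,1) = d1" "G (0,1,0,2) = d2" by blast
  note co = co co[unfolded One_nat_def]
  have bs: "bihom_smooth (to_ac a0) (to_ac a1) (to_ac a2) (to_ac b0) (to_ac b1) (to_ac b2)
     (to_ac c0) (to_ac c1) (to_ac c2) (to_ac d0) (to_ac d1) (to_ac d2)"
    unfolding bihom_smooth_def
  proof (intro allI impI, goal_cases)
    case (1 x0 x1 x2 x3)
    have "vec4_of x0 x1 x2 x3 i = 0" if "i < 4" for i
    proof (rule smooth_no_singular_point[OF sm _ _ that])
      show "form_eval to_ac G (vec4_of x0 x1 x2 x3) = 0"
        using 1(5) unfolding form_eval_expand by (simp add: z co algebra_simps power2_eq_square)
      fix i :: nat assume "i < 4"
      then have "i = 0 \<or> i = 1 \<or> i = 2 \<or> i = 3" by linarith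
      then show "form_deriv_eval to_ac G i (vec4_of x0 x1 x2 x3) = 0"
      proof (elim disjE)
        assume i: "i = 0" show ?thesis using 1(1) unfolding i form_deriv_eval_expand by (simp add: z co algebra_simps power2_eq_square)
      next
        assume i: "i = 1" show ?thesis using 1(2) unfolding i form_deriv_eval_expand by (simp add: z co algebra_simps power2_eq_square)
      next
        assume i: "i = 2" show ?thesis using 1(3) unfolding i form_deriv_eval_expand by (simp add: z co algebra_simps power2_eq_square)
      next
        assume i: "i = 3" show ?thesis using 1(4) unfolding i form_deriv_eval_expand by (simp add: z co algebra_simps power2_eq_square)
      qed
    qed
    from this[of 0] this[of 1] this[of 2] this[of 3] show ?case by simp
  qed
  have line: "line_on_surface G (vec4_of p q r s) (vec4_of p' q' r' s') \<longleftrightarrow>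
     [:r, r':] * ([:a0:] * [:p, p':]\<^sup>2 + [:a1:] * [:p, p':] * [:q, q':] + [:a2:] * [:q, q':]\<^sup>2)
     + [:s, s':] * ([:b0:] * [:p, p':]\<^sup>2 + [:b1:] * [:p, p':] * [:q, q':] + [:b2:] * [:q, q':]\<^sup>2)
     + (([:c0:] * [:p, p':] + [:d0:] * [:q, q':]) * [:r, r':]\<^sup>2 + ([:c1:] * [:p, p':] + [:d1:] * [:q, q':]) * [:r, r':] * [:s, s':]
       + ([:c2:] * [:p, p':] + [:d2:] * [:q, q':]) * [:s, s':]\<^sup>2) = 0" (is "_ \<longleftrightarrow> ?E = 0") for p q r s p' q' r' s'
  proof -
    define x0 x1 x2 x3 where x: "x0 = [:p, p':]" "x1 = [:q, q':]" "x2 = [:r, r':]" "x3 = [:s, s':]"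
    have "form_eval (\<lambda>a. [:a:]) G (\<lambda>j. [:vec4_of p q r s j, vec4_of p' q' r' s' j:]) = ?E"
      unfolding form_eval_expand vec4_of_simps x[symmetric] z co
      by (simp only: pCons_0_0 mult_zero_left add_0_left add_0_right, simp only: power2_eq_square algebra_simps)
    then show ?thesis unfolding line_on_surface_def by simp
  qed
  define A2 A3 C0 C1 C2 where poly_defs: "A2 = [:a0, a1, a2:]" "A3 = [:b0, b1, b2:]" "C0 = [:c0, d0:]" "C1 = [:c1, d1:]" "C2 = [:c2, d2:]"
  define f where f: "f = C0 * A3\<^sup>2 - C1 * A2 * A3 + C2 * A2\<^sup>2"
  note fprops = transversal_quintic_squarefree[OF bs, folded poly_defs, folded f]
  have no_root: "s = 0 \<and> t = 0" if "a0 * s\<^sup>2 + a1 * s * t + a2 * t\<^sup>2 = 0" "b0 * s\<^sup>2 + b1 * s * t + b2 * t\<^sup>2 = 0" for s t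
    using bihom_smooth_no_common_root[OF bs, of "to_ac s" "to_ac t"] arg_cong[OF that(1), of to_ac] arg_cong[OF that(2), of to_ac] by simp
  \<comment> \<open>Common zeros are excluded over the closure, and the resultant already lies in k,
    so A2 and A3 are coprime over k.\<close>
  have "quad_res (to_ac a0) (to_ac a1) (to_ac a2) (to_ac b0) (to_ac b1) (to_ac b2) \<noteq> 0"
    using quad_res_common_root bihom_smooth_no_common_root[OF bs] by blast
  then have "to_ac (quad_res a0 a1 a2 b0 b1 b2) \<noteq> 0" by (simp add: quad_res_def)
  then have "quad_res a0 a1 a2 b0 b1 b2 \<noteq> 0" by (metis to_ac_0)
  then obtain U V where UV: "U * A2 + V * A3 = 1" using quad_res_bezout unfolding poly_defs by blast
  interpret skew_graphs A2 A3 C0 C1 C2 U V f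
  proof
    show "degree A2 \<le> 2" "degree A3 \<le> 2" "degree C0 \<le> 1" "degree C1 \<le> 1" "degree C2 \<le> 1"
      unfolding poly_defs by simp_all
    show "degree A2 = 2 \<or> degree A3 = 2" using no_root[of 0 1] unfolding poly_defs by auto
    show "U * A2 + V * A3 = 1" by (rule UV)
    show "f = C0 * A3\<^sup>2 - C1 * A2 * A3 + C2 * A2\<^sup>2" by (rule f)
    show "degree f = 4 \<or> degree f = 5" "\<And>h. h * h dvd f \<Longrightarrow> degree h = 0" by (rule fprops)+
    fix v w assume "smult (v\<^sup>2) C0 + smult (v * w) C1 + smult (w\<^sup>2) C2 = 0"
    then have e: "c0 * v\<^sup>2 + c1 * v * w + c2 * w\<^sup>2 = 0" "d0 * v\<^sup>2 + d1 * v * w + d2 * w\<^sup>2 = 0"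
      unfolding poly_defs by (simp_all add: ac_simps)
    show "v = 0 \<and> w = 0"
      using bihom_smooth_point_M[OF bs, of "to_ac v" "to_ac w"] arg_cong[OF e(1), of to_ac] arg_cong[OF e(2), of to_ac] by simp
  qed
  define L where "L = span2 (axis4 0) (axis4 1 :: nat \<Rightarrow> 'k)"
  define M where "M = span2 (axis4 2) (axis4 3 :: nat \<Rightarrow> 'k)"
  have inL: "x \<in> L \<longleftrightarrow> (\<exists>s t. x = vec4_of s t 0 0)" for x
    unfolding L_def axis4_eq_vec4_of span2_vec4_of_iff by simp
  have inM: "x \<in> M \<longleftrightarrow> (\<exists>s t. x = vec4_of 0 0 s t)" for x
    unfolding M_def axis4_eq_vec4_of span2_vec4_of_iff by simp
  have LM: "L \<in> k_lines G" "M \<in> k_lines G"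
    unfolding L_def M_def axis4_eq_vec4_of using l01[unfolded axis4_eq_vec4_of] l23[unfolded axis4_eq_vec4_of]
    by (simp_all add: span2_in_k_lines_iff vec4_of_in_vec4 lin_indep2_vec4_of)
  have skew: "\<not> meets L M"
    unfolding meets_def inL inM zero_eq_vec4_of by (auto simp: vec4_of_eq_iff)
  define T where "T = {N \<in> k_lines G. meets N L \<and> meets N M}"
  define S where "S = {N \<in> k_lines G. \<not> meets N L \<and> \<not> meets N M}"
  define \<alpha> where "\<alpha> s t = a0 * s\<^sup>2 + a1 * s * t + a2 * t\<^sup>2" for s t
  define \<beta> where "\<beta> s t = b0 * s\<^sup>2 + b1 * s * t + b2 * t\<^sup>2" for s t
  have nr: "\<alpha> s t \<noteq> 0 \<or> \<beta> s t \<noteq> 0" if "s \<noteq> 0 \<or> t \<noteq> 0" for s t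
    using no_root[of s t] that unfolding \<alpha>_def \<beta>_def by blast
  define \<phi> where "\<phi> s t = (c0 * s + d0 * t) * (\<beta> s t)\<^sup>2 - (c1 * s + d1 * t) * \<alpha> s t * \<beta> s t + (c2 * s + d2 * t) * (\<alpha> s t)\<^sup>2" for s t
  \<comment> \<open>A transversal through the point (s, t) of L can only meet M where \<alpha> y2 +
    \<beta> y3 = 0, that is in (\<beta>, -\<alpha>). It lies on the surface exactly when the quintic
    form \<phi> vanishes at (s, t).\<close>
  define tr where "tr s t = span2 (vec4_of s t 0 0) (vec4_of 0 0 (\<beta> s t) (- \<alpha> s t))" for s t
  have ind_tr: "lin_indep2 (vec4_of s t 0 0) (vec4_of 0 0 p q)" if "s \<noteq> 0 \<or> t \<noteq> 0" "p \<noteq> 0 \<or> q \<noteq> 0" for s t p q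
    unfolding lin_indep2_vec4_of using that by auto
  have line_tr: "line_on_surface G (vec4_of s t 0 0) (vec4_of 0 0 p q) \<longleftrightarrow> p * \<alpha> s t + q * \<beta> s t = 0 \<and>
     (c0 * s + d0 * t) * p\<^sup>2 + (c1 * s + d1 * t) * p * q + (c2 * s + d2 * t) * q\<^sup>2 = 0" for s t p q
    unfolding line \<alpha>_def \<beta>_def by (simp add: power2_eq_square algebra_simps)
  have tr_T: "tr s t \<in> T" if st: "s \<noteq> 0 \<or> t \<noteq> 0" "\<phi> s t = 0" for s t
  proof -
    have n: "\<beta> s t \<noteq> 0 \<or> - \<alpha> s t \<noteq> 0" using nr[of s t] st by auto
    have "tr s t \<in> k_lines G"
      unfolding tr_def span2_in_k_lines_iff[OF vec4_of_in_vec4 vec4_of_in_vec4 ind_tr[OF st(1) n]] line_tr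
      using st(2) unfolding \<phi>_def by (simp add: algebra_simps)
    moreover have "meets (tr s t) L" unfolding meets_def
      using st(1) by (intro exI[of _ "vec4_of s t 0 0"]) (simp add: tr_def span2_base inL vec4_of_eq_iff zero_eq_vec4_of)
    moreover have "meets (tr s t) M" unfolding meets_def
      using n by (intro exI[of _ "vec4_of 0 0 (\<beta> s t) (- \<alpha> s t)"]) (simp add: tr_def span2_base inM vec4_of_eq_iff zero_eq_vec4_of)
    ultimately show ?thesis unfolding T_def by simp
  qed
  have T_tr: "\<exists>s t. (s \<noteq> 0 \<or> t \<noteq> 0) \<and> \<phi> s t = 0 \<and> N = tr s t" if N: "N \<in> T" for N
  proof -
    have N': "N \<in> k_lines G" using N unfolding T_def by simp
    obtain s t where st: "vec4_of s t 0 0 \<in> N" "s \<noteq> 0 \<or> t \<noteq> 0"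
      using N unfolding T_def meets_def inL zero_eq_vec4_of by (auto simp: vec4_of_eq_iff)
    obtain p q where pq: "vec4_of 0 0 p q \<in> N" "p \<noteq> 0 \<or> q \<noteq> 0"
      using N unfolding T_def meets_def inM zero_eq_vec4_of by (auto simp: vec4_of_eq_iff)
    note Nb = k_lines_basis[OF N' st(1) pq(1) ind_tr[OF st(2) pq(2)]]
    have e: "p * \<alpha> s t + q * \<beta> s t = 0" "(c0 * s + d0 * t) * p\<^sup>2 + (c1 * s + d1 * t) * p * q + (c2 * s + d2 * t) * q\<^sup>2 = 0"
      using Nb(4) unfolding line_tr by blast+
    have n: "\<beta> s t \<noteq> 0 \<or> \<alpha> s t \<noteq> 0" using nr[of s t] st by auto
    \<comment> \<open>(p, q) and (\<beta>, -\<alpha>) are nonzero zeros of the same nonzero linear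
      form, hence proportional.\<close>
    obtain l where l: "\<beta> s t = l * p" "- \<alpha> s t = l * q"
    proof (cases "p = 0")
      case True
      then have "q \<noteq> 0" "\<beta> s t = 0" using pq(2) e(1) by auto
      then show ?thesis using that[of "- \<alpha> s t / q"] True by simp
    next
      case False
      have "\<beta> s t * q = - \<alpha> s t * p" using e(1) by (simp add: eq_neg_iff_add_eq_0 algebra_simps)
      then show ?thesis using that[of "\<beta> s t / p"] False by (simp add: eq_divide_eq)
    qed
    have l0: "l \<noteq> 0" using l n by auto
    have \<alpha>': "\<alpha> s t = - (l * q)" using l(2) by (metis minus_minus)
    have "\<phi> s t = l\<^sup>2 * ((c0 * s + d0 * t) * p\<^sup>2 + (c1 * s + d1 * t) * p * q + (c2 * s + d2 * t) * q\<^sup>2)"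
      unfolding \<phi>_def l(1) \<alpha>' by (simp add: power2_eq_square algebra_simps)
    then have "\<phi> s t = 0" using e(2) by simp
    moreover have "tr s t = span2 (vec4_of s t 0 0) (vec4_of 0 0 p q)"
      unfolding tr_def
    proof (rule span2_eqI)
      show "vec4_of 0 0 (\<beta> s t) (- \<alpha> s t) \<in> span2 (vec4_of s t 0 0) (vec4_of 0 0 p q)"
        unfolding span2_vec4_of_iff l by (intro exI[of _ 0] exI[of _ l]) simp
      show "lin_indep2 (vec4_of s t 0 0) (vec4_of 0 0 (\<beta> s t) (- \<alpha> s t))" using n by (intro ind_tr st(2)) auto
    qed (rule span2_base)
    ultimately show ?thesis using st(2) Nb(1) by auto
  qed
  have tr_scale: "tr (c * s) (c * t) = tr s t" if c: "c \<noteq> 0" "s \<noteq> 0 \<or> t \<noteq> 0" for c s t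
    unfolding tr_def
  proof (rule span2_eqI)
    have h: "\<beta> (c * s) (c * t) = c\<^sup>2 * \<beta> s t" "\<alpha> (c * s) (c * t) = c\<^sup>2 * \<alpha> s t"
      unfolding \<alpha>_def \<beta>_def by (simp_all add: power2_eq_square algebra_simps)
    show "vec4_of (c * s) (c * t) 0 0 \<in> span2 (vec4_of s t 0 0) (vec4_of 0 0 (\<beta> s t) (- \<alpha> s t))"
      unfolding span2_vec4_of_iff by (intro exI[of _ c] exI[of _ 0]) simp
    show "vec4_of 0 0 (\<beta> (c * s) (c * t)) (- \<alpha> (c * s) (c * t)) \<in> span2 (vec4_of s t 0 0) (vec4_of 0 0 (\<beta> s t) (- \<alpha> s t))"
      unfolding span2_vec4_of_iff h by (intro exI[of _ 0] exI[of _ "c\<^sup>2"]) simp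
    show "lin_indep2 (vec4_of (c * s) (c * t) 0 0) (vec4_of 0 0 (\<beta> (c * s) (c * t)) (- \<alpha> (c * s) (c * t)))"
      using nr[of s t] c unfolding h by (intro ind_tr) auto
  qed
  have \<phi>_scale: "\<phi> (c * s) (c * t) = c ^ 5 * \<phi> s t" for c s t
  proof -
    have h: "\<beta> (c * s) (c * t) = c\<^sup>2 * \<beta> s t" "\<alpha> (c * s) (c * t) = c\<^sup>2 * \<alpha> s t"
      unfolding \<alpha>_def \<beta>_def by (simp_all add: power2_eq_square algebra_simps)
    show ?thesis unfolding \<phi>_def h by (simp add: eval_nat_numeral algebra_simps)
  qed
  have tr_eq: "s * t' = t * s'" if e: "tr s t = tr s' t'" for s t s' t'
  proof -
    have "vec4_of s' t' 0 0 \<in> tr s' t'" unfolding tr_def by (rule span2_base)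
    then have "vec4_of s' t' 0 0 \<in> tr s t" by (simp only: e)
    then show ?thesis unfolding tr_def span2_vec4_of_iff by (auto simp: vec4_of_eq_iff)
  qed
  define Z where "Z = {z. poly f z = 0}"
  have \<phi>1: "\<phi> 1 z = poly f z" for z
    unfolding f poly_defs \<phi>_def \<alpha>_def \<beta>_def by (simp add: power2_eq_square algebra_simps)
  have \<phi>0: "\<phi> 0 1 = coeff f 5" unfolding fprops(2) \<phi>_def \<alpha>_def \<beta>_def by simp
  have deg4: "\<phi> 0 1 = 0 \<longleftrightarrow> degree f = 4"
  proof -
    have "coeff f 5 \<noteq> 0" if "degree f = 5"
      using that leading_coeff_0_iff[of f] by (metis degree_0 zero_neq_numeral)
    then show ?thesis unfolding \<phi>0 using df by (auto simp: coeff_eq_0)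
  qed
  have TZ: "T = tr 1 ` Z \<union> (if degree f = 4 then {tr 0 1} else {})"
  proof (intro equalityI subsetI)
    fix N assume "N \<in> T"
    then obtain s t where st: "s \<noteq> 0 \<or> t \<noteq> 0" "\<phi> s t = 0" "N = tr s t" using T_tr by blast
    show "N \<in> tr 1 ` Z \<union> (if degree f = 4 then {tr 0 1} else {})"
    proof (cases "s = 0")
      case True
      then have "t \<noteq> 0" using st by simp
      then have "N = tr 0 1" "\<phi> 0 1 = 0" using tr_scale[of t 0 1] \<phi>_scale[of t 0 1] st True by simp_all
      then show ?thesis using deg4 by simp
    next
      case False
      then have "N = tr 1 (t / s)" "\<phi> 1 (t / s) = 0" using tr_scale[of s 1 "t / s"] \<phi>_scale[of s 1 "t / s"] st by simp_all
      then show ?thesis unfolding \<phi>1 Z_def by blast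
    qed
  next
    fix N assume "N \<in> tr 1 ` Z \<union> (if degree f = 4 then {tr 0 1} else {})"
    then show "N \<in> T" using tr_T[of 1] tr_T[of 0 1] deg4 \<phi>1 unfolding Z_def by (auto split: if_splits)
  qed
  define R where "R = {h. lead_coeff h = 1 \<and> h dvd f \<and> degree h \<le> 2 \<and> degree f \<le> 3 + degree h}"
  have count: "finite Z" "finite R" "2 + 3 * (card Z + (5 - degree f)) + card R \<in> {2, 3, 5, 7, 9, 15, 27}"
    using quintic_factor_count[OF df sq] unfolding Z_def R_def by blast+
  have T: "finite T" "card T = card Z + (5 - degree f)"
  proof -
    have inj: "inj_on (tr 1) Z" by (rule inj_onI, drule tr_eq) simp
    have "tr 0 1 \<notin> tr 1 ` Z" using tr_eq[of 0 1 1] by auto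
    then show "finite T" "card T = card Z + (5 - degree f)"
      unfolding TZ using count(1) df card_image[OF inj] by auto
  qed
  \<comment> \<open>A line skew to M is the graph of a linear map from L; its basis is normalized to
    start with (1, 0) and (0, 1).\<close>
  define gr where "gr = (\<lambda>(P, Q). span2 (vec4_of 1 0 (coeff P 0) (coeff Q 0)) (vec4_of 0 1 (coeff P 1) (coeff Q (1::nat))) :: (nat \<Rightarrow> 'k) set)"
  have ind_gr: "lin_indep2 (vec4_of 1 0 p q) (vec4_of 0 1 r s)" for p q r s :: 'k
    unfolding lin_indep2_vec4_of by simp
  have line_gr: "line_on_surface G (vec4_of 1 0 p q) (vec4_of 0 1 r s) \<longleftrightarrow> A2 * [:p, r:] + A3 * [:q, s:] + quad_part [:p, r:] [:q, s:] = 0"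
    for p q r s
  proof -
    have x: "[:1, 0:] = (1::'k poly)" by simp
    have e: "[:a0:] * [:1, 0:]\<^sup>2 + [:a1:] * [:1, 0:] * [:0, 1:] + [:a2:] * [:0, 1:]\<^sup>2 = A2"
      "[:b0:] * [:1, 0:]\<^sup>2 + [:b1:] * [:1, 0:] * [:0, 1:] + [:b2:] * [:0, 1:]\<^sup>2 = A3"
      "[:c0:] * [:1, 0:] + [:d0:] * [:0, 1:] = C0" "[:c1:] * [:1, 0:] + [:d1:] * [:0, 1:] = C1" "[:c2:] * [:1, 0:] + [:d2:] * [:0, 1:] = C2"
      unfolding poly_defs by (simp_all add: power2_eq_square)
    show ?thesis unfolding line e quad_part_def by (simp only: mult.commute[of _ A2] mult.commute[of _ A3])
  qed
  have gr_skewM: "\<not> meets (span2 (vec4_of 1 0 p q) (vec4_of 0 1 r s)) M" for p q r s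
    unfolding meets_def inM span2_vec4_of_iff zero_eq_vec4_of by (auto simp: vec4_of_eq_iff)
  have gr_skewL: "\<not> meets (span2 (vec4_of 1 0 p q) (vec4_of 0 1 r s)) L \<longleftrightarrow> p * s - r * q \<noteq> 0" for p q r s
  proof
    assume nm: "\<not> meets (span2 (vec4_of 1 0 p q) (vec4_of 0 1 r s)) L"
    have n: "x = 0 \<and> y = 0" if xy: "x * p + y * r = 0" "x * q + y * s = 0" for x y
    proof -
      have "vec4_of x y 0 0 \<in> span2 (vec4_of 1 0 p q) (vec4_of 0 1 r s)"
        unfolding span2_vec4_of_iff by (rule exI[of _ x], rule exI[of _ y]) (simp add: xy)
      moreover have "vec4_of x y 0 0 \<in> L" unfolding inL by blast
      ultimately have "vec4_of x y 0 0 = (\<lambda>_. 0)" using nm unfolding meets_def by blast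
      then show ?thesis unfolding zero_eq_vec4_of vec4_of_eq_iff by blast
    qed
    show "p * s - r * q \<noteq> 0"
    proof
      assume d: "p * s - r * q = 0"
      have "r = 0 \<and> - p = 0" by (rule n) (use d in \<open>simp_all add: algebra_simps\<close>)
      moreover have "s = 0 \<and> - q = 0" by (rule n) (use d in \<open>simp_all add: algebra_simps\<close>)
      ultimately show False using n[of 1 0] by simp
    qed
  next
    assume d: "p * s - r * q \<noteq> 0"
    have n: "x = 0 \<and> y = 0" if "x * p + y * r = 0" "x * q + y * s = 0" for x y
    proof -
      have "x * (p * s - r * q) = s * (x * p + y * r) - r * (x * q + y * s)"
        "y * (p * s - r * q) = p * (x * q + y * s) - q * (x * p + y * r)" by (simp_all add: algebra_simps)
      then show ?thesis using that d by simp
    qed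
    show "\<not> meets (span2 (vec4_of 1 0 p q) (vec4_of 0 1 r s)) L"
    proof
      assume "meets (span2 (vec4_of 1 0 p q) (vec4_of 0 1 r s)) L"
      then obtain w x y x' y' where w: "w \<noteq> vec4_of 0 0 0 0" "w = vec4_of x' y' 0 0"
        "w = vec4_of (x * 1 + y * 0) (x * 0 + y * 1) (x * p + y * r) (x * q + y * s)"
        unfolding meets_def inL span2_vec4_of_iff zero_eq_vec4_of by blast
      then have "x * p + y * r = 0" "x * q + y * s = 0" by (simp_all only: vec4_of_eq_iff)
      then have "x = 0 \<and> y = 0" by (rule n)
      then show False using w(1,3) by simp
    qed
  qed
  have S_gr: "S = gr ` skew_sols"
  proof (intro equalityI subsetI)
    fix N assume N: "N \<in> S"
    then have N': "N \<in> k_lines G" "\<not> meets N L" "\<not> meets N M" unfolding S_def by auto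
    obtain u v where uv: "N = span2 u v" "u \<in> vec4" "v \<in> vec4" "lin_indep2 u v" using N'(1) by (rule k_linesE)
    obtain x0 x1 x2 x3 where u: "u = vec4_of x0 x1 x2 x3" using vec4_eq_vec4_of[OF uv(2)] by blast
    obtain y0 y1 y2 y3 where v: "v = vec4_of y0 y1 y2 y3" using vec4_eq_vec4_of[OF uv(3)] by blast
    define D where "D = x0 * y1 - x1 * y0"
    \<comment> \<open>A combination with vanishing first two coordinates is a point of M, and N
      misses M; so the projection of N to L is injective.\<close>
    have n: "s = 0 \<and> t = 0" if "s * x0 + t * y0 = 0" "s * x1 + t * y1 = 0" for s t
    proof (rule ccontr)
      assume st: "\<not> (s = 0 \<and> t = 0)"
      let ?w = "vec4_of (s * x0 + t * y0) (s * x1 + t * y1) (s * x2 + t * y2) (s * x3 + t * y3)"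
      have "?w \<in> N" unfolding uv(1) u v span2_vec4_of_iff by blast
      moreover have "?w \<in> M" unfolding inM that by blast
      moreover have "?w \<noteq> (\<lambda>_. 0)" unfolding zero_eq_vec4_of vec4_of_eq_iff
        using uv(4) st unfolding u v lin_indep2_vec4_of by blast
      ultimately show False using N'(3) unfolding meets_def by blast
    qed
    have D: "D \<noteq> 0"
    proof
      assume d: "D = 0"
      have "y0 = 0 \<and> - x0 = 0" by (rule n) (use d in \<open>simp_all add: D_def algebra_simps\<close>)
      moreover have "y1 = 0 \<and> - x1 = 0" by (rule n) (use d in \<open>simp_all add: D_def algebra_simps\<close>)
      ultimately show False using n[of 1 0] by simp
    qed
    \<comment> \<open>The inverse of the first 2 by 2 block, with determinant D, applied to the
      second block brings the basis of N into graph form.\<close>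
    define p q r s where pqrs: "p = (y1 * x2 - x1 * y2) / D" "q = (y1 * x3 - x1 * y3) / D"
      "r = (x0 * y2 - y0 * x2) / D" "s = (x0 * y3 - y0 * x3) / D"
    have mem: "vec4_of 1 0 p q \<in> N" "vec4_of 0 1 r s \<in> N"
    proof -
      have D1: "y1 / D * x0 + - x1 / D * y0 = 1" "- y0 / D * x1 + x0 / D * y1 = 1"
        using D unfolding D_def by (simp_all add: diff_divide_distrib[symmetric] mult.commute)
      show "vec4_of 1 0 p q \<in> N" unfolding uv(1) u v span2_vec4_of_iff
        by (rule exI[of _ "y1 / D"], rule exI[of _ "- x1 / D"], unfold vec4_of_eq_iff D1 pqrs)
          (simp add: diff_divide_distrib mult.commute)
      show "vec4_of 0 1 r s \<in> N" unfolding uv(1) u v span2_vec4_of_iff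
        by (rule exI[of _ "- y0 / D"], rule exI[of _ "x0 / D"], unfold vec4_of_eq_iff D1 pqrs)
          (simp add: diff_divide_distrib mult.commute)
    qed
    note Nb = k_lines_basis[OF N'(1) mem ind_gr]
    have "([:p, r:], [:q, s:]) \<in> skew_sols"
      using Nb(4) N'(2) unfolding line_gr Nb(1) gr_skewL skew_sols_def graph_det_def by simp
    moreover have "N = gr ([:p, r:], [:q, s:])" unfolding gr_def using Nb(1) by simp
    ultimately show "N \<in> gr ` skew_sols" by blast
  next
    fix N assume "N \<in> gr ` skew_sols"
    then obtain P Q where PQ: "(P, Q) \<in> skew_sols" "N = gr (P, Q)" by auto
    then obtain p r q s where P: "P = [:p, r:]" and Q: "Q = [:q, s:]"
      using degree_le_1_coeffs unfolding skew_sols_def by blast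
    have Ne: "N = span2 (vec4_of 1 0 p q) (vec4_of 0 1 r s)" unfolding PQ(2) gr_def P Q by simp
    have "line_on_surface G (vec4_of 1 0 p q) (vec4_of 0 1 r s)" "p * s - r * q \<noteq> 0"
      using PQ(1) unfolding line_gr P Q skew_sols_def graph_det_def by simp_all
    then show "N \<in> S" unfolding S_def Ne using gr_skewM gr_skewL
      by (simp add: span2_in_k_lines_iff[OF vec4_of_in_vec4 vec4_of_in_vec4 ind_gr])
  qed
  have inj_gr: "inj_on gr skew_sols"
  proof (rule inj_onI, clarify)
    fix P Q P' Q' assume s: "(P, Q) \<in> skew_sols" "(P', Q') \<in> skew_sols" and e: "gr (P, Q) = gr (P', Q')"
    obtain p r q s where P: "P = [:p, r:]" and Q: "Q = [:q, s:]"
      using degree_le_1_coeffs s(1) unfolding skew_sols_def by blast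
    obtain p' r' q' s' where P': "P' = [:p', r':]" and Q': "Q' = [:q', s':]"
      using degree_le_1_coeffs s(2) unfolding skew_sols_def by blast
    have g: "gr (P, Q) = span2 (vec4_of 1 0 p q) (vec4_of 0 1 r s)" "gr (P', Q') = span2 (vec4_of 1 0 p' q') (vec4_of 0 1 r' s')"
      unfolding gr_def P Q P' Q' by simp_all
    have "vec4_of 1 0 p q \<in> span2 (vec4_of 1 0 p' q') (vec4_of 0 1 r' s')"
      "vec4_of 0 1 r s \<in> span2 (vec4_of 1 0 p' q') (vec4_of 0 1 r' s')"
      using e unfolding g by (metis span2_base)+
    then show "P = P' \<and> Q = Q'"
      unfolding span2_vec4_of_iff P Q P' Q' by (auto simp: vec4_of_eq_iff)
  qed
  have "finite S" "card S = card R"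
    unfolding S_gr using bij_betw_finite[OF sols_bij_factors] bij_betw_same_card[OF sols_bij_factors] count(2)
    by (simp_all add: card_image[OF inj_gr] R_def)
  then show ?thesis
    using card_skew[OF sm LM skew, folded T_def S_def] T count(3) by simp
qed

theorem theorem1p2:
  fixes F :: "nat \<times> nat \<times> nat \<times> nat \<Rightarrow> 'k::field"
  assumes "smooth_cubic_surface F"
  shows "finite (k_lines F) \<and> card (k_lines F) \<in> {0, 1, 2, 3, 5, 7, 9, 15, 27}"
proof (cases "\<forall>L M. L \<in> k_lines F \<longrightarrow> M \<in> k_lines F \<longrightarrow> meets L M")
  case True
  then show ?thesis using card_no_skew[OF assms] by auto
next
  case False
  then obtain L M where L: "L \<in> k_lines F" and M: "M \<in> k_lines F" and skew: "\<not> meets L M" by blast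
  obtain u v where u: "L = span2 u v" "u \<in> vec4" "v \<in> vec4" "lin_indep2 u v" "line_on_surface F u v" using L by (rule k_linesE)
  obtain x y where x: "M = span2 x y" "x \<in> vec4" "y \<in> vec4" "lin_indep2 x y" "line_on_surface F x y" using M by (rule k_linesE)
  let ?u = "frame4 u v x y"
  \<comment> \<open>Bases of skew lines combine to a basis of \<open>k^4\<close>: a linear relation
    equates a vector of L with one of M, so both are 0.\<close>
  have b: "basis4 ?u"
  proof (rule basis4I)
    show "?u i \<in> vec4" for i using u x by (simp add: frame4_def)
    fix w :: "nat \<Rightarrow> 'k" and i :: nat
    assume w: "\<And>j. j < 4 \<Longrightarrow> lin_map ?u w j = 0" and i: "i < 4"
    have e: "w 0 * u j + w 1 * v j + w 2 * x j + w 3 * y j = 0" for j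
      using w[of j] u x by (cases "j < 4") (auto simp: lin_map_def sum_less4 vec4_def)
    let ?p = "\<lambda>j. w 0 * u j + w 1 * v j"
    have pM: "?p = (\<lambda>j. (- w 2) * x j + (- w 3) * y j)"
      using e by (auto simp: fun_eq_iff eq_neg_iff_add_eq_0 algebra_simps)
    have "?p \<in> L" unfolding u(1) by (rule span2_memI)
    moreover have "?p \<in> M" unfolding x(1) pM by (rule span2_memI)
    ultimately have p0: "?p = (\<lambda>_. 0)" using skew unfolding meets_def by blast
    then have "w 0 = 0 \<and> w 1 = 0" using u(4) unfolding lin_indep2_def by (metis (no_types))
    moreover have "- w 2 = 0 \<and> - w 3 = 0" using x(4) p0 unfolding pM lin_indep2_def by (metis (no_types))
    ultimately show "w i = 0" using i by (auto simp: eval_nat_numeral less_Suc_eq)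
  qed
  have "finite (k_lines (form_subst F ?u)) \<and> card (k_lines (form_subst F ?u)) \<in> {2, 3, 5, 7, 9, 15, 27}"
    by (rule normalized_count[OF smooth_form_subst[OF assms b]])
      (use u(5) x(5) in \<open>simp_all add: line_on_form_subst lin_map_axis4\<close>)
  then show ?thesis
    using bij_betw_finite[OF k_lines_form_subst[OF b, of F]] bij_betw_same_card[OF k_lines_form_subst[OF b, of F]] by auto
qed

end
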